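(* There exist an absolute constant $c>0$ and a fixed polynomial $\mathrm{poly}(\cdot)$ such that the following holds for any $\delta\in(0,1]$, $\epsilon>0$, $\alpha>0$, any positive integers $S,A,O,H,K$ and any integer $1\le m\le H$ with $$K\ge \mathrm{poly}\left(S,A^m,O,H,\alpha^{-1},\log(\epsilon^{-1}\delta^{-1})\right)\cdot\epsilon^{-2}.$$ Run multi-step OMLE (defined in the context) for $K$ iterations with inputs $m,\alpha$ and $\beta = c\left(H(S^2A+SO)\log(SAOHK)+\log(KH/\delta)\right)$. Then for any POMDP with $S$ states, $A$ actions, $O$ observations and horizon $H$ whose $m$-step emission-action matrices satisfy $\min_{h\in[H-m+1]}\sigma_S(\mathbb M_h)\ge\alpha$, with probability at least $1-\delta$, the uniform mixture of the optimistic policies $\pi^1,\dots,\pi^K$ computed by multi-step OMLE is $\epsilon$-optimal, i.e. $$\frac1K\sum_{k=1}^K V^{\pi^k}\ge V^\star-\epsilon.$$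
   Context: Notation: $[n]=\{1,\dots,n\}$; $\Delta_X$ is the set of probability distributions on a finite set $X$; $\sigma_j(M)$ is the $j$-th largest singular value of $M$ (equal to $0$ if $M$ has fewer than $j$ rows or columns). POMDP: a tuple $(\mathscr S,\mathscr A,\mathscr O;H,\mu_1,\mathbb T,\mathbb O;r)$ with finite sets of states, actions, observations of sizes $S,A,O$; horizon $H$; initial state distribution $\mu_1\in\Delta_{\mathscr S}$; transition matrices $\mathbb T_{h,a}\in\mathbb R^{S\times S}$ ($h\in[H-1],a\in\mathscr A$), where $\mathbb T_{h,a}(\cdot\mid s)$ is the distribution of the next state; emission matrices $\mathbb O_h\in\mathbb R^{O\times S}$ ($h\in[H]$), where $\mathbb O_h(\cdot\mid s)$ is the distribution of the observation; known rewards $r_h:\mathscr O\to[0,1]$. In an episode $s_1\sim\mu_1$; at step $h$ the learner sees $o_h\sim\mathbb O_h(\cdot\mid s_h)$, receives $r_h(o_h)$, takes $a_h$, and $s_{h+1}\sim\mathbb T_{h,a_h}(\cdot\mid s_h)$; the episode ends after $a_H$. States are never observed. A policy is $\pi=\{\pi_h\}_{h=1}^H$ with $\pi_h:(\mathscr O\times\mathscr A)^{h-1}\times\mathscr O\to\Delta_{\mathscr A}$. $V^\pi=\mathbb E_\pi[\sum_{h=1}^H r_h(o_h)]$, $V^\star=\sup_\pi V^\pi$. Values without a model argument refer to the true POMDP. $m$-step emission-action matrices: $\mathbb M_h\in\mathbb R^{(A^{m-1}O^m)\times S}$, $h\in[H-m+1]$, with entries $[\mathbb M_h]_{(\mathbf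 a,\mathbf o),s}=\mathbb P(o_{h:h+m-1}=\mathbf o\mid s_h=s,\ a_{h:h+m-2}=\mathbf a)$ for $\mathbf a\in\mathscr A^{m-1}$, $\mathbf o\in\mathscr O^m$, $s\in\mathscr S$. Models: $\theta=(\mathbb T,\mathbb O,\mu_1)$, and $\Theta$ is the set of all such parameters for the given $S,A,O,H$; $V^\pi(\theta)$ is the value of $\pi$ under $\theta$, $\mathbb M_h(\theta)$ its $m$-step emission-action matrices, and $\mathbb P^\pi_\theta(\tau)$ the probability of the full trajectory $\tau=(o_1,a_1,\dots,o_H,a_H)$ under $\pi$ and $\theta$. Multi-step OMLE with inputs $m,\alpha,\beta$: set $\mathcal B^1=\{\hat\theta\in\Theta:\min_h\sigma_S(\mathbb M_h(\hat\theta))\ge\alpha\}$ and $\mathcal D=\emptyset$. For $k=1,\dots,K$: compute $(\theta^k,\pi^k)\in\arg\max_{\hat\theta\in\mathcal B^k,\pi}V^\pi(\hat\theta)$ (ties broken by a fixed deterministic rule; if $\mathcal B^k=\emptyset$ the choice is arbitrary); for each $h=0,\dots,H-m$, execute for one episode the policy $\pi^k_{1:h}\circ\mathrm{uniform}(\mathscr A)$ (follow $\pi^k$ in steps $1,\dots,h$, then choose actions uniformly at random in all remaining steps), collect the trajectory $\tau^{k,h}$ and add the pair $(\pi^k_{1:h}\circ\mathrm{uniform}(\mathscr A),\tau^{k,h})$ to $\mathcal D$; then set $$\mathcal B^{k+1}=\Big\{\hat\theta\in\Theta:\sum_{(\pi,\tau)\in\mathcal D}\log\mathbb P^\pi_{\hat\theta}(\tau)\ge\max_{\theta'\in\Theta}\sum_{(\pi,\tau)\in\mathcal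 D}\log\mathbb P^\pi_{\theta'}(\tau)-\beta\Big\}\cap\mathcal B^1.$$ *)

theory Defs
  imports
    "HOL-Probability.Probability"
    "HOL-Library.Monad_Syntax"
    "Jordan_Normal_Form.Char_Poly"
begin

text \<open>
  The finite sets of states, actions and observations are \<open>{..<nS}\<close>, \<open>{..<nA}\<close>, \<open>{..<nO}\<close>.
  They are sets of naturals rather than types because the constants of the theorem must not
  depend on them. Time steps are numbered from \<open>1\<close> to \<open>H\<close>. Functions are total, but
  only their values on the index ranges constrained by \<open>models\<close> and \<open>policies\<close> matter.
\<close>

text \<open>
  The singular values are the square roots of the eigenvalues of the positive semidefinite
  matrix \<open>M\<^sup>T M\<close>, counted with multiplicity; its characteristic polynomial splits over the
  reals, so \<open>proots\<close> lists all \<open>dim_col M\<close> of them.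
\<close>

definition singular_value :: "nat \<Rightarrow> real mat \<Rightarrow> real" where
  "singular_value j M =
     (if 1 \<le> j \<and> j \<le> dim_row M \<and> j \<le> dim_col M
      then sqrt (rev (sorted_list_of_multiset (proots (char_poly (transpose_mat M * M)))) ! (j - 1))
      else 0)"

text \<open>
  \<open>transition \<theta> h a s\<close> and \<open>emission \<theta> h s\<close> are the columns \<open>T\<^bsub>h,a\<^esub>(\<cdot> | s)\<close> and
  \<open>O\<^bsub>h\<^esub>(\<cdot> | s)\<close>.
\<close>

record model =
  initial :: "nat pmf"
  transition :: "nat \<Rightarrow> nat \<Rightarrow> nat \<Rightarrow> nat pmf"
  emission :: "nat \<Rightarrow> nat \<Rightarrow> nat pmf"

definition models :: "nat \<Rightarrow> nat \<Rightarrow> nat \<Rightarrow> nat \<Rightarrow> model set" where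
  "models nS nA nO H = {\<theta>.
     set_pmf (initial \<theta>) \<subseteq> {..<nS} \<and>
     (\<forall>h\<in>{1..<H}. \<forall>a<nA. \<forall>s<nS. set_pmf (transition \<theta> h a s) \<subseteq> {..<nS}) \<and>
     (\<forall>h\<in>{1..H}. \<forall>s<nS. set_pmf (emission \<theta> h s) \<subseteq> {..<nO})}"

text \<open>A trajectory (or a prefix of one) is the list of its observation-action pairs.\<close>

type_synonym traj = "(nat \<times> nat) list"

text \<open>
  The family \<open>\<pi>\<^sub>1, \<dots>, \<pi>\<^sub>H\<close> is a single function: its value on a history of length
  \<open>h - 1\<close> and a current observation is that of \<open>\<pi>\<^sub>h\<close>.
\<close>

type_synonym policy = "traj \<Rightarrow> nat \<Rightarrow> nat pmf"

definition policies :: "nat \<Rightarrow> nat \<Rightarrow> nat \<Rightarrow> policy set" where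
  "policies nA nO H = {\<pi>. \<forall>hist ob.
     length hist < H \<and> set hist \<subseteq> {..<nO} \<times> {..<nA} \<and> ob < nO \<longrightarrow>
       set_pmf (\<pi> hist ob) \<subseteq> {..<nA}}"

definition trajectories :: "nat \<Rightarrow> nat \<Rightarrow> nat \<Rightarrow> traj set" where
  "trajectories nA nO H = {\<tau>. length \<tau> = H \<and> set \<tau> \<subseteq> {..<nO} \<times> {..<nA}}"

text \<open>
  Continue from state \<open>s\<close> after the history \<open>hist\<close>, that is, at step \<open>length hist + 1\<close>,
  for \<open>n\<close> further steps.
\<close>

fun rollout :: "model \<Rightarrow> policy \<Rightarrow> nat \<Rightarrow> traj \<Rightarrow> nat \<Rightarrow> traj pmf" where
  "rollout \<theta> \<pi> 0 hist s = return_pmf hist"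
| "rollout \<theta> \<pi> (Suc n) hist s =
     do {
       ob \<leftarrow> emission \<theta> (length hist + 1) s;
       a \<leftarrow> \<pi> hist ob;
       if n = 0 then return_pmf (hist @ [(ob, a)])
       else do {
         s' \<leftarrow> transition \<theta> (length hist + 1) a s;
         rollout \<theta> \<pi> n (hist @ [(ob, a)]) s'
       }
     }"

definition traj_pmf :: "nat \<Rightarrow> model \<Rightarrow> policy \<Rightarrow> traj pmf" where
  "traj_pmf H \<theta> \<pi> = bind_pmf (initial \<theta>) (rollout \<theta> \<pi> H [])"

definition policy_value :: "nat \<Rightarrow> (nat \<Rightarrow> nat \<Rightarrow> real) \<Rightarrow> model \<Rightarrow> policy \<Rightarrow> real" where
  "policy_value H r \<theta> \<pi> =
     measure_pmf.expectation (traj_pmf H \<theta> \<pi>) (\<lambda>\<tau>. \<Sum>h=1..H. r h (fst (\<tau> ! (h - 1))))"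

definition optimal_value ::
  "nat \<Rightarrow> nat \<Rightarrow> nat \<Rightarrow> (nat \<Rightarrow> nat \<Rightarrow> real) \<Rightarrow> model \<Rightarrow> real" where
  "optimal_value nA nO H r \<theta> = (SUP \<pi>\<in>policies nA nO H. policy_value H r \<theta> \<pi>)"

text \<open>
  Law of the observations from step \<open>h\<close> on, starting in state \<open>s\<close> at step \<open>h\<close>, when the
  listed actions are taken. There is one more observation than there are actions.
\<close>

fun obs_pmf :: "model \<Rightarrow> nat \<Rightarrow> nat \<Rightarrow> nat list \<Rightarrow> nat list pmf" where
  "obs_pmf \<theta> h s [] = map_pmf (\<lambda>ob. [ob]) (emission \<theta> h s)"
| "obs_pmf \<theta> h s (a # acts) =
     do {
       ob \<leftarrow> emission \<theta> h s;
       s' \<leftarrow> transition \<theta> h a s;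
       obs \<leftarrow> obs_pmf \<theta> (h + 1) s' acts;
       return_pmf (ob # obs)
     }"

text \<open>
  Row \<open>i\<close> belongs to the \<open>i\<close>-th pair of an action and an observation sequence in
  \<open>row_index\<close>; singular values do not depend on the order of the rows.
\<close>

definition row_index :: "nat \<Rightarrow> nat \<Rightarrow> nat \<Rightarrow> (nat list \<times> nat list) list" where
  "row_index nA nO m =
     List.product (List.n_lists (m - 1) [0..<nA]) (List.n_lists m [0..<nO])"

definition emission_action_mat ::
  "nat \<Rightarrow> nat \<Rightarrow> nat \<Rightarrow> nat \<Rightarrow> model \<Rightarrow> nat \<Rightarrow> real mat" where
  "emission_action_mat nS nA nO m \<theta> h =
     mat (nA ^ (m - 1) * nO ^ m) nS
       (\<lambda>(i, s). case row_index nA nO m ! i of (acts, obs) \<Rightarrow> pmf (obs_pmf \<theta> h s acts) obs)"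

definition min_singular_value ::
  "nat \<Rightarrow> nat \<Rightarrow> nat \<Rightarrow> nat \<Rightarrow> nat \<Rightarrow> model \<Rightarrow> real" where
  "min_singular_value nS nA nO H m \<theta> =
     (MIN h\<in>{1..H - m + 1}. singular_value nS (emission_action_mat nS nA nO m \<theta> h))"

type_synonym dataset = "(policy \<times> traj) list"

definition extended_ln :: "real \<Rightarrow> ereal" where
  "extended_ln x = (if x \<le> 0 then - \<infinity> else ereal (ln x))"

definition log_likelihood :: "nat \<Rightarrow> dataset \<Rightarrow> model \<Rightarrow> ereal" where
  "log_likelihood H D \<theta> = (\<Sum>(\<pi>, \<tau>)\<leftarrow>D. extended_ln (pmf (traj_pmf H \<theta> \<pi>) \<tau>))"

definition initial_confidence_set ::
  "nat \<Rightarrow> nat \<Rightarrow> nat \<Rightarrow> nat \<Rightarrow> nat \<Rightarrow> real \<Rightarrow> model set" where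
  "initial_confidence_set nS nA nO H m \<alpha> =
     {\<theta> \<in> models nS nA nO H. min_singular_value nS nA nO H m \<theta> \<ge> \<alpha>}"

text \<open>
  The supremum is a maximum, by compactness. On the empty data set, which occurs only in the
  first iteration, this is \<open>initial_confidence_set\<close> (see the lemma below).
\<close>

definition confidence_set ::
  "nat \<Rightarrow> nat \<Rightarrow> nat \<Rightarrow> nat \<Rightarrow> nat \<Rightarrow> real \<Rightarrow> real \<Rightarrow> dataset \<Rightarrow> model set" where
  "confidence_set nS nA nO H m \<alpha> \<beta> D =
     {\<theta> \<in> models nS nA nO H.
        log_likelihood H D \<theta> \<ge> (SUP \<theta>'\<in>models nS nA nO H. log_likelihood H D \<theta>') - ereal \<beta>}
     \<inter> initial_confidence_set nS nA nO H m \<alpha>"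

lemma confidence_set_Nil:
  assumes "\<beta> \<ge> 0"
  shows "confidence_set nS nA nO H m \<alpha> \<beta> [] = initial_confidence_set nS nA nO H m \<alpha>"
proof (cases "models nS nA nO H = {}")
  case True
  then show ?thesis
    by (auto simp: confidence_set_def initial_confidence_set_def)
next
  case False
  then show ?thesis
    using assms
    by (auto simp: confidence_set_def initial_confidence_set_def log_likelihood_def
        simp flip: zero_ereal_def)
qed

text \<open>
  The optimistic planning step with its tie-breaking rule: a function of the data collected so
  far that returns a maximiser of the value over the confidence set and all policies. If the
  confidence set is empty, it may return any policy.
\<close>

definition optimistic_planner ::
  "nat \<Rightarrow> nat \<Rightarrow> nat \<Rightarrow> nat \<Rightarrow> nat \<Rightarrow> real \<Rightarrow> real \<Rightarrow> (nat \<Rightarrow> nat \<Rightarrow> real) \<Rightarrow>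
   (dataset \<Rightarrow> model \<times> policy) \<Rightarrow> bool" where
  "optimistic_planner nS nA nO H m \<alpha> \<beta> r plan \<longleftrightarrow>
     (\<forall>D \<in> lists (policies nA nO H \<times> trajectories nA nO H).
        snd (plan D) \<in> policies nA nO H \<and>
        (confidence_set nS nA nO H m \<alpha> \<beta> D \<noteq> {} \<longrightarrow>
           is_arg_max (\<lambda>(\<theta>, \<pi>). policy_value H r \<theta> \<pi>)
             (\<lambda>(\<theta>, \<pi>). \<theta> \<in> confidence_set nS nA nO H m \<alpha> \<beta> D \<and> \<pi> \<in> policies nA nO H)
             (plan D)))"

definition uniform_after :: "nat \<Rightarrow> nat \<Rightarrow> policy \<Rightarrow> policy" where
  "uniform_after nA h \<pi> =
     (\<lambda>hist ob. if length hist < h then \<pi> hist ob else pmf_of_set {..<nA})"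

fun collect_episodes :: "nat \<Rightarrow> nat \<Rightarrow> model \<Rightarrow> policy \<Rightarrow> nat list \<Rightarrow> dataset pmf" where
  "collect_episodes nA H \<theta> \<pi> [] = return_pmf []"
| "collect_episodes nA H \<theta> \<pi> (h # hs) =
     do {
       \<tau> \<leftarrow> traj_pmf H \<theta> (uniform_after nA h \<pi>);
       D \<leftarrow> collect_episodes nA H \<theta> \<pi> hs;
       return_pmf ((uniform_after nA h \<pi>, \<tau>) # D)
     }"

text \<open>
  Joint law, after the given number of iterations in the true model \<open>\<theta>\<close>, of the optimistic
  policies played so far and the data collected. The inputs \<open>\<alpha>\<close> and \<open>\<beta>\<close> enter through \<open>plan\<close>.
\<close>

fun omle ::
  "nat \<Rightarrow> nat \<Rightarrow> nat \<Rightarrow> model \<Rightarrow> (dataset \<Rightarrow> model \<times> policy) \<Rightarrow> nat \<Rightarrow>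
   (policy list \<times> dataset) pmf" where
  "omle nA H m \<theta> plan 0 = return_pmf ([], [])"
| "omle nA H m \<theta> plan (Suc k) =
     do {
       (\<pi>s, D) \<leftarrow> omle nA H m \<theta> plan k;
       E \<leftarrow> collect_episodes nA H \<theta> (snd (plan D)) [0..<H - m + 1];
       return_pmf (\<pi>s @ [snd (plan D)], D @ E)
     }"

end

theory Submission
  imports Defs "Jordan_Normal_Form.Determinant"
begin

text \<open>
  Optimism reduces the regret to \<open>\<Sum>\<^sub>k TV(\<theta>\<^sup>k, \<theta>; \<pi>\<^sup>k)\<close>, the distance between the trajectory laws of the
  estimated and the true model under the policy played.

  Statistics: rounding all parameters of a model up to multiples of \<open>1 / N\<close> gives a finite family of
  upper brackets \<open>w\<close> of the likelihoods. A union bound over it controls both the likelihood ratios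
  \<open>w / P\<^sub>\<theta>\<close> (hence the true model stays in the confidence sets) and their square roots (hence the
  squared distances of any model in the confidence set, summed over the data policies, are \<open>O(\<beta>)\<close>).

  Comparison: let \<open>P\<^sub>j\<close> be a left inverse of the emission-action matrix of the estimated model at step
  \<open>j + 1\<close>, of \<open>\<ell>\<^sub>1\<close> norm at most \<open>\<surd>S / \<alpha>\<close>. The hybrids that follow the true model for \<open>j\<close> steps, translate the
  state vector with \<open>P\<^sub>j M\<^sub>j\<close> and continue in the estimated model interpolate between the two
  likelihoods. Consecutive hybrids differ by terms that are bilinear in a defect of the estimated
  model and a belief vector of the true model. Under the data policies of earlier iterations, these
  terms are bounded by the data distances.

  Pigeonhole: transferring such bounds from earlier iterations to the current one costs only a
  logarithm. The potential is the volume of the zonotope spanned by the beliefs seen so far, i.e. the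
  sum of \<open>|det|\<close> over all \<open>d\<close>-tuples of them; Cramer's rule bounds \<open>|f \<cdot> x|\<close> by the relative growth of the
  volume when \<open>x\<close> is added, times the sum of \<open>|f \<cdot> y|\<close> over the earlier \<open>y\<close>.
\<close>

unbundle no vec_syntax

section \<open>Singular values and left inverses\<close>

text \<open>A trajectory probability is a policy factor times a model factor, and the policy factor
  cancels in every likelihood ratio. So the brackets cover models only, and the adaptively chosen
  policies cost nothing in the union bound. Upper brackets are used because a model from a finite
  net can give probability 0 to the observed data, whereas a dominating \<open>w\<close> never
  underestimates a likelihood; the price is a mass slightly above 1. State vectors keep the number
  of trajectories out of the bound: a likelihood difference has exponentially many coordinates, but
  a defect is a functional on S-dimensional beliefs. Defects do not depend on the policy and beliefs
  do not depend on the estimate, so the two can be recombined across iterations. A defect applied to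
  a belief is a combination of likelihood differences over windows of m or m + 1 steps, which
  uniform actions reach at the price A^m or A^(m + 1) instead of A^H. Total variation sums absolute
  values over all these windows; passing to squares term by term would bring their number back,
  hence a pigeonhole principle for absolute values.\<close>

lemma symmetric_quadratic_form_minimizer:
  fixes B :: "nat \<Rightarrow> nat \<Rightarrow> real"
  assumes sym: "\<And>i j. B i j = B j i" and n: "n > 0"
  obtains \<mu> x where "\<And>v. \<mu> * (\<Sum>i<n. v i ^ 2) \<le> (\<Sum>i<n. \<Sum>j<n. v i * B i j * v j)"
    and "(\<Sum>i<n. x i ^ 2) = 1" and "\<And>i. i < n \<Longrightarrow> (\<Sum>j<n. B i j * x j) = \<mu> * x i"
proof -
  define q :: "(nat \<Rightarrow> real) \<Rightarrow> real" where "q v = (\<Sum>i<n. \<Sum>j<n. v i * B i j * v j)" for v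
  define sq :: "(nat \<Rightarrow> real) \<Rightarrow> real" where "sq v = (\<Sum>i<n. v i ^ 2)" for v
  \<comment> \<open>Vectors are total functions, so the coordinates from n on are pinned to 0.
    Tychonoff makes the box compact, and the unit sphere is a closed part of it.\<close>
  define box :: "(nat \<Rightarrow> real) set" where "box = PiE UNIV (\<lambda>i. if i < n then {-1..1} else {0})"
  define sph where "sph = box \<inter> {v. sq v = 1}"
  have cont: "continuous_on A q" "continuous_on A sq" for A
    unfolding q_def sq_def
    by (intro continuous_intros continuous_on_subset[OF continuous_on_product_coordinates]; simp)+
  have "compactin (product_topology (\<lambda>i::nat. euclidean :: real topology) UNIV) box"
    unfolding box_def by (subst compactin_PiE) auto
  then have "compact box"
    by (simp add: euclidean_product_topology)
  moreover have "closed {v. sq v = 1}"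
    by (intro closed_Collect_eq cont continuous_intros)
  ultimately have "compact sph"
    unfolding sph_def by (rule compact_Int_closed)
  have norm_sph: "(\<lambda>i. if i < n then v i / sqrt (sq v) else 0) \<in> sph" if "sq v \<noteq> 0" for v
  proof -
    have pos: "sq v > 0" using that unfolding sq_def
      by (metis (no_types, lifting) less_eq_real_def sum_nonneg zero_le_power2)
    have le: "\<bar>v i / sqrt (sq v)\<bar> \<le> 1" if "i < n" for i
    proof -
      have "v i ^ 2 \<le> sq v" unfolding sq_def
        by (rule member_le_sum) (use that in auto)
      then have "\<bar>v i\<bar> \<le> sqrt (sq v)"
        using real_le_rsqrt by (metis power2_abs)
      then show ?thesis using pos by (simp add: abs_divide)
    qed
    have "sq (\<lambda>i. if i < n then v i / sqrt (sq v) else 0) = (\<Sum>i<n. v i ^ 2 / sq v)"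
      unfolding sq_def
      by (intro sum.cong) (auto simp: power_divide sum_nonneg)
    also have "\<dots> = 1" using pos unfolding sq_def by (simp flip: sum_divide_distrib)
    moreover have "- 1 \<le> v i / sqrt (sq v) \<and> v i / sqrt (sq v) \<le> 1" if "i < n" for i
      using le[OF that] by linarith
    ultimately show ?thesis unfolding sph_def box_def by (auto simp: PiE_def Pi_def extensional_def)
  qed
  have "sq (\<lambda>i. if i = 0 then 1 else 0) = 1"
    unfolding sq_def using n by (simp add: if_distrib[of "\<lambda>x. x ^ 2"] sum.delta cong: if_cong)
  then have "sph \<noteq> {}" using norm_sph[of "\<lambda>i. if i = 0 then 1 else 0"] by auto
  then obtain x where x: "x \<in> sph" "\<And>y. y \<in> sph \<Longrightarrow> q x \<le> q y"
    using continuous_attains_inf[OF \<open>compact sph\<close> _ cont(1)] by blast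
  have sqx: "sq x = 1" using x unfolding sph_def by auto
  have min: "q x * sq v \<le> q v" for v
  proof (cases "sq v = 0")
    case True
    then have "v i = 0" if "i < n" for i using that unfolding sq_def
      by (subst (asm) sum_nonneg_eq_0_iff) auto
    then have "q v = 0" unfolding q_def by simp
    with True show ?thesis by simp
  next
    case False
    then have pos: "sq v > 0" unfolding sq_def
      by (metis (no_types, lifting) less_eq_real_def sum_nonneg zero_le_power2)
    have "q (\<lambda>i. if i < n then v i / sqrt (sq v) else 0) = (\<Sum>i<n. \<Sum>j<n. v i * B i j * v j / sq v)"
      unfolding q_def using pos by (intro sum.cong refl) (auto simp: divide_simps)
    also have "\<dots> = q v / sq v" unfolding q_def by (simp flip: sum_divide_distrib)
    finally show ?thesis using x(2)[OF norm_sph[OF False]] pos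
      by (simp add: pos_le_divide_eq)
  qed
  \<comment> \<open>First-order condition: moving x along coordinate i by t turns \<open>min\<close>
    into a quadratic inequality in t without constant term, so its linear coefficient
    vanishes.\<close>
  have eig: "(\<Sum>j<n. B i j * x j) = q x * x i" if i: "i < n" for i
  proof -
    define b where "b = (\<Sum>j<n. B i j * x j) - q x * x i"
    have d1: "(\<Sum>k<n. \<Sum>j<n. if k = i then g k j else 0) = (\<Sum>j<n. g i j)" for g :: "nat \<Rightarrow> nat \<Rightarrow> real"
      by (subst sum.swap) (simp add: i)
    have d2: "(\<Sum>k<n. \<Sum>j<n. if j = i then g k j else 0) = (\<Sum>k<n. g k i)" for g :: "nat \<Rightarrow> nat \<Rightarrow> real"
      by (simp add: i)
    have d3: "(\<Sum>k<n. \<Sum>j<n. if k = i then if j = i then g k j else 0 else 0) = g i i" for g :: "nat \<Rightarrow> nat \<Rightarrow> real"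
      unfolding d1 by (simp add: i)
    have qt: "q (\<lambda>k. x k + (if k = i then t else 0)) = q x + 2 * t * (\<Sum>j<n. B i j * x j) + t^2 * B i i" for t
    proof -
      have "q (\<lambda>k. x k + (if k = i then t else 0)) = (\<Sum>k<n. \<Sum>j<n. x k * B k j * x j
         + (if k = i then t * (B k j * x j) else 0) + (if j = i then t * (x k * B k j) else 0)
         + (if k = i then if j = i then t^2 * B k j else 0 else 0))"
        unfolding q_def by (intro sum.cong refl) (auto simp: algebra_simps power2_eq_square)
      also have "\<dots> = q x + t * (\<Sum>j<n. B i j * x j) + t * (\<Sum>k<n. x k * B k i) + t^2 * B i i"
        unfolding q_def sum.distrib by (simp only: d1 d2 sum_distrib_left) (simp add: i)
      also have "(\<Sum>k<n. x k * B k i) = (\<Sum>j<n. B i j * x j)"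
        by (intro sum.cong) (auto simp: sym[of i] mult.commute)
      finally show ?thesis by simp
    qed
    have st: "sq (\<lambda>k. x k + (if k = i then t else 0)) = sq x + 2 * t * x i + t^2" for t
    proof -
      have "sq (\<lambda>k. x k + (if k = i then t else 0)) = (\<Sum>k<n. x k ^ 2 + (if k = i then 2 * t * x k + t^2 else 0))"
        unfolding sq_def by (intro sum.cong) (auto simp: power2_eq_square algebra_simps)
      then show ?thesis unfolding sum.distrib using i by (simp add: sq_def sum.delta)
    qed
    have main: "0 \<le> 2 * t * b + t^2 * (B i i - q x)" for t
      using min[of "\<lambda>k. x k + (if k = i then t else 0)"] unfolding qt st sqx b_def
      by (simp add: algebra_simps)
    have "b = 0"
    proof (rule ccontr)
      assume "b \<noteq> 0"
      \<comment> \<open>With this c, the choice t = - b / c makes the quadratic at most - b^2 /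
        c.\<close>
      define c where "c = \<bar>B i i - q x\<bar> + 1"
      have c: "c > 0" "B i i - q x < c" unfolding c_def by auto
      have "0 \<le> 2 * (- b / c) * b + (- b / c)^2 * (B i i - q x)" by (rule main)
      also have "\<dots> \<le> 2 * (- b / c) * b + (- b / c)^2 * c"
        using c by (intro add_left_mono mult_left_mono) auto
      also have "\<dots> = - (b^2 / c)" using c by (simp add: field_simps power2_eq_square)
      also have "\<dots> < 0" using \<open>b \<noteq> 0\<close> c by simp
      finally show False by simp
    qed
    then show ?thesis unfolding b_def by simp
  qed
  show thesis
    by (rule that[of "q x" x]) (use min sqx eig in \<open>auto simp: q_def sq_def\<close>)
qed

text \<open>For a complex eigenvector v, the Hermitian form of A at v equals a |v|^2, and symmetry
  makes it its own conjugate.\<close>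

lemma symmetric_real_mat_complex_eigenvalue:
  fixes A :: "real mat" and a :: complex
  assumes A: "A \<in> carrier_mat n n" and sym: "\<And>i j. i < n \<Longrightarrow> j < n \<Longrightarrow> A $$ (i, j) = A $$ (j, i)"
    and ev: "eigenvalue (map_mat of_real A) a"
  shows "Im a = 0"
proof -
  from ev obtain v where v: "v \<in> carrier_vec n" "v \<noteq> 0\<^sub>v n"
    and eq: "map_mat of_real A *\<^sub>v v = a \<cdot>\<^sub>v v"
    using A unfolding eigenvalue_def eigenvector_def by auto
  have row: "(\<Sum>j<n. of_real (A $$ (i, j)) * v $ j) = a * v $ i" if "i < n" for i
    using arg_cong[OF eq, of "\<lambda>w. w $ i"] A v that
    by (simp add: scalar_prod_def atLeast0LessThan)
  define S where "S = (\<Sum>i<n. \<Sum>j<n. cnj (v $ i) * of_real (A $$ (i, j)) * v $ j)"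
  have "S = (\<Sum>i<n. cnj (v $ i) * (\<Sum>j<n. of_real (A $$ (i, j)) * v $ j))"
    unfolding S_def by (simp add: sum_distrib_left mult.assoc)
  also have "\<dots> = (\<Sum>i<n. a * (v $ i * cnj (v $ i)))"
    by (intro sum.cong) (auto simp: row)
  also have "\<dots> = a * of_real (\<Sum>i<n. (cmod (v $ i))^2)"
    unfolding complex_norm_square sum_distrib_left of_real_sum ..
  finally have S: "S = a * of_real (\<Sum>i<n. (cmod (v $ i))^2)" .
  have "cnj S = (\<Sum>i<n. \<Sum>j<n. v $ i * of_real (A $$ (i, j)) * cnj (v $ j))"
    unfolding S_def by simp
  also have "\<dots> = (\<Sum>j<n. \<Sum>i<n. v $ i * of_real (A $$ (i, j)) * cnj (v $ j))"
    by (rule sum.swap)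
  also have "\<dots> = S" unfolding S_def
    by (intro sum.cong refl) (auto simp: sym)
  finally have "Im S = 0" by (metis complex_cnj cnj.sel(2) neg_equal_zero)
  then have "Im a * (\<Sum>i<n. (cmod (v $ i))^2) = 0" unfolding S by simp
  moreover have "(\<Sum>i<n. (cmod (v $ i))^2) \<noteq> 0"
  proof
    assume "(\<Sum>i<n. (cmod (v $ i))^2) = 0"
    then have "\<forall>i<n. v $ i = 0" by (subst (asm) sum_nonneg_eq_0_iff) auto
    then show False using v by (metis eq_vecI carrier_vecD index_zero_vec(1) index_zero_vec(2))
  qed
  ultimately show ?thesis by simp
qed

text \<open>\<open>singular_value\<close> picks an entry from the list of real roots. Only because
  the characteristic polynomial splits over the reals does this list have n entries, so that
  position n is the smallest eigenvalue.\<close>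

lemma char_poly_symmetric_real_mat:
  fixes A :: "real mat"
  assumes A: "A \<in> carrier_mat n n" and sym: "\<And>i j. i < n \<Longrightarrow> j < n \<Longrightarrow> A $$ (i, j) = A $$ (j, i)"
  obtains es where "char_poly A = (\<Prod>e\<leftarrow>es. [:- e, 1:])" "length es = n"
proof -
  let ?C = "map_mat complex_of_real A"
  have C: "?C \<in> carrier_mat n n" using A by auto
  from char_poly_factorized[OF C] obtain as where
    as: "char_poly ?C = (\<Prod>a\<leftarrow>as. [:- a, 1:])" "length as = n" by auto
  have real: "Im a = 0" if "a \<in> set as" for a
  proof (rule symmetric_real_mat_complex_eigenvalue[OF A sym])
    show "eigenvalue ?C a"
      unfolding eigenvalue_root_char_poly[OF C] as using that
      by (simp add: poly_prod_list prod_list_zero_iff image_iff)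
  qed
  interpret h: map_poly_inj_idom_hom complex_of_real ..
  have hp: "map_poly complex_of_real (\<Prod>e\<leftarrow>es. [:- e, 1:]) = (\<Prod>e\<leftarrow>es. [:- complex_of_real e, 1:])" for es
    by (simp add: h.hom_prod_list o_def)
  have "map_poly complex_of_real (\<Prod>e\<leftarrow>map Re as. [:- e, 1:]) = (\<Prod>a\<leftarrow>as. [:- a, 1:])"
    unfolding hp using real
    by (intro arg_cong[of _ _ prod_list]) (auto simp: complex_eq_iff intro!: arg_cong[of _ _ "\<lambda>x. [: x, 1 :]"])
  also have "\<dots> = map_poly complex_of_real (char_poly A)"
    unfolding as(1)[symmetric] by (rule of_real_hom.char_poly_hom[OF A])
  finally have "char_poly A = (\<Prod>e\<leftarrow>map Re as. [:- e, 1:])"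
    using h.injectivity by (metis h.eq_iff)
  then show thesis using as(2) that[of "map Re as"] by simp
qed

lemma proots_prod_list_linear: "proots (\<Prod>e\<leftarrow>es. [:- e, 1:]) = mset (es :: real list)"
proof (induction es)
  case (Cons e es)
  have "(\<Prod>e\<leftarrow>es. [:- e, 1:]) \<noteq> (0 :: real poly)"
    by (auto simp: prod_list_zero_iff)
  then have "proots ([:- e, 1:] * (\<Prod>e\<leftarrow>es. [:- e, 1:])) = {#e#} + mset es"
    using Cons by (subst proots_mult) auto
  then show ?case by simp
qed auto

text \<open>The minimum of the Rayleigh quotient is an eigenvalue, so it occurs among the roots that
  define the singular values and is at least the smallest of them, hence at least
  \<alpha>^2.\<close>

lemma singular_value_lower_bound:
  fixes M :: "real mat"
  assumes M: "M \<in> carrier_mat r n" and sv: "singular_value n M \<ge> \<alpha>" and \<alpha>: "\<alpha> > 0"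
  shows "\<alpha>^2 * (\<Sum>s<n. v s ^ 2) \<le> (\<Sum>i<r. (\<Sum>s<n. M $$ (i, s) * v s)^2)"
proof -
  \<comment> \<open>The default value 0 of \<open>singular_value\<close>, for n = 0 or fewer than n
    rows, is excluded by \<alpha> > 0.\<close>
  have n: "1 \<le> n" "n \<le> r" using sv \<alpha> M unfolding singular_value_def by (auto split: if_splits)
  define A where "A = transpose_mat M * M"
  have A: "A \<in> carrier_mat n n" using M unfolding A_def by auto
  define B where "B i j = (\<Sum>k<r. M $$ (k, i) * M $$ (k, j))" for i j
  have AB: "A $$ (i, j) = B i j" if "i < n" "j < n" for i j
    using M that unfolding A_def B_def by (simp add: scalar_prod_def atLeast0LessThan)
  have symB: "B i j = B j i" for i j unfolding B_def by (simp add: mult.commute)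
  have "A $$ (i, j) = A $$ (j, i)" if "i < n" "j < n" for i j
    unfolding AB[OF that] AB[OF that(2,1)] by (rule symB)
  from char_poly_symmetric_real_mat[OF A this] obtain es where
    es: "char_poly A = (\<Prod>e\<leftarrow>es. [:- e, 1:])" "length es = n" by blast
  obtain \<mu> x where \<mu>: "\<And>v. \<mu> * (\<Sum>i<n. v i ^ 2) \<le> (\<Sum>i<n. \<Sum>j<n. v i * B i j * v j)"
    and x: "(\<Sum>i<n. x i ^ 2) = 1" "\<And>i. i < n \<Longrightarrow> (\<Sum>j<n. B i j * x j) = \<mu> * x i"
    by (rule symmetric_quadratic_form_minimizer[of B n, OF symB]) (use n in auto)
  have "eigenvalue A \<mu>"
    unfolding eigenvalue_def eigenvector_def
  proof (intro exI[of _ "vec n x"] conjI)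
    show "vec n x \<in> carrier_vec (dim_row A)" using A by auto
    show "vec n x \<noteq> 0\<^sub>v (dim_row A)"
    proof
      assume "vec n x = 0\<^sub>v (dim_row A)"
      then have "\<forall>i<n. x i = 0" using A by (metis carrier_matD(1) index_vec index_zero_vec(1))
      then show False using x(1) by simp
    qed
    show "A *\<^sub>v vec n x = \<mu> \<cdot>\<^sub>v vec n x"
      by (rule eq_vecI) (use A in \<open>auto simp: scalar_prod_def atLeast0LessThan AB x(2)\<close>)
  qed
  then have "\<mu> \<in> set es"
    unfolding eigenvalue_root_char_poly[OF A] es
    by (auto simp: poly_prod_list prod_list_zero_iff)
  \<comment> \<open>Position n - 1 of the descending list is position 0 of the ascending
    one.\<close>
  have "singular_value n M = sqrt (sort es ! 0)"
    using n M es unfolding singular_value_def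
    by (simp add: A_def[symmetric] proots_prod_list_linear rev_nth)
  moreover have "sort es ! 0 \<le> \<mu>"
    using \<open>\<mu> \<in> set es\<close> by (metis in_set_conv_nth le0 set_sort sorted_nth_mono sorted_sort)
  ultimately have "\<alpha> \<le> sqrt \<mu>" using sv by (smt (verit) real_sqrt_le_mono)
  then have "\<alpha>^2 \<le> \<mu>" using \<alpha>
    by (metis less_eq_real_def linorder_not_less order_trans power_mono real_sqrt_le_0_iff real_sqrt_pow2)
  then have "\<alpha>^2 * (\<Sum>s<n. v s ^ 2) \<le> \<mu> * (\<Sum>s<n. v s ^ 2)"
    by (intro mult_right_mono sum_nonneg) auto
  also have "\<dots> \<le> (\<Sum>i<n. \<Sum>j<n. v i * B i j * v j)" by (rule \<mu>)
  also have "\<dots> = (\<Sum>i<n. \<Sum>j<n. \<Sum>k<r. (M $$ (k, i) * v i) * (M $$ (k, j) * v j))"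
    unfolding B_def by (simp add: sum_distrib_left sum_distrib_right mult_ac)
  also have "\<dots> = (\<Sum>i<n. \<Sum>k<r. \<Sum>j<n. (M $$ (k, i) * v i) * (M $$ (k, j) * v j))"
    by (intro sum.cong refl sum.swap)
  also have "\<dots> = (\<Sum>k<r. \<Sum>i<n. \<Sum>j<n. (M $$ (k, i) * v i) * (M $$ (k, j) * v j))"
    by (rule sum.swap)
  also have "\<dots> = (\<Sum>k<r. (\<Sum>s<n. M $$ (k, s) * v s)^2)"
    by (simp add: power2_eq_square sum_product)
  finally show ?thesis .
qed

text \<open>P is the pseudoinverse, the inverse Gram matrix times the transpose of M. For y = P x
  the vector M y is the orthogonal projection of x, so \<alpha> |y|_2 \<le> |M y|_2 \<le> |x|_2
  \<le> |x|_1, while |y|_1 \<le> sqrt n |y|_2.\<close>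

lemma bounded_left_inverse:
  fixes M :: "'r \<Rightarrow> nat \<Rightarrow> real"
  assumes R: "finite R" and \<alpha>: "\<alpha> > 0"
    and low: "\<And>v :: nat \<Rightarrow> real. \<alpha>^2 * (\<Sum>s<n. v s ^ 2) \<le> (\<Sum>i\<in>R. (\<Sum>s<n. M i s * v s)^2)"
  obtains P :: "nat \<Rightarrow> 'r \<Rightarrow> real" where
    "\<And>v s. s < n \<Longrightarrow> (\<Sum>i\<in>R. P s i * (\<Sum>s'<n. M i s' * v s')) = v s"
    "\<And>x. (\<Sum>s<n. \<bar>\<Sum>i\<in>R. P s i * x i\<bar>) \<le> sqrt n / \<alpha> * (\<Sum>i\<in>R. \<bar>x i\<bar>)"
proof -
  define G where "G = mat n n (\<lambda>(i, j). \<Sum>k\<in>R. M k i * M k j)"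
  have G: "G \<in> carrier_mat n n" unfolding G_def by auto
  have G_mult: "(\<Sum>t<n. G $$ (s, t) * v t) = (\<Sum>i\<in>R. M i s * (\<Sum>t<n. M i t * v t))" if "s < n" for s v
  proof -
    have "(\<Sum>t<n. G $$ (s, t) * v t) = (\<Sum>t<n. \<Sum>k\<in>R. M k s * M k t * v t)"
      unfolding G_def using that by (simp add: sum_distrib_right)
    also have "\<dots> = (\<Sum>k\<in>R. \<Sum>t<n. M k s * M k t * v t)" by (rule sum.swap)
    finally show ?thesis by (simp add: sum_distrib_left mult.assoc)
  qed
  have energy: "(\<Sum>s<n. v s * (\<Sum>i\<in>R. M i s * x i)) = (\<Sum>i\<in>R. (\<Sum>s<n. M i s * v s) * x i)" for v x
    unfolding sum_distrib_left sum_distrib_right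
    by (subst sum.swap) (simp add: mult_ac)
  have "det G \<noteq> 0"
  proof
    assume "det G = 0"
    then obtain v where v: "v \<in> carrier_vec n" "v \<noteq> 0\<^sub>v n" "G *\<^sub>v v = 0\<^sub>v n"
      using det_0_iff_vec_prod_zero_field[OF G] by auto
    have "(\<Sum>t<n. G $$ (s, t) * v $ t) = 0" if "s < n" for s
      using arg_cong[OF v(3), of "\<lambda>w. w $ s"] that G v(1)
      by (simp add: scalar_prod_def atLeast0LessThan)
    then have "(\<Sum>s<n. v $ s * (\<Sum>i\<in>R. M i s * (\<Sum>t<n. M i t * v $ t))) = 0"
      using G_mult[of _ "\<lambda>t. v $ t"] by simp
    then have "(\<Sum>i\<in>R. (\<Sum>s<n. M i s * v $ s)^2) = 0"
      unfolding energy by (simp add: power2_eq_square)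
    with low[of "\<lambda>s. v $ s"] \<alpha> have "(\<Sum>s<n. (v $ s)^2) \<le> 0"
      by (simp add: mult_le_0_iff)
    then have "(\<Sum>s<n. (v $ s)^2) = 0" by (meson order_antisym sum_nonneg zero_le_power2)
    then have "\<forall>s<n. v $ s = 0" by (subst (asm) sum_nonneg_eq_0_iff) auto
    then show False using v by (metis eq_vecI carrier_vecD index_zero_vec(1) index_zero_vec(2))
  qed
  define Q where "Q = (1 / det G) \<cdot>\<^sub>m adj_mat G"
  note adj = adj_mat[OF G]
  have Q: "Q \<in> carrier_mat n n" unfolding Q_def using adj by auto
  have QG: "Q * G = 1\<^sub>m n" and GQ: "G * Q = 1\<^sub>m n"
    unfolding Q_def using adj G \<open>det G \<noteq> 0\<close> by (auto simp: mult_smult_distrib[of _ n n] mult_smult_assoc_mat[of _ n n] intro!: eq_matI)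
  have QG': "(\<Sum>t<n. Q $$ (s, t) * G $$ (t, u)) = (if s = u then 1 else 0)" if "s < n" "u < n" for s u
    using arg_cong[OF QG, of "\<lambda>w. w $$ (s, u)"] that G Q
    by (simp add: scalar_prod_def atLeast0LessThan)
  have GQ': "(\<Sum>t<n. G $$ (s, t) * Q $$ (t, u)) = (if s = u then 1 else 0)" if "s < n" "u < n" for s u
    using arg_cong[OF GQ, of "\<lambda>w. w $$ (s, u)"] that G Q
    by (simp add: scalar_prod_def atLeast0LessThan)
  define P where "P s i = (\<Sum>t<n. Q $$ (s, t) * M i t)" for s i
  have P: "(\<Sum>i\<in>R. P s i * x i) = (\<Sum>t<n. Q $$ (s, t) * (\<Sum>i\<in>R. M i t * x i))" for s x
    unfolding P_def sum_distrib_left sum_distrib_right by (subst sum.swap) (simp add: mult_ac)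
  show thesis
  proof (rule that[of P])
    fix v :: "nat \<Rightarrow> real" and s assume s: "s < n"
    have "(\<Sum>i\<in>R. P s i * (\<Sum>s'<n. M i s' * v s')) = (\<Sum>t<n. Q $$ (s, t) * (\<Sum>u<n. G $$ (t, u) * v u))"
      unfolding P by (intro sum.cong) (auto simp: G_mult)
    also have "\<dots> = (\<Sum>u<n. (\<Sum>t<n. Q $$ (s, t) * G $$ (t, u)) * v u)"
      unfolding sum_distrib_left sum_distrib_right by (subst sum.swap) (simp add: mult_ac)
    also have "\<dots> = (\<Sum>u<n. (if s = u then v u else 0))"
      by (intro sum.cong) (auto simp: QG' s)
    also have "\<dots> = v s" using s by (simp add: sum.delta)
    finally show "(\<Sum>i\<in>R. P s i * (\<Sum>s'<n. M i s' * v s')) = v s" .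
  next
    fix x :: "'r \<Rightarrow> real"
    define y where "y s = (\<Sum>i\<in>R. P s i * x i)" for s
    define N1 where "N1 = (\<Sum>i\<in>R. \<bar>x i\<bar>)"
    have N1: "N1 \<ge> 0" unfolding N1_def by (simp add: sum_nonneg)
    have normal: "(\<Sum>i\<in>R. M i s * (\<Sum>t<n. M i t * y t)) = (\<Sum>i\<in>R. M i s * x i)" if s: "s < n" for s
    proof -
      have "(\<Sum>i\<in>R. M i s * (\<Sum>t<n. M i t * y t)) = (\<Sum>t<n. G $$ (s, t) * y t)"
        using G_mult[OF s] by simp
      also have "\<dots> = (\<Sum>u<n. (\<Sum>t<n. G $$ (s, t) * Q $$ (t, u)) * (\<Sum>i\<in>R. M i u * x i))"
      proof -
        have "(\<Sum>t<n. G $$ (s, t) * y t) = (\<Sum>t<n. \<Sum>u<n. G $$ (s, t) * Q $$ (t, u) * (\<Sum>i\<in>R. M i u * x i))"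
          unfolding y_def P sum_distrib_left[of _ _ "{..<n}"] by (simp add: mult.assoc)
        also have "\<dots> = (\<Sum>u<n. \<Sum>t<n. G $$ (s, t) * Q $$ (t, u) * (\<Sum>i\<in>R. M i u * x i))"
          by (rule sum.swap)
        finally show ?thesis by (simp add: sum_distrib_right)
      qed
      also have "\<dots> = (\<Sum>u<n. (if s = u then (\<Sum>i\<in>R. M i u * x i) else 0))"
        by (intro sum.cong) (auto simp: GQ' s)
      finally show ?thesis using s by (simp add: sum.delta)
    qed
    define z where "z i = (\<Sum>s<n. M i s * y s)" for i
    have "(\<Sum>i\<in>R. z i ^ 2) = (\<Sum>s<n. y s * (\<Sum>i\<in>R. M i s * z i))"
      unfolding energy z_def by (simp add: power2_eq_square)
    also have "\<dots> = (\<Sum>s<n. y s * (\<Sum>i\<in>R. M i s * x i))"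
      unfolding z_def by (intro sum.cong) (auto simp: normal)
    also have "\<dots> = (\<Sum>i\<in>R. z i * x i)" unfolding energy z_def ..
    finally have zx: "(\<Sum>i\<in>R. z i ^ 2) = (\<Sum>i\<in>R. z i * x i)" .
    \<comment> \<open>Pythagoras: \<open>zx\<close> says that the residual x - z is orthogonal to
      z.\<close>
    have "0 \<le> (\<Sum>i\<in>R. (z i - x i)^2)" by (simp add: sum_nonneg)
    also have "\<dots> = (\<Sum>i\<in>R. x i ^ 2) - (\<Sum>i\<in>R. z i ^ 2)"
      using zx by (simp add: power2_diff sum.distrib sum_subtractf sum_distrib_left[symmetric] mult.assoc)
    finally have "(\<Sum>i\<in>R. z i ^ 2) \<le> (\<Sum>i\<in>R. \<bar>x i\<bar> ^ 2)" by simp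
    also have "\<dots> \<le> N1^2"
    proof -
      have "(\<Sum>i\<in>R. \<bar>x i\<bar> ^ 2) \<le> (\<Sum>i\<in>R. \<bar>x i\<bar> * N1)"
        unfolding power2_eq_square N1_def using R
        by (intro sum_mono mult_left_mono member_le_sum) auto
      then show ?thesis by (simp add: N1_def power2_eq_square sum_distrib_right)
    qed
    finally have y2: "\<alpha>^2 * (\<Sum>s<n. y s ^ 2) \<le> N1^2" using low[of y] unfolding z_def by simp
    have "(\<Sum>s<n. \<bar>y s\<bar>)^2 \<le> (\<Sum>s<n. \<bar>y s\<bar>^2) * (\<Sum>s<n. 1^2)"
      using Cauchy_Schwarz_ineq_sum[of "\<lambda>s. \<bar>y s\<bar>" "\<lambda>_. 1" "{..<n}"] by simp
    also have "\<dots> \<le> (N1^2 / \<alpha>^2) * n"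
    proof (rule mult_mono)
      show "(\<Sum>s<n. \<bar>y s\<bar>^2) \<le> N1^2 / \<alpha>^2"
        using y2 \<alpha> by (simp add: pos_le_divide_eq mult.commute)
    qed auto
    also have "\<dots> = (sqrt n / \<alpha> * N1)^2" by (simp add: power_mult_distrib power_divide)
    finally show "(\<Sum>s<n. \<bar>\<Sum>i\<in>R. P s i * x i\<bar>) \<le> sqrt n / \<alpha> * (\<Sum>i\<in>R. \<bar>x i\<bar>)"
      unfolding y_def[symmetric] N1_def[symmetric]
      by (rule power2_le_imp_le) (use N1 \<alpha> in auto)
  qed
qed

section \<open>A pigeonhole principle for sums of absolute values\<close>

definition tuple_det :: "nat \<Rightarrow> ('i \<Rightarrow> nat \<Rightarrow> real) \<Rightarrow> (nat \<Rightarrow> 'i) \<Rightarrow> real" where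
  "tuple_det d v \<sigma> = \<bar>det (mat d d (\<lambda>(r, c). v (\<sigma> c) r))\<bar>"

text \<open>Ordered tuples count each d-subset of Y d! times and a repetition gives determinant 0,
  so for finite Y this is d! times the volume of the zonotope. Ordered slots allow tuples to be
  split by position.\<close>

definition tuple_volume :: "nat \<Rightarrow> ('i \<Rightarrow> nat \<Rightarrow> real) \<Rightarrow> 'i set \<Rightarrow> real" where
  "tuple_volume d v Y = (\<Sum>\<sigma>\<in>PiE {..<d} (\<lambda>_. Y). tuple_det d v \<sigma>)"

text \<open>The part of the growth of \<open>tuple_volume\<close> that comes from tuples with the
  new x in exactly one slot c.\<close>

definition tuple_width :: "nat \<Rightarrow> ('i \<Rightarrow> nat \<Rightarrow> real) \<Rightarrow> 'i set \<Rightarrow> 'i \<Rightarrow> real" where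
  "tuple_width d v Y x = (\<Sum>c<d. \<Sum>\<sigma>\<in>PiE ({..<d} - {c}) (\<lambda>_. Y). tuple_det d v (\<sigma>(c := x)))"

lemma tuple_det_nonneg: "tuple_det d v \<sigma> \<ge> 0"
  by (simp add: tuple_det_def)

text \<open>Cramer's rule writes det A times x as the sum over c of column c times the determinant
  of A with column c replaced by x; then f is applied. With the adjugate in place of the inverse
  this also holds for singular A.\<close>

lemma cramer_functional:
  "\<bar>\<Sum>r<d. f r * v x r\<bar> * tuple_det d v \<sigma>
     \<le> (\<Sum>c<d. \<bar>\<Sum>r<d. f r * v (\<sigma> c) r\<bar> * tuple_det d v (\<sigma>(c := x)))"
proof -
  define A where "A = mat d d (\<lambda>(r, c). v (\<sigma> c) r)"
  define b where "b = vec d (v x)"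
  define y where "y = adj_mat A *\<^sub>v b"
  have A: "A \<in> carrier_mat d d" and b: "b \<in> carrier_vec d" unfolding A_def b_def by auto
  have y: "y \<in> carrier_vec d" unfolding y_def using adj_mat(1)[OF A] b by auto
  have Ay: "A *\<^sub>v y = det A \<cdot>\<^sub>v b"
  proof -
    have "A *\<^sub>v y = (A * adj_mat A) *\<^sub>v b"
      unfolding y_def using A adj_mat(1)[OF A] b by (simp add: assoc_mult_mat_vec)
    then show ?thesis unfolding adj_mat(2)[OF A] using b by auto
  qed
  have yc: "y $ c = det (mat d d (\<lambda>(r, c'). v ((\<sigma>(c := x)) c') r))" if c: "c < d" for c
  proof -
    have R: "mat d d (\<lambda>(r, c'). v ((\<sigma>(c := x)) c') r) = replace_col A b c"
      by (rule eq_matI) (auto simp: replace_col_def A_def b_def)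
    have RA: "replace_col A b c \<in> carrier_mat d d" using A by (auto simp: replace_col_def)
    \<comment> \<open>Entry c of the adjugate times b is the Laplace expansion of the replaced
      determinant along column c.\<close>
    have "y $ c = row (adj_mat A) c \<bullet> b"
      unfolding y_def using adj_mat(1)[OF A] c by auto
    also have "\<dots> = det (replace_col A b c)"
      unfolding scalar_prod_def using b c A
      by (subst laplace_expansion_column[OF RA c], auto intro!: sum.cong arg_cong[of _ _ det]
        arg_cong[of _ _ "\<lambda> x. _ * x"] eq_matI
        simp: replace_col_def adj_mat_def Matrix.row_def cofactor_def mat_delete_def ac_simps)
    finally show ?thesis unfolding R .
  qed
  have "(\<Sum>r<d. f r * v x r) * det A = (\<Sum>r<d. f r * (A *\<^sub>v y) $ r)"
    unfolding Ay sum_distrib_right by (intro sum.cong) (auto simp: b_def)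
  also have "\<dots> = (\<Sum>r<d. \<Sum>c<d. f r * v (\<sigma> c) r * y $ c)"
    using A y by (intro sum.cong refl) (auto simp: scalar_prod_def atLeast0LessThan A_def sum_distrib_left mult.assoc)
  also have "\<dots> = (\<Sum>c<d. (\<Sum>r<d. f r * v (\<sigma> c) r) * y $ c)"
    unfolding sum_distrib_right by (rule sum.swap)
  finally have "\<bar>\<Sum>r<d. f r * v x r\<bar> * \<bar>det A\<bar> = \<bar>\<Sum>c<d. (\<Sum>r<d. f r * v (\<sigma> c) r) * y $ c\<bar>"
    by (metis abs_mult)
  also have "\<dots> \<le> (\<Sum>c<d. \<bar>\<Sum>r<d. f r * v (\<sigma> c) r\<bar> * \<bar>y $ c\<bar>)"
    by (rule order_trans[OF sum_abs]) (simp add: abs_mult)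
  finally show ?thesis unfolding tuple_det_def using yc A_def by simp
qed

text \<open>Sum of \<open>cramer_functional\<close> over all tuples. Once x has overwritten slot c,
  the determinant no longer sees the entry \<open>\<sigma> c\<close>, so the sum over that entry
  factors out.\<close>

lemma tuple_volume_cramer:
  assumes Y: "finite Y"
  shows "\<bar>\<Sum>r<d. f r * v x r\<bar> * tuple_volume d v Y
     \<le> (\<Sum>y\<in>Y. \<bar>\<Sum>r<d. f r * v y r\<bar>) * tuple_width d v Y x"
proof -
  let ?g = "\<lambda>y. \<bar>\<Sum>r<d. f r * v y r\<bar>"
  have split: "(\<Sum>\<sigma>\<in>PiE {..<d} (\<lambda>_. Y). h (\<sigma> c) * tuple_det d v (\<sigma>(c := x)))
      = (\<Sum>y\<in>Y. h y) * (\<Sum>\<sigma>\<in>PiE ({..<d} - {c}) (\<lambda>_. Y). tuple_det d v (\<sigma>(c := x)))"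
    if c: "c < d" for c and h :: "'a \<Rightarrow> real"
  proof -
    let ?P = "PiE ({..<d} - {c}) (\<lambda>_. Y)"
    have P: "PiE {..<d} (\<lambda>_. Y) = (\<lambda>(y, \<sigma>). \<sigma>(c := y)) ` (Y \<times> ?P)"
      using PiE_insert_eq[of c "{..<d} - {c}" "\<lambda>_. Y"] c by (simp add: insert_absorb)
    have inj: "inj_on (\<lambda>(y, \<sigma>). \<sigma>(c := y)) (Y \<times> ?P)"
      by (rule inj_combinator) auto
    have "(\<Sum>\<sigma>\<in>PiE {..<d} (\<lambda>_. Y). h (\<sigma> c) * tuple_det d v (\<sigma>(c := x)))
      = (\<Sum>(y, \<sigma>)\<in>Y \<times> ?P. h y * tuple_det d v (\<sigma>(c := x)))"
      unfolding P by (subst sum.reindex[OF inj]) (simp add: case_prod_unfold o_def)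
    also have "\<dots> = (\<Sum>y\<in>Y. \<Sum>\<sigma>\<in>?P. h y * tuple_det d v (\<sigma>(c := x)))"
      by (rule sum.cartesian_product[symmetric])
    finally show ?thesis by (simp only: sum_product)
  qed
  have "?g x * tuple_volume d v Y = (\<Sum>\<sigma>\<in>PiE {..<d} (\<lambda>_. Y). ?g x * tuple_det d v \<sigma>)"
    unfolding tuple_volume_def by (rule sum_distrib_left)
  also have "\<dots> \<le> (\<Sum>\<sigma>\<in>PiE {..<d} (\<lambda>_. Y). \<Sum>c<d. ?g (\<sigma> c) * tuple_det d v (\<sigma>(c := x)))"
    by (intro sum_mono cramer_functional)
  also have "\<dots> = (\<Sum>c<d. \<Sum>\<sigma>\<in>PiE {..<d} (\<lambda>_. Y). ?g (\<sigma> c) * tuple_det d v (\<sigma>(c := x)))"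
    by (rule sum.swap)
  also have "\<dots> = (\<Sum>y\<in>Y. ?g y) * tuple_width d v Y x"
    unfolding tuple_width_def sum_distrib_left[of _ _ "{..<d}"] by (intro sum.cong refl split) auto
  finally show ?thesis .
qed

text \<open>Of the tuples over the union only those with at most one entry from X are kept. Since X
  and Y are disjoint, such a tuple determines the slot and the entry.\<close>

lemma tuple_volume_Un:
  assumes Y: "finite Y" "finite X" "Y \<inter> X = {}"
  shows "tuple_volume d v Y + (\<Sum>x\<in>X. tuple_width d v Y x) \<le> tuple_volume d v (Y \<union> X)"
proof -
  define S where "S = (SIGMA x:X. SIGMA c:{..<d}. PiE ({..<d} - {c}) (\<lambda>_. Y))"
  define F where "F = (\<lambda>(x, c, \<sigma>). (\<sigma> :: nat \<Rightarrow> 'a)(c := x))"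
  have S: "finite S" unfolding S_def using Y by (intro finite_SigmaI finite_PiE) auto
  have "(\<Sum>x\<in>X. tuple_width d v Y x) = (\<Sum>p\<in>S. tuple_det d v (F p))"
  proof -
    have "(\<Sum>p\<in>S. tuple_det d v (F p)) = (\<Sum>x\<in>X. \<Sum>(c, \<sigma>)\<in>(SIGMA c:{..<d}. PiE ({..<d} - {c}) (\<lambda>_. Y)). tuple_det d v (\<sigma>(c := x)))"
      unfolding S_def F_def using Y
      by (subst sum.Sigma) (auto intro!: finite_SigmaI finite_PiE sum.cong)
    also have "\<dots> = (\<Sum>x\<in>X. \<Sum>c<d. \<Sum>\<sigma>\<in>PiE ({..<d} - {c}) (\<lambda>_. Y). tuple_det d v (\<sigma>(c := x)))"
      using Y by (intro sum.cong refl) (subst sum.Sigma, auto intro!: finite_PiE)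
    finally show ?thesis unfolding tuple_width_def ..
  qed
  also have "\<dots> = (\<Sum>\<sigma>\<in>F ` S. tuple_det d v \<sigma>)"
  proof (rule sum.reindex_cong[symmetric, OF _ refl refl])
    show "inj_on F S"
    proof (rule inj_onI, clarsimp simp: F_def S_def)
      fix x c \<sigma> x' c' \<sigma>'
      assume *: "x \<in> X" "c < d" "\<sigma> \<in> PiE ({..<d} - {c}) (\<lambda>_. Y)" "x' \<in> X" "c' < d"
        "\<sigma>' \<in> PiE ({..<d} - {c'}) (\<lambda>_. Y)" "\<sigma>(c := x) = \<sigma>'(c' := x')"
      have cc: "c = c'"
      proof (rule ccontr)
        assume "c \<noteq> c'"
        then have "\<sigma>' c = x" using * by (metis fun_upd_other fun_upd_same)
        moreover have "\<sigma>' c \<in> Y" using * \<open>c \<noteq> c'\<close> by (auto simp: PiE_def Pi_def)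
        ultimately show False using * Y by auto
      qed
      moreover have "x = x'" using * cc by (metis fun_upd_same)
      moreover have "\<sigma> i = \<sigma>' i" for i
      proof (cases "i = c")
        case True
        then show ?thesis using * cc by (auto simp: PiE_def extensional_def)
      next
        case False
        then show ?thesis using * cc by (metis fun_upd_other)
      qed
      ultimately show "x = x' \<and> c = c' \<and> \<sigma> = \<sigma>'" by auto
    qed
  qed
  finally have W: "(\<Sum>x\<in>X. tuple_width d v Y x) = (\<Sum>\<sigma>\<in>F ` S. tuple_det d v \<sigma>)" .
  have "F ` S \<inter> PiE {..<d} (\<lambda>_. Y) = {}"
  proof -
    have "F p \<notin> PiE {..<d} (\<lambda>_. Y)" if p: "p \<in> S" for p
    proof -
      obtain x c \<sigma> where "p = (x, c, \<sigma>)" by (cases p) auto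
      then have "F p c = x" "x \<in> X" "c < d" using p by (auto simp: F_def S_def)
      then show ?thesis using Y by (auto simp: PiE_def Pi_def)
    qed
    then show ?thesis by blast
  qed
  then have "tuple_volume d v Y + (\<Sum>x\<in>X. tuple_width d v Y x)
      = (\<Sum>\<sigma>\<in>PiE {..<d} (\<lambda>_. Y) \<union> F ` S. tuple_det d v \<sigma>)"
    unfolding W tuple_volume_def using S Y
    by (subst sum.union_disjoint) (auto intro!: finite_PiE)
  also have "\<dots> \<le> tuple_volume d v (Y \<union> X)"
    unfolding tuple_volume_def
  proof (rule sum_mono2)
    have "F p \<in> PiE {..<d} (\<lambda>_. Y \<union> X)" if p: "p \<in> S" for p
      using p by (auto simp: F_def S_def PiE_def Pi_def extensional_def)
    then show "PiE {..<d} (\<lambda>_. Y) \<union> F ` S \<subseteq> PiE {..<d} (\<lambda>_. Y \<union> X)"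
      by (auto simp: PiE_def Pi_def)
  qed (use Y in \<open>auto intro!: finite_PiE simp: tuple_det_nonneg\<close>)
  finally show ?thesis .
qed

text \<open>Leibniz expansion with d! \<le> d^d. The constant may be crude because the volume enters
  only through its logarithm.\<close>

lemma tuple_det_le: "tuple_det d v \<sigma> \<le> real d ^ d * (\<Prod>c<d. \<Sum>r<d. \<bar>v (\<sigma> c) r\<bar>)"
proof -
  define A where "A = mat d d (\<lambda>(r, c). v (\<sigma> c) r)"
  define N where "N = (\<Prod>c<d. \<Sum>r<d. \<bar>v (\<sigma> c) r\<bar>)"
  have A: "transpose_mat A \<in> carrier_mat d d" unfolding A_def by auto
  have "tuple_det d v \<sigma> = \<bar>det (transpose_mat A)\<bar>"
    unfolding tuple_det_def A_def by (subst det_transpose) auto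
  also have "\<dots> \<le> (\<Sum>p | p permutes {0..<d}. \<bar>signof p * (\<Prod>i = 0..<d. transpose_mat A $$ (i, p i))\<bar>)"
    unfolding det_def'[OF A] by (rule sum_abs)
  also have "\<dots> \<le> (\<Sum>p | p permutes {0..<d}. N)"
  proof (rule sum_mono)
    fix p assume "p \<in> {p. p permutes {0..<d}}"
    then have p: "p permutes {0..<d}" by simp
    have pi: "p i < d" if "i < d" for i using permutes_in_image[OF p, of i] that by auto
    have "\<bar>signof p * (\<Prod>i = 0..<d. transpose_mat A $$ (i, p i))\<bar> = (\<Prod>i<d. \<bar>v (\<sigma> i) (p i)\<bar>)"
      using pi by (auto simp: abs_mult abs_prod sign_def A_def atLeast0LessThan intro!: prod.cong)
    also have "\<dots> \<le> N"
      unfolding N_def using pi by (intro prod_mono) (auto intro!: member_le_sum)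
    finally show "\<bar>signof p * (\<Prod>i = 0..<d. transpose_mat A $$ (i, p i))\<bar> \<le> N" .
  qed
  also have "\<dots> = fact d * N" by (simp add: card_permutations)
  also have "\<dots> \<le> real d ^ d * N"
  proof (rule mult_right_mono)
    show "fact d \<le> real d ^ d" by (metis fact_le_power le_refl of_nat_fact of_nat_le_iff of_nat_power)
    show "0 \<le> N" unfolding N_def by (intro prod_nonneg sum_nonneg ballI) auto
  qed
  finally show ?thesis unfolding N_def .
qed

lemma tuple_volume_le:
  assumes "finite Y"
  shows "tuple_volume d v Y \<le> (real d * (\<Sum>y\<in>Y. \<Sum>r<d. \<bar>v y r\<bar>)) ^ d"
proof -
  have "tuple_volume d v Y \<le> (\<Sum>\<sigma>\<in>PiE {..<d} (\<lambda>_. Y). real d ^ d * (\<Prod>c<d. \<Sum>r<d. \<bar>v (\<sigma> c) r\<bar>))"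
    unfolding tuple_volume_def by (intro sum_mono tuple_det_le)
  also have "\<dots> = real d ^ d * (\<Prod>c<d. \<Sum>y\<in>Y. \<Sum>r<d. \<bar>v y r\<bar>)"
    using assms prod_sum_PiE[of "{..<d}" "\<lambda>_. Y" "\<lambda>_ y. \<Sum>r<d. \<bar>v y r\<bar>"]
    by (simp only: sum_distrib_left[symmetric] finite_lessThan)
  finally show ?thesis by (simp add: power_mult_distrib)
qed

text \<open>The analogue of the elliptical potential argument for absolute values. In round k the
  functionals \<open>f k\<close> are small on all earlier vectors; if they are large on the new
  ones, the volume grows by a proportional factor, and polynomial growth leaves room for only
  logarithmically much of this. The numbers of functionals and vectors per round enter only through
  F and G.\<close>

lemma l1_pigeonhole:
  fixes f :: "nat \<Rightarrow> 'j \<Rightarrow> nat \<Rightarrow> real" and g :: "nat \<Rightarrow> 'i \<Rightarrow> nat \<Rightarrow> real"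
  assumes fin: "finite J" "finite I" and d: "d > 0" and G: "G > 0" and nn: "F \<ge> 0" "\<gamma> \<ge> 0"
    and fF: "\<And>k. k < K \<Longrightarrow> (\<Sum>j\<in>J. \<Sum>r<d. \<bar>f k j r\<bar>) \<le> F"
    and gG: "\<And>k. k < K \<Longrightarrow> (\<Sum>i\<in>I. \<Sum>r<d. \<bar>g k i r\<bar>) \<le> G"
    and data: "\<And>k. k < K \<Longrightarrow> (\<Sum>t<k. \<Sum>i\<in>I. \<Sum>j\<in>J. \<bar>\<Sum>r<d. f k j r * g t i r\<bar>) \<le> \<gamma>"
  shows "(\<Sum>k<K. \<Sum>i\<in>I. \<Sum>j\<in>J. \<bar>\<Sum>r<d. f k j r * g k i r\<bar>) \<le> 4 * (G * F + \<gamma>) * d * ln (real d + real K)"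
proof -
  \<comment> \<open>The vectors G e_r, present from the start, make the initial volume positive.
    They add at most G F to the sum of |f . y| over the earlier y, hence the term G F in
    \<open>\<Gamma>\<close>.\<close>
  define v :: "nat + nat \<times> 'i \<Rightarrow> nat \<Rightarrow> real" where
    "v = (\<lambda>y r. case y of Inl s \<Rightarrow> (if r = s then G else 0) | Inr (t, i) \<Rightarrow> g t i r)"
  define Y where "Y k = Inl ` {..<d} \<union> Inr ` ({..<k} \<times> I)" for k :: nat
  define V where "V k = tuple_volume d v (Y k)" for k
  define \<Gamma> where "\<Gamma> = G * F + \<gamma>"
  define e where "e k = (\<Sum>i\<in>I. \<Sum>j\<in>J. \<bar>\<Sum>r<d. f k j r * g k i r\<bar>)" for k
  have \<Gamma>: "\<Gamma> \<ge> 0" unfolding \<Gamma>_def using nn G by simp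
  have finY: "finite (Y k)" for k unfolding Y_def using fin by auto
  have Ysum: "(\<Sum>y\<in>Y k. h y) = (\<Sum>r<d. h (Inl r)) + (\<Sum>t<k. \<Sum>i\<in>I. h (Inr (t, i)))" for h :: "_ \<Rightarrow> real" and k
    unfolding Y_def using fin
    by (subst sum.union_disjoint) (auto simp: sum.reindex sum.cartesian_product)
  have step: "e k * V k \<le> \<Gamma> * (V (Suc k) - V k)" if k: "k < K" for k
  proof -
    let ?W = "\<lambda>i. tuple_width d v (Y k) (Inr (k, i))"
    let ?D = "\<lambda>j. \<Sum>y\<in>Y k. \<bar>\<Sum>r<d. f k j r * v y r\<bar>"
    have W: "?W i \<ge> 0" for i unfolding tuple_width_def by (intro sum_nonneg tuple_det_nonneg)
    have Dj: "(\<Sum>j\<in>J. ?D j) \<le> \<Gamma>"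
    proof -
      have "(\<Sum>j\<in>J. ?D j) = G * (\<Sum>j\<in>J. \<Sum>r<d. \<bar>f k j r\<bar>) + (\<Sum>j\<in>J. \<Sum>t<k. \<Sum>i\<in>I. \<bar>\<Sum>r<d. f k j r * g t i r\<bar>)"
        unfolding Ysum using G
        by (simp add: v_def sum.distrib abs_mult sum_distrib_left mult.commute if_distrib[of "\<lambda>x. _ * x"] cong: if_cong)
      also have "(\<Sum>j\<in>J. \<Sum>t<k. \<Sum>i\<in>I. \<bar>\<Sum>r<d. f k j r * g t i r\<bar>) = (\<Sum>t<k. \<Sum>j\<in>J. \<Sum>i\<in>I. \<bar>\<Sum>r<d. f k j r * g t i r\<bar>)"
        by (rule sum.swap)
      also have "\<dots> = (\<Sum>t<k. \<Sum>i\<in>I. \<Sum>j\<in>J. \<bar>\<Sum>r<d. f k j r * g t i r\<bar>)"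
        by (intro sum.cong refl sum.swap)
      finally show ?thesis unfolding \<Gamma>_def
        using data[OF k] mult_left_mono[OF fF[OF k], of G] G by linarith
    qed
    have "e k * V k = (\<Sum>i\<in>I. \<Sum>j\<in>J. \<bar>\<Sum>r<d. f k j r * v (Inr (k, i)) r\<bar> * V k)"
      unfolding e_def sum_distrib_right by (simp add: v_def)
    also have "\<dots> \<le> (\<Sum>i\<in>I. \<Sum>j\<in>J. ?D j * ?W i)"
      unfolding V_def by (intro sum_mono tuple_volume_cramer finY)
    also have "\<dots> = (\<Sum>j\<in>J. ?D j) * (\<Sum>i\<in>I. ?W i)"
      unfolding sum_product by (rule sum.swap)
    also have "\<dots> \<le> \<Gamma> * (\<Sum>i\<in>I. ?W i)"
      by (intro mult_right_mono Dj sum_nonneg W)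
    also have "(\<Sum>i\<in>I. ?W i) = (\<Sum>x\<in>(\<lambda>i. Inr (k, i)) ` I. tuple_width d v (Y k) x)"
      by (subst sum.reindex) (auto simp: inj_on_def)
    also have "\<dots> \<le> V (Suc k) - V k"
    proof -
      have "Y (Suc k) = Y k \<union> (\<lambda>i. Inr (k, i)) ` I"
        unfolding Y_def by (auto simp: less_Suc_eq)
      moreover have "Y k \<inter> (\<lambda>i. Inr (k, i)) ` I = {}" unfolding Y_def by auto
      ultimately show ?thesis
        unfolding V_def using tuple_volume_Un[OF finY, of "(\<lambda>i. Inr (k, i)) ` I" k d v] fin by simp
    qed
    finally show ?thesis using \<Gamma> by (simp add: mult_left_mono)
  qed
  \<comment> \<open>For rounds in which the volume more than doubles; there the bound from
    \<open>step\<close> alone would not be logarithmic.\<close>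
  have e_le: "e k \<le> \<Gamma>" if k: "k < K" for k
  proof -
    have "e k \<le> (\<Sum>i\<in>I. \<Sum>j\<in>J. (\<Sum>r<d. \<bar>f k j r\<bar>) * (\<Sum>r<d. \<bar>g k i r\<bar>))"
      unfolding e_def
    proof (intro sum_mono)
      fix i j
      have "\<bar>\<Sum>r<d. f k j r * g k i r\<bar> \<le> (\<Sum>r<d. \<bar>f k j r\<bar> * \<bar>g k i r\<bar>)"
        by (rule order_trans[OF sum_abs]) (simp add: abs_mult)
      also have "\<dots> \<le> (\<Sum>r<d. \<bar>f k j r\<bar> * (\<Sum>r<d. \<bar>g k i r\<bar>))"
        by (intro sum_mono mult_left_mono member_le_sum) auto
      finally show "\<bar>\<Sum>r<d. f k j r * g k i r\<bar> \<le> (\<Sum>r<d. \<bar>f k j r\<bar>) * (\<Sum>r<d. \<bar>g k i r\<bar>)"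
        by (simp add: sum_distrib_right)
    qed
    also have "\<dots> = (\<Sum>i\<in>I. \<Sum>r<d. \<bar>g k i r\<bar>) * (\<Sum>j\<in>J. \<Sum>r<d. \<bar>f k j r\<bar>)"
      unfolding sum_product[of "\<lambda>i. \<Sum>r<d. \<bar>g k i r\<bar>"] by (simp add: mult.commute)
    also have "\<dots> \<le> G * F"
      using G by (intro mult_mono fF gG k) (auto intro!: sum_nonneg)
    finally show ?thesis unfolding \<Gamma>_def using nn by simp
  qed
  have V0: "V 0 \<ge> G ^ d"
  proof -
    let ?\<sigma> = "restrict Inl {..<d} :: nat \<Rightarrow> nat + nat \<times> 'i"
    have "mat d d (\<lambda>(r, c). v (?\<sigma> c) r) = G \<cdot>\<^sub>m 1\<^sub>m d"
      by (rule eq_matI) (auto simp: v_def)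
    then have "tuple_det d v ?\<sigma> = G ^ d" unfolding tuple_det_def using G by simp
    moreover have "tuple_det d v ?\<sigma> \<le> V 0" unfolding V_def tuple_volume_def
    proof (rule member_le_sum)
      show "?\<sigma> \<in> PiE {..<d} (\<lambda>_. Y 0)" by (rule restrict_PiE_iff[THEN iffD2]) (auto simp: Y_def)
    qed (auto simp: tuple_det_nonneg intro!: finite_PiE finY)
    ultimately show ?thesis by simp
  qed
  have Vmono: "V k \<le> V (Suc k)" for k
    unfolding V_def tuple_volume_def
    by (intro sum_mono2 finite_PiE PiE_mono finY tuple_det_nonneg) (auto simp: Y_def less_Suc_eq)
  have V_pos: "V k > 0" for k
  proof -
    have "V 0 \<le> V k" by (rule lift_Suc_mono_le[of V]) (auto simp: Vmono)
    then show ?thesis using V0 G by (smt (verit) zero_less_power)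
  qed
  have e_ln: "e k \<le> 2 * \<Gamma> * (ln (V (Suc k)) - ln (V k))" if k: "k < K" for k
  proof -
    define u where "u = V (Suc k) / V k"
    have u: "u \<ge> 1" unfolding u_def using Vmono V_pos[of k] by simp
    have "1 - 1 / u \<le> ln u"
      using ln_one_minus_pos_lower_bound ln_le_minus_one[of "1 / u"] u by (simp add: ln_div)
    \<comment> \<open>With 1 - 1 / u \<le> ln u this trades the relative growth, capped at 1, for a
      logarithm that telescopes. The factor 2 is attained at u = 2.\<close>
    moreover have "min 1 (u - 1) \<le> 2 * (1 - 1 / u)"
    proof (cases "u \<ge> 2")
      case False
      then have "0 \<le> (u - 1) * (2 - u)" using u by simp
      then show ?thesis using u False by (simp add: field_simps)
    qed (simp add: field_simps)
    ultimately have *: "min 1 (u - 1) \<le> 2 * ln u"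
      by (meson mult_left_mono order_trans zero_le_numeral)
    have "e k \<le> \<Gamma> * (u - 1)"
      using step[OF k] V_pos[of k] unfolding u_def by (simp add: field_simps)
    with e_le[OF k] have "e k \<le> \<Gamma> * min 1 (u - 1)" by (auto simp: min_def)
    also have "\<dots> \<le> \<Gamma> * (2 * ln u)" by (intro mult_left_mono * \<Gamma>)
    finally show ?thesis unfolding u_def using V_pos[of k] V_pos[of "Suc k"] by (simp add: ln_div algebra_simps)
  qed
  have "(\<Sum>k<K. e k) \<le> (\<Sum>k<K. 2 * \<Gamma> * (ln (V (Suc k)) - ln (V k)))"
    by (intro sum_mono e_ln) auto
  also have "\<dots> = 2 * \<Gamma> * (ln (V K) - ln (V 0))"
    using sum_lessThan_telescope[of "\<lambda>k. ln (V k)" K] by (simp flip: sum_distrib_left)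
  \<comment> \<open>The final volume is at most (d G (d + K))^d and the initial one at least G^d, so
    the scale G cancels; d \<le> d + K gives the exponent 2 d.\<close>
  also have "\<dots> \<le> 2 * \<Gamma> * (2 * d * ln (real d + real K))"
  proof (intro mult_left_mono)
    have "V K \<le> (real d * (\<Sum>y\<in>Y K. \<Sum>r<d. \<bar>v y r\<bar>)) ^ d"
      unfolding V_def by (rule tuple_volume_le[OF finY])
    also have "\<dots> \<le> (real d * (G * (real d + real K))) ^ d"
    proof (intro power_mono mult_left_mono mult_nonneg_nonneg sum_nonneg)
      have "(\<Sum>y\<in>Y K. \<Sum>r<d. \<bar>v y r\<bar>) = d * G + (\<Sum>t<K. \<Sum>i\<in>I. \<Sum>r<d. \<bar>g t i r\<bar>)"
        unfolding Ysum using G by (simp add: v_def if_distrib[of abs] cong: if_cong)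
      also have "\<dots> \<le> d * G + (\<Sum>t<K. G)"
        by (intro add_left_mono sum_mono gG) auto
      finally show "(\<Sum>y\<in>Y K. \<Sum>r<d. \<bar>v y r\<bar>) \<le> G * (real d + real K)" by (simp add: algebra_simps)
    qed auto
    also have "\<dots> \<le> ((real d + real K) * (G * (real d + real K))) ^ d"
      using G by (intro power_mono mult_right_mono mult_nonneg_nonneg) auto
    also have "\<dots> = G ^ d * (real d + real K) ^ (2 * d)"
      by (simp add: power_mult_distrib power_mult power2_eq_square mult_ac)
    also have "\<dots> \<le> V 0 * (real d + real K) ^ (2 * d)" using V0 by (intro mult_right_mono) auto
    finally have "ln (V K) \<le> ln (V 0 * (real d + real K) ^ (2 * d))"
      using V_pos by (subst ln_le_cancel_iff) (use d in \<open>auto intro!: mult_pos_pos\<close>)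
    also have "\<dots> = ln (V 0) + 2 * d * ln (real d + real K)"
      using V_pos[of 0] d by (simp add: ln_mult ln_realpow)
    finally show "ln (V K) - ln (V 0) \<le> 2 * d * ln (real d + real K)" by simp
  qed (use \<Gamma> in auto)
  finally show ?thesis unfolding e_def \<Gamma>_def by (simp add: algebra_simps)
qed

section \<open>Trajectories and hidden Markov kernels\<close>

lemma trajectories_0 [simp]: "trajectories nA nO 0 = {[]}"
  by (auto simp: trajectories_def)

lemma length_trajectories: "\<tau> \<in> trajectories nA nO n \<Longrightarrow> length \<tau> = n"
  by (simp add: trajectories_def)

lemma finite_trajectories [simp]: "finite (trajectories nA nO n)"
proof -
  have "trajectories nA nO n = {\<tau>. set \<tau> \<subseteq> {..<nO} \<times> {..<nA} \<and> length \<tau> = n}"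
    by (auto simp: trajectories_def)
  then show ?thesis using finite_lists_length_eq[of "{..<nO} \<times> {..<nA}" n] by simp
qed

lemma sum_trajectories_add:
  "(\<Sum>\<tau>\<in>trajectories nA nO (i + j). g \<tau>)
     = (\<Sum>\<tau>\<^sub>1\<in>trajectories nA nO i. \<Sum>\<tau>\<^sub>2\<in>trajectories nA nO j. g (\<tau>\<^sub>1 @ \<tau>\<^sub>2))"
proof -
  have "(\<Sum>\<tau>\<in>trajectories nA nO (i + j). g \<tau>)
    = (\<Sum>(\<tau>\<^sub>1, \<tau>\<^sub>2)\<in>trajectories nA nO i \<times> trajectories nA nO j. g (\<tau>\<^sub>1 @ \<tau>\<^sub>2))"
    by (rule sum.reindex_bij_witness[of _ "\<lambda>(a, b). a @ b" "\<lambda>\<tau>. (take i \<tau>, drop i \<tau>)"])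
      (auto simp: trajectories_def dest: in_set_takeD in_set_dropD)
  then show ?thesis by (simp add: sum.cartesian_product)
qed

lemma sum_trajectories_Suc:
  "(\<Sum>\<tau>\<in>trajectories nA nO (Suc n). g \<tau>)
     = (\<Sum>ob<nO. \<Sum>a<nA. \<Sum>\<tau>\<in>trajectories nA nO n. g ((ob, a) # \<tau>))"
proof -
  have "(\<Sum>\<tau>\<in>trajectories nA nO (Suc n). g \<tau>)
    = (\<Sum>((ob, a), \<tau>)\<in>({..<nO} \<times> {..<nA}) \<times> trajectories nA nO n. g ((ob, a) # \<tau>))"
    by (rule sum.reindex_bij_witness[of _ "\<lambda>(x, \<tau>). x # \<tau>" "\<lambda>\<tau>. (hd \<tau>, tl \<tau>)"])
      (force simp: trajectories_def length_Suc_conv)+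
  also have "\<dots> = (\<Sum>p\<in>{..<nO} \<times> {..<nA}. \<Sum>\<tau>\<in>trajectories nA nO n. g (p # \<tau>))"
    by (subst sum.cartesian_product) (auto intro!: sum.cong)
  also have "\<dots> = (\<Sum>ob<nO. \<Sum>a<nA. \<Sum>\<tau>\<in>trajectories nA nO n. g ((ob, a) # \<tau>))"
    by (subst sum.cartesian_product) (simp add: case_prod_unfold)
  finally show ?thesis .
qed

lemma sum_trajectories_1:
  "(\<Sum>\<tau>\<in>trajectories nA nO (Suc 0). g \<tau>) = (\<Sum>ob<nO. \<Sum>a<nA. g [(ob, a)])"
  by (simp add: sum_trajectories_Suc)

text \<open>
  Likelihood of the observations in \<open>\<tau>\<close> from state \<open>s\<close> at step \<open>h\<close>, given the actions in \<open>\<tau>\<close>.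
  The last action has no influence.
\<close>

fun fut :: "nat \<Rightarrow> (nat \<Rightarrow> nat \<Rightarrow> nat \<Rightarrow> nat \<Rightarrow> real) \<Rightarrow> (nat \<Rightarrow> nat \<Rightarrow> nat \<Rightarrow> real) \<Rightarrow>
    nat \<Rightarrow> nat \<Rightarrow> traj \<Rightarrow> real" where
  "fut nS T E h s [] = 1"
| "fut nS T E h s ((ob, a) # \<tau>) =
     E h s ob * (if \<tau> = [] then 1 else \<Sum>s'<nS. T h a s s' * fut nS T E (Suc h) s' \<tau>)"

text \<open>Unnormalised distribution of the state after \<open>\<tau>\<close>, starting from \<open>v\<close> at step \<open>h\<close>.\<close>

fun fwd :: "nat \<Rightarrow> (nat \<Rightarrow> nat \<Rightarrow> nat \<Rightarrow> nat \<Rightarrow> real) \<Rightarrow> (nat \<Rightarrow> nat \<Rightarrow> nat \<Rightarrow> real) \<Rightarrow>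
    (nat \<Rightarrow> real) \<Rightarrow> nat \<Rightarrow> traj \<Rightarrow> nat \<Rightarrow> real" where
  "fwd nS T E v h [] = v"
| "fwd nS T E v h ((ob, a) # \<tau>) =
     fwd nS T E (\<lambda>s'. \<Sum>s<nS. v s * (E h s ob * T h a s s')) (Suc h) \<tau>"

fun policy_prob :: "policy \<Rightarrow> traj \<Rightarrow> traj \<Rightarrow> real" where
  "policy_prob \<pi> hist [] = 1"
| "policy_prob \<pi> hist ((ob, a) # \<tau>) = pmf (\<pi> hist ob) a * policy_prob \<pi> (hist @ [(ob, a)]) \<tau>"

text \<open>The part of a trajectory probability that does not depend on the policy. The kernels are
  arbitrary real functions because the rounded-up parameters of the brackets need not sum to
  1.\<close>

definition lik :: "nat \<Rightarrow> (nat \<Rightarrow> real) \<Rightarrow> (nat \<Rightarrow> nat \<Rightarrow> nat \<Rightarrow> nat \<Rightarrow> real) \<Rightarrow>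
    (nat \<Rightarrow> nat \<Rightarrow> nat \<Rightarrow> real) \<Rightarrow> traj \<Rightarrow> real" where
  "lik nS mu T E \<tau> = (\<Sum>s<nS. mu s * fut nS T E (Suc 0) s \<tau>)"

lemma policy_prob_nonneg [simp]: "policy_prob \<pi> hist \<tau> \<ge> 0"
  by (induction \<pi> hist \<tau> rule: policy_prob.induct) auto

lemma policy_prob_le_1: "policy_prob \<pi> hist \<tau> \<le> 1"
  by (induction \<pi> hist \<tau> rule: policy_prob.induct) (auto intro!: mult_le_one simp: pmf_le_1)

lemma uniform_after_policies:
  "\<pi> \<in> policies nA nO H \<Longrightarrow> nA > 0 \<Longrightarrow> uniform_after nA j \<pi> \<in> policies nA nO H"
  by (auto simp: policies_def uniform_after_def lessThan_empty_iff)

lemma policy_prob_append: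
  "policy_prob \<pi> hist (\<tau>\<^sub>1 @ \<tau>\<^sub>2) = policy_prob \<pi> hist \<tau>\<^sub>1 * policy_prob \<pi> (hist @ \<tau>\<^sub>1) \<tau>\<^sub>2"
  by (induction \<pi> hist \<tau>\<^sub>1 rule: policy_prob.induct) (auto simp: mult.assoc)

lemma fwd_append: "fwd nS T E v h (\<tau>\<^sub>1 @ \<tau>\<^sub>2) = fwd nS T E (fwd nS T E v h \<tau>\<^sub>1) (h + length \<tau>\<^sub>1) \<tau>\<^sub>2"
  by (induction nS T E v h \<tau>\<^sub>1 rule: fwd.induct) auto

text \<open>Markov property at an intermediate step. For \<open>\<tau>\<^sub>2 = []\<close> the
  sides could differ, because \<open>fut\<close> stops before the transition after the last
  observation whereas \<open>fwd\<close> performs it.\<close>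

lemma fut_append:
  assumes "\<tau>\<^sub>2 \<noteq> []"
  shows "(\<Sum>s<nS. v s * fut nS T E h s (\<tau>\<^sub>1 @ \<tau>\<^sub>2))
     = (\<Sum>s<nS. fwd nS T E v h \<tau>\<^sub>1 s * fut nS T E (h + length \<tau>\<^sub>1) s \<tau>\<^sub>2)"
proof (induction \<tau>\<^sub>1 arbitrary: v h)
  case (Cons x \<tau>\<^sub>1)
  obtain ob a where x: "x = (ob, a)" by force
  have "(\<Sum>s<nS. v s * fut nS T E h s ((x # \<tau>\<^sub>1) @ \<tau>\<^sub>2))
    = (\<Sum>s<nS. \<Sum>s'<nS. v s * (E h s ob * T h a s s') * fut nS T E (Suc h) s' (\<tau>\<^sub>1 @ \<tau>\<^sub>2))"
    using assms by (simp add: x sum_distrib_left mult.assoc)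
  also have "\<dots> = (\<Sum>s'<nS. (\<Sum>s<nS. v s * (E h s ob * T h a s s')) * fut nS T E (Suc h) s' (\<tau>\<^sub>1 @ \<tau>\<^sub>2))"
    unfolding sum_distrib_right by (rule sum.swap)
  finally show ?case unfolding Cons.IH by (simp add: x)
qed simp

lemma lik_append:
  "\<tau>\<^sub>2 \<noteq> [] \<Longrightarrow> lik nS mu T E (\<tau>\<^sub>1 @ \<tau>\<^sub>2)
     = (\<Sum>s<nS. fut nS T E (Suc (length \<tau>\<^sub>1)) s \<tau>\<^sub>2 * fwd nS T E mu (Suc 0) \<tau>\<^sub>1 s)"
  unfolding lik_def by (subst fut_append) (auto simp: mult.commute)

lemma fut_nonneg:
  assumes "\<And>h a s s'. T h a s s' \<ge> 0" "\<And>h s ob. E h s ob \<ge> 0"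
  shows "fut nS T E h s \<tau> \<ge> 0"
  by (induction \<tau> arbitrary: h s) (auto simp: assms intro!: mult_nonneg_nonneg sum_nonneg)

lemma fwd_nonneg:
  assumes "\<And>h a s s'. T h a s s' \<ge> 0" "\<And>h s ob. E h s ob \<ge> 0" "\<And>s. v s \<ge> 0"
  shows "fwd nS T E v h \<tau> s \<ge> 0"
  using assms(3)
proof (induction \<tau> arbitrary: h v)
  case (Cons x \<tau>)
  obtain ob a where x: "x = (ob, a)" by force
  show ?case unfolding x fwd.simps
    by (rule Cons.IH) (intro sum_nonneg mult_nonneg_nonneg assms Cons.prems)
qed simp

lemma fut_mono:
  assumes nonneg: "\<And>h a s s'. 0 \<le> T h a s s'" "\<And>h s ob. 0 \<le> E h s ob"
    and T: "\<And>h a s s'. 1 \<le> h \<Longrightarrow> h < H \<Longrightarrow> a < nA \<Longrightarrow> s < nS \<Longrightarrow> s' < nS \<Longrightarrow> T h a s s' \<le> T' h a s s'"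
    and E: "\<And>h s ob. 1 \<le> h \<Longrightarrow> h \<le> H \<Longrightarrow> s < nS \<Longrightarrow> ob < nO \<Longrightarrow> E h s ob \<le> E' h s ob"
  shows "\<lbrakk>\<tau> \<in> trajectories nA nO n; 1 \<le> h; h + n \<le> Suc H; s < nS\<rbrakk> \<Longrightarrow> fut nS T E h s \<tau> \<le> fut nS T' E' h s \<tau>"
proof (induction n arbitrary: h s \<tau>)
  case (Suc n)
  obtain ob a \<tau>' where \<tau>: "\<tau> = (ob, a) # \<tau>'" "\<tau>' \<in> trajectories nA nO n" "ob < nO" "a < nA"
    using Suc.prems(1) unfolding trajectories_def length_Suc_conv by auto
  have E': "0 \<le> E h s ob" "E h s ob \<le> E' h s ob" using Suc.prems \<tau> by (auto intro!: E nonneg)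
  have tail: "T h a s s' * fut nS T E (Suc h) s' \<tau>' \<le> T' h a s s' * fut nS T' E' (Suc h) s' \<tau>'"
    if "s' < nS" "\<tau>' \<noteq> []" for s'
  proof -
    have "h < H" using that \<tau>(2) Suc.prems by (cases n) auto
    then have "0 \<le> T h a s s'" "T h a s s' \<le> T' h a s s'" using Suc.prems \<tau> that by (auto intro!: T nonneg)
    moreover have "fut nS T E (Suc h) s' \<tau>' \<le> fut nS T' E' (Suc h) s' \<tau>'"
      using Suc.prems \<tau> that by (intro Suc.IH) auto
    ultimately show ?thesis using fut_nonneg[of T E, OF nonneg] by (intro mult_mono) auto
  qed
  show ?case
  proof (cases "\<tau>' = []")
    case False
    have "0 \<le> (\<Sum>s'<nS. T h a s s' * fut nS T E (Suc h) s' \<tau>')"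
      by (intro sum_nonneg mult_nonneg_nonneg nonneg fut_nonneg)
    moreover have "(\<Sum>s'<nS. T h a s s' * fut nS T E (Suc h) s' \<tau>') \<le> (\<Sum>s'<nS. T' h a s s' * fut nS T' E' (Suc h) s' \<tau>')"
      using False by (intro sum_mono tail) auto
    ultimately show ?thesis using False E' unfolding \<tau>(1) by (auto intro!: mult_mono)
  qed (use E' \<tau> in simp)
qed simp

lemma sum_pmf_lessThan_le_1: "(\<Sum>a<n. pmf p a) \<le> 1" for n :: nat
  using measure_pmf.prob_le_1[of p "{..<n}"] by (simp add: measure_measure_pmf_finite)

lemma sum_pmf_lessThan_eq_1: "set_pmf p \<subseteq> {..<n} \<Longrightarrow> (\<Sum>a<n. pmf p a) = 1" for n :: nat
  by (rule sum_pmf_eq_1) auto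

lemma sum_policy_prob_fut_Suc:
  "(\<Sum>\<tau>\<in>trajectories nA nO (Suc n). policy_prob \<pi> hist \<tau> * fut nS T E h s \<tau>)
    = (\<Sum>ob<nO. E h s ob * (\<Sum>a<nA. pmf (\<pi> hist ob) a * (if n = 0 then 1 else
        \<Sum>s'<nS. T h a s s' * (\<Sum>\<tau>\<in>trajectories nA nO n. policy_prob \<pi> (hist @ [(ob, a)]) \<tau> * fut nS T E (Suc h) s' \<tau>))))"
proof (cases "n = 0")
  case False
  then have "\<tau> \<noteq> []" if "\<tau> \<in> trajectories nA nO n" for \<tau> using that by (auto simp: trajectories_def)
  then have "(\<Sum>\<tau>\<in>trajectories nA nO (Suc n). policy_prob \<pi> hist \<tau> * fut nS T E h s \<tau>)
    = (\<Sum>ob<nO. \<Sum>a<nA. \<Sum>\<tau>\<in>trajectories nA nO n. \<Sum>s'<nS. E h s ob * (pmf (\<pi> hist ob) a *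
        (T h a s s' * (policy_prob \<pi> (hist @ [(ob, a)]) \<tau> * fut nS T E (Suc h) s' \<tau>))))"
    unfolding sum_trajectories_Suc by (intro sum.cong refl) (simp add: sum_distrib_left mult_ac)
  also have "\<dots> = (\<Sum>ob<nO. \<Sum>a<nA. \<Sum>s'<nS. \<Sum>\<tau>\<in>trajectories nA nO n. E h s ob * (pmf (\<pi> hist ob) a *
        (T h a s s' * (policy_prob \<pi> (hist @ [(ob, a)]) \<tau> * fut nS T E (Suc h) s' \<tau>))))"
    by (intro sum.cong refl sum.swap)
  finally show ?thesis using False by (simp add: sum_distrib_left)
qed (simp add: sum_trajectories_Suc sum_distrib_left mult_ac)

text \<open>Meant for the rounded-up kernels: row sums of at most t and e let the mass grow by a
  factor t e per step, whatever the policy.\<close>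

lemma sum_policy_prob_fut_le:
  assumes "\<And>h a s s'. T h a s s' \<ge> 0" "\<And>h s ob. E h s ob \<ge> 0"
    and T: "\<And>h a s. 1 \<le> h \<Longrightarrow> h < H \<Longrightarrow> a < nA \<Longrightarrow> s < nS \<Longrightarrow> (\<Sum>s'<nS. T h a s s') \<le> t"
    and E: "\<And>h s. 1 \<le> h \<Longrightarrow> h \<le> H \<Longrightarrow> s < nS \<Longrightarrow> (\<Sum>ob<nO. E h s ob) \<le> e"
    and te: "t \<ge> 1" "e \<ge> 1"
    and "1 \<le> h" "h + n \<le> Suc H" "s < nS"
  shows "(\<Sum>\<tau>\<in>trajectories nA nO n. policy_prob \<pi> hist \<tau> * fut nS T E h s \<tau>) \<le> (t * e) ^ n"
  using assms(7-)
proof (induction n arbitrary: h s hist)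
  case (Suc n)
  have te1: "(t * e) ^ n \<ge> 1" "t * e \<ge> 1" using te by (auto intro!: one_le_power simp: mult_ge1_I)
  have inner: "(if n = 0 then 1 else \<Sum>s'<nS. T h a s s' *
      (\<Sum>\<tau>\<in>trajectories nA nO n. policy_prob \<pi> (hist @ [(ob, a)]) \<tau> * fut nS T E (Suc h) s' \<tau>)) \<le> t * (t * e) ^ n"
    if a: "a < nA" for a ob
  proof (cases "n = 0")
    case True
    then show ?thesis using te by simp
  next
    case False
    have "(\<Sum>s'<nS. T h a s s' * (\<Sum>\<tau>\<in>trajectories nA nO n. policy_prob \<pi> (hist @ [(ob, a)]) \<tau> * fut nS T E (Suc h) s' \<tau>))
      \<le> (\<Sum>s'<nS. T h a s s' * (t * e) ^ n)"
      using Suc.prems by (intro sum_mono mult_left_mono Suc.IH assms(1)) auto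
    also have "\<dots> \<le> t * (t * e) ^ n"
      unfolding sum_distrib_right[symmetric] using te1 Suc.prems False a by (intro mult_right_mono T) auto
    finally show ?thesis using False by simp
  qed
  have "(\<Sum>\<tau>\<in>trajectories nA nO (Suc n). policy_prob \<pi> hist \<tau> * fut nS T E h s \<tau>)
    \<le> (\<Sum>ob<nO. E h s ob * (\<Sum>a<nA. pmf (\<pi> hist ob) a * (t * (t * e) ^ n)))"
    unfolding sum_policy_prob_fut_Suc
    by (intro sum_mono mult_left_mono inner assms) auto
  also have "\<dots> \<le> (\<Sum>ob<nO. E h s ob * (1 * (t * (t * e) ^ n)))"
    unfolding sum_distrib_right[symmetric, where A = "{..<nA}"] using te te1
    by (intro sum_mono mult_left_mono mult_right_mono sum_pmf_lessThan_le_1 assms) auto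
  also have "\<dots> \<le> e * (1 * (t * (t * e) ^ n))"
    unfolding sum_distrib_right[symmetric] using te te1 Suc.prems by (intro mult_right_mono E) auto
  finally show ?case by (simp add: mult_ac)
qed simp

locale hmm =
  fixes nS nA nO H :: nat and mu :: "nat \<Rightarrow> real"
    and T :: "nat \<Rightarrow> nat \<Rightarrow> nat \<Rightarrow> nat \<Rightarrow> real" and E :: "nat \<Rightarrow> nat \<Rightarrow> nat \<Rightarrow> real"
  assumes mu_nonneg: "\<And>s. mu s \<ge> 0"
    and T_nonneg: "\<And>h a s s'. T h a s s' \<ge> 0"
    and E_nonneg: "\<And>h s ob. E h s ob \<ge> 0"
    and sum_mu: "(\<Sum>s<nS. mu s) = 1"
    and sum_T: "\<And>h a s. 1 \<le> h \<Longrightarrow> h < H \<Longrightarrow> a < nA \<Longrightarrow> s < nS \<Longrightarrow> (\<Sum>s'<nS. T h a s s') = 1"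
    and sum_E: "\<And>h s. 1 \<le> h \<Longrightarrow> h \<le> H \<Longrightarrow> s < nS \<Longrightarrow> (\<Sum>ob<nO. E h s ob) = 1"
begin

abbreviation "F \<equiv> fut nS T E"
abbreviation "bel \<equiv> fwd nS T E mu (Suc 0)"
abbreviation "L \<equiv> lik nS mu T E"
abbreviation "tr \<equiv> trajectories nA nO"

lemma F_nonneg [simp]: "F h s \<tau> \<ge> 0"
  by (intro fut_nonneg T_nonneg E_nonneg)

lemma bel_nonneg [simp]: "bel \<tau> s \<ge> 0"
  by (intro fwd_nonneg T_nonneg E_nonneg mu_nonneg)

lemma L_nonneg [simp]: "L \<tau> \<ge> 0"
  unfolding lik_def by (intro sum_nonneg mult_nonneg_nonneg mu_nonneg F_nonneg)

lemma sum_policy_prob_fut: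
  assumes \<pi>: "\<pi> \<in> policies nA nO H"
  shows "\<lbrakk>hist \<in> tr (h - 1); 1 \<le> h; h + n \<le> Suc H; s < nS\<rbrakk> \<Longrightarrow>
    (\<Sum>\<tau>\<in>tr n. policy_prob \<pi> hist \<tau> * F h s \<tau>) = 1"
proof (induction n arbitrary: h s hist)
  case (Suc n)
  have len: "length hist < H" using Suc.prems by (auto simp: trajectories_def)
  have one: "(\<Sum>a<nA. pmf (\<pi> hist ob) a) = 1" if "ob < nO" for ob
    using \<pi> Suc.prems len that by (intro sum_pmf_lessThan_eq_1) (auto simp: policies_def trajectories_def)
  have inner: "(if n = 0 then 1 else \<Sum>s'<nS. T h a s s' *
      (\<Sum>\<tau>\<in>tr n. policy_prob \<pi> (hist @ [(ob, a)]) \<tau> * F (Suc h) s' \<tau>)) = 1"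
    if a: "a < nA" "ob < nO" for a ob
  proof (cases "n = 0")
    case False
    have "hist @ [(ob, a)] \<in> tr (Suc h - 1)" using Suc.prems a by (auto simp: trajectories_def)
    then have "(\<Sum>s'<nS. T h a s s' * (\<Sum>\<tau>\<in>tr n. policy_prob \<pi> (hist @ [(ob, a)]) \<tau> * F (Suc h) s' \<tau>))
      = (\<Sum>s'<nS. T h a s s')"
      using Suc.prems by (intro sum.cong refl) (simp add: Suc.IH)
    then show ?thesis using sum_T[of h a s] Suc.prems a False by simp
  qed simp
  have "(\<Sum>\<tau>\<in>tr (Suc n). policy_prob \<pi> hist \<tau> * F h s \<tau>) = (\<Sum>ob<nO. E h s ob * (\<Sum>a<nA. pmf (\<pi> hist ob) a * 1))"
    unfolding sum_policy_prob_fut_Suc by (intro sum.cong refl arg_cong2[of _ _ _ _ "(*)"] inner) auto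
  also have "\<dots> = (\<Sum>ob<nO. E h s ob)" using one by simp
  finally show ?case using sum_E[of h s] Suc.prems by simp
qed simp

text \<open>Without policy weights each of the nA^n action sequences, the ineffective last action
  included, carries total mass 1.\<close>

lemma sum_fut: "\<lbrakk>1 \<le> h; h + n \<le> Suc H; s < nS\<rbrakk> \<Longrightarrow> (\<Sum>\<tau>\<in>tr n. F h s \<tau>) = real nA ^ n"
proof (induction n arbitrary: h s)
  case (Suc n)
  show ?case
  proof (cases "n = 0")
    case True
    then show ?thesis using sum_E[of h s] Suc.prems
      by (simp add: sum_trajectories_1 flip: sum_distrib_left)
  next
    case False
    then have "\<tau> \<noteq> []" if "\<tau> \<in> tr n" for \<tau> using that by (auto simp: trajectories_def)
    then have "(\<Sum>\<tau>\<in>tr (Suc n). F h s \<tau>)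
      = (\<Sum>ob<nO. \<Sum>a<nA. E h s ob * (\<Sum>\<tau>\<in>tr n. \<Sum>s'<nS. T h a s s' * F (Suc h) s' \<tau>))"
      unfolding sum_trajectories_Suc by (intro sum.cong refl) (simp add: sum_distrib_left)
    also have "\<dots> = (\<Sum>ob<nO. \<Sum>a<nA. E h s ob * (\<Sum>s'<nS. T h a s s' * (\<Sum>\<tau>\<in>tr n. F (Suc h) s' \<tau>)))"
      by (subst sum.swap[of _ _ "tr n"]) (simp add: sum_distrib_left)
    also have "\<dots> = (\<Sum>ob<nO. \<Sum>a<nA. E h s ob * (real nA ^ n * (\<Sum>s'<nS. T h a s s')))"
      using Suc by (simp add: sum_distrib_left mult.commute)
    also have "\<dots> = (\<Sum>ob<nO. \<Sum>a<nA. E h s ob * real nA ^ n)"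
      using Suc.prems False by (intro sum.cong refl) (simp add: sum_T)
    also have "\<dots> = real nA ^ Suc n * (\<Sum>ob<nO. E h s ob)"
      by (simp add: sum_distrib_left mult_ac)
    finally show ?thesis using sum_E[of h s] Suc.prems by simp
  qed
qed simp

text \<open>The transition after the last observation of \<tau> must be stochastic, and
  \<open>sum_T\<close> says so only before step H; hence h + n \<le> H here instead of H +
  1.\<close>

lemma sum_fwd:
  "\<lbrakk>\<tau> \<in> tr n; 1 \<le> h; h + n \<le> H\<rbrakk> \<Longrightarrow> (\<Sum>s<nS. fwd nS T E v h \<tau> s) = (\<Sum>s<nS. v s * F h s \<tau>)"
proof (induction n arbitrary: \<tau> h v)
  case 0
  then show ?case by (simp)
next
  case (Suc n)
  obtain ob a \<tau>' where \<tau>: "\<tau> = (ob, a) # \<tau>'" "\<tau>' \<in> tr n" "ob < nO" "a < nA"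
    using Suc.prems(1) unfolding trajectories_def length_Suc_conv by auto
  let ?w = "\<lambda>s'. \<Sum>s<nS. v s * (E h s ob * T h a s s')"
  have "(\<Sum>s<nS. fwd nS T E v h \<tau> s) = (\<Sum>s'<nS. ?w s' * F (Suc h) s' \<tau>')"
    unfolding \<tau> using Suc.prems \<tau> by (simp add: Suc.IH)
  also have "\<dots> = (\<Sum>s<nS. \<Sum>s'<nS. v s * (E h s ob * T h a s s') * F (Suc h) s' \<tau>')"
    unfolding sum_distrib_right by (rule sum.swap)
  also have "\<dots> = (\<Sum>s<nS. v s * F h s \<tau>)"
  proof (rule sum.cong[OF refl])
    fix s assume s: "s \<in> {..<nS}"
    show "(\<Sum>s'<nS. v s * (E h s ob * T h a s s') * F (Suc h) s' \<tau>') = v s * F h s \<tau>"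
      using sum_T[of h a s] Suc.prems s \<tau> by (auto simp: mult.assoc simp flip: sum_distrib_left)
  qed
  finally show ?case .
qed

lemma sum_bel: "\<tau> \<in> tr n \<Longrightarrow> n < H \<Longrightarrow> (\<Sum>s<nS. bel \<tau> s) = L \<tau>"
  unfolding lik_def by (subst sum_fwd) auto

lemma sum_policy_prob_L:
  assumes \<pi>: "\<pi> \<in> policies nA nO H" and n: "n \<le> H"
  shows "(\<Sum>\<tau>\<in>tr n. policy_prob \<pi> [] \<tau> * L \<tau>) = 1"
proof -
  have "(\<Sum>\<tau>\<in>tr n. policy_prob \<pi> [] \<tau> * L \<tau>) = (\<Sum>\<tau>\<in>tr n. \<Sum>s<nS. mu s * (policy_prob \<pi> [] \<tau> * F (Suc 0) s \<tau>))"
    unfolding lik_def by (simp add: sum_distrib_left mult_ac)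
  also have "\<dots> = (\<Sum>s<nS. mu s * (\<Sum>\<tau>\<in>tr n. policy_prob \<pi> [] \<tau> * F (Suc 0) s \<tau>))"
    by (subst sum.swap) (simp add: sum_distrib_left)
  also have "\<dots> = (\<Sum>s<nS. mu s)"
    using n by (intro sum.cong refl) (simp add: sum_policy_prob_fut[OF \<pi>])
  finally show ?thesis using sum_mu by simp
qed

lemma bel_snoc:
  "bel (\<tau> @ [(ob, a)]) s' = (\<Sum>s<nS. bel \<tau> s * (E (Suc (length \<tau>)) s ob * T (Suc (length \<tau>)) a s s'))"
  by (simp add: fwd_append)

lemma sum_policy_prob_L_future:
  assumes \<pi>: "\<pi> \<in> policies nA nO H" and \<tau>: "\<tau> \<in> tr n" and n: "n < H"
  shows "(\<Sum>\<rho>\<in>tr (H - n). policy_prob \<pi> \<tau> \<rho> * L (\<tau> @ \<rho>)) = L \<tau>"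
proof -
  have "\<rho> \<noteq> []" if "\<rho> \<in> tr (H - n)" for \<rho> using that n by (auto simp: trajectories_def)
  then have "(\<Sum>\<rho>\<in>tr (H - n). policy_prob \<pi> \<tau> \<rho> * L (\<tau> @ \<rho>))
    = (\<Sum>\<rho>\<in>tr (H - n). \<Sum>s<nS. bel \<tau> s * (policy_prob \<pi> \<tau> \<rho> * F (Suc n) s \<rho>))"
    using length_trajectories[OF \<tau>] by (simp add: lik_append sum_distrib_left mult_ac)
  also have "\<dots> = (\<Sum>s<nS. bel \<tau> s * (\<Sum>\<rho>\<in>tr (H - n). policy_prob \<pi> \<tau> \<rho> * F (Suc n) s \<rho>))"
    by (subst sum.swap) (simp add: sum_distrib_left)
  also have "\<dots> = (\<Sum>s<nS. bel \<tau> s)"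
    using n \<tau> by (intro sum.cong refl) (simp add: sum_policy_prob_fut[OF \<pi>])
  finally show ?thesis using sum_bel[OF \<tau> n] by simp
qed

end

section \<open>Comparison of two models\<close>

text \<open>j counts completed steps, so \<open>P j\<close> belongs to step j + 1, and windows of m
  steps starting there fit into the horizon exactly for j \<le> H - m.\<close>

locale hmm_pair = hmm nS nA nO H mu T E + hat: hmm nS nA nO H mu' T' E'
  for nS nA nO H mu T E mu' T' E' +
  fixes m :: nat and B :: real and P :: "nat \<Rightarrow> nat \<Rightarrow> traj \<Rightarrow> real"
  assumes m: "1 \<le> m" "m \<le> H" and B: "B \<ge> 0" and nA: "nA > 0"
    and P_inverse: "\<And>j s v. j \<le> H - m \<Longrightarrow> s < nS \<Longrightarrow>
      (\<Sum>\<rho>\<in>tr m. P j s \<rho> * (\<Sum>s'<nS. hat.F (Suc j) s' \<rho> * v s')) = v s"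
    and P_bound: "\<And>j x. j \<le> H - m \<Longrightarrow>
      (\<Sum>s<nS. \<bar>\<Sum>\<rho>\<in>tr m. P j s \<rho> * x \<rho>\<bar>) \<le> B * (\<Sum>\<rho>\<in>tr m. \<bar>x \<rho>\<bar>)"
begin

section \<open>Hybrid likelihoods and their telescoping sum\<close>

definition lik_diff :: "traj \<Rightarrow> real" where
  "lik_diff \<tau> = L \<tau> - hat.L \<tau>"

text \<open>Translates a state vector of the true model at step \<open>j + 1\<close> into one of the estimated model.\<close>

definition transl :: "nat \<Rightarrow> nat \<Rightarrow> nat \<Rightarrow> real" where
  "transl j s u = (\<Sum>\<rho>\<in>tr m. P j s \<rho> * F (Suc j) u \<rho>)"

definition hybrid :: "nat \<Rightarrow> traj \<Rightarrow> real" where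
  "hybrid j \<tau> = (\<Sum>s<nS. hat.F (Suc j) s (drop j \<tau>) * (\<Sum>u<nS. transl j s u * bel (take j \<tau>) u))"

text \<open>Commutator of translation and time step: row s' of (translation after a true step) minus
  (estimated step after translation), for observation ob and action a.\<close>

definition step_defect :: "nat \<Rightarrow> nat \<times> nat \<times> nat \<Rightarrow> nat \<Rightarrow> real" where
  "step_defect j = (\<lambda>(ob, a, s') s.
     (\<Sum>u<nS. transl (Suc j) s' u * (E (Suc j) s ob * T (Suc j) a s u))
     - (\<Sum>u<nS. E' (Suc j) u ob * T' (Suc j) a u s' * transl j u s))"

text \<open>No full window starts after step H - m + 1, so there the true window likelihoods are
  compared with those predicted from the translated state.\<close>

definition final_defect :: "traj \<Rightarrow> nat \<Rightarrow> real" where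
  "final_defect \<rho> s = F (Suc (H - m)) s \<rho> - (\<Sum>u<nS. hat.F (Suc (H - m)) u \<rho> * transl (H - m) u s)"

abbreviation "triples \<equiv> {..<nO} \<times> {..<nA} \<times> {..<nS}"

lemma tr_m_not_Nil: "\<rho> \<in> tr m \<Longrightarrow> \<rho> \<noteq> []"
  using m by (auto simp: trajectories_def)

text \<open>The true window likelihoods applied to the true belief give \<open>L\<close> of the
  extended trajectory. Writing \<open>L\<close> as \<open>hat.L\<close> plus \<open>lik_diff\<close>
  and using that P inverts the estimated window likelihoods yields the estimated belief and an error
  linear in \<open>lik_diff\<close>. This is why defects are small on beliefs that the data have
  covered.\<close>

lemma transl_bel:
  assumes \<tau>: "\<tau> \<in> tr j" and j: "j \<le> H - m" and s: "s < nS"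
  shows "(\<Sum>u<nS. transl j s u * bel \<tau> u) = hat.bel \<tau> s + (\<Sum>\<rho>\<in>tr m. P j s \<rho> * lik_diff (\<tau> @ \<rho>))"
proof -
  have "(\<Sum>u<nS. transl j s u * bel \<tau> u) = (\<Sum>\<rho>\<in>tr m. P j s \<rho> * (\<Sum>u<nS. F (Suc j) u \<rho> * bel \<tau> u))"
    unfolding transl_def sum_distrib_left sum_distrib_right
    by (subst sum.swap) (simp add: mult.assoc)
  also have "\<dots> = (\<Sum>\<rho>\<in>tr m. P j s \<rho> * (\<Sum>u<nS. hat.F (Suc j) u \<rho> * hat.bel \<tau> u) + P j s \<rho> * lik_diff (\<tau> @ \<rho>))"
  proof (rule sum.cong[OF refl])
    fix \<rho> assume "\<rho> \<in> tr m"
    note ne = tr_m_not_Nil[OF this]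
    have len: "length \<tau> = j" using \<tau> by (simp add: trajectories_def)
    show "P j s \<rho> * (\<Sum>u<nS. F (Suc j) u \<rho> * bel \<tau> u)
      = P j s \<rho> * (\<Sum>u<nS. hat.F (Suc j) u \<rho> * hat.bel \<tau> u) + P j s \<rho> * lik_diff (\<tau> @ \<rho>)"
      unfolding lik_diff_def lik_append[OF ne] len by (simp add: algebra_simps)
  qed
  finally show ?thesis by (simp add: sum.distrib P_inverse[OF j s])
qed

lemma sum_transl_le:
  assumes "j \<le> H - m" "u < nS"
  shows "(\<Sum>s<nS. \<bar>transl j s u\<bar>) \<le> B * real nA ^ m"
proof -
  have "(\<Sum>s<nS. \<bar>transl j s u\<bar>) \<le> B * (\<Sum>\<rho>\<in>tr m. \<bar>F (Suc j) u \<rho>\<bar>)"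
    unfolding transl_def by (rule P_bound[OF assms(1)])
  also have "(\<Sum>\<rho>\<in>tr m. \<bar>F (Suc j) u \<rho>\<bar>) = real nA ^ m"
    using sum_fut[of "Suc j" m u] assms m by simp
  finally show ?thesis .
qed

text \<open>Even the hybrid that uses the estimated model throughout differs from it: its initial
  state vector is the translation of \<open>mu\<close>, not \<open>mu'\<close>.\<close>

lemma hybrid_0:
  "hat.L \<tau> - hybrid 0 \<tau> = - (\<Sum>s<nS. hat.F (Suc 0) s \<tau> * (\<Sum>\<rho>\<in>tr m. P 0 s \<rho> * lik_diff \<rho>))"
proof -
  have "hybrid 0 \<tau> = (\<Sum>s<nS. hat.F (Suc 0) s \<tau> * (mu' s + (\<Sum>\<rho>\<in>tr m. P 0 s \<rho> * lik_diff \<rho>)))"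
    unfolding hybrid_def
  proof (intro sum.cong refl)
    fix s assume "s \<in> {..<nS}"
    then show "hat.F (Suc 0) s (drop 0 \<tau>) * (\<Sum>u<nS. transl 0 s u * bel (take 0 \<tau>) u)
      = hat.F (Suc 0) s \<tau> * (mu' s + (\<Sum>\<rho>\<in>tr m. P 0 s \<rho> * lik_diff \<rho>))"
      using transl_bel[of "[]" 0 s] by simp
  qed
  then show ?thesis
    by (simp add: lik_def algebra_simps sum.distrib)
qed

lemma hybrid_Suc:
  assumes \<tau>: "\<tau>\<^sub>1 \<in> tr j" "\<tau>\<^sub>2 \<noteq> []"
  shows "hybrid (Suc j) (\<tau>\<^sub>1 @ (ob, a) # \<tau>\<^sub>2) - hybrid j (\<tau>\<^sub>1 @ (ob, a) # \<tau>\<^sub>2)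
    = (\<Sum>s'<nS. hat.F (Suc (Suc j)) s' \<tau>\<^sub>2 * (\<Sum>s<nS. step_defect j (ob, a, s') s * bel \<tau>\<^sub>1 s))"
proof -
  have len: "length \<tau>\<^sub>1 = j" using \<tau> by (simp add: trajectories_def)
  let ?b = "bel \<tau>\<^sub>1"
  have 1: "(\<Sum>u<nS. transl (Suc j) s' u * bel (\<tau>\<^sub>1 @ [(ob, a)]) u)
    = (\<Sum>s<nS. (\<Sum>u<nS. transl (Suc j) s' u * (E (Suc j) s ob * T (Suc j) a s u)) * ?b s)" for s'
    unfolding bel_snoc len sum_distrib_left sum_distrib_right
    by (subst sum.swap) (simp add: mult_ac)
  have sw: "(\<Sum>s<nS. E' (Suc j) s ob * T' (Suc j) a s s' * (\<Sum>u<nS. transl j s u * ?b u))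
    = (\<Sum>s<nS. (\<Sum>u<nS. E' (Suc j) u ob * T' (Suc j) a u s' * transl j u s) * ?b s)" for s'
    unfolding sum_distrib_left sum_distrib_right
    by (subst sum.swap) (simp add: mult_ac)
  have 2: "(\<Sum>s<nS. hat.F (Suc j) s ((ob, a) # \<tau>\<^sub>2) * (\<Sum>u<nS. transl j s u * ?b u))
    = (\<Sum>s'<nS. hat.F (Suc (Suc j)) s' \<tau>\<^sub>2 * (\<Sum>s<nS. (\<Sum>u<nS. E' (Suc j) u ob * T' (Suc j) a u s' * transl j u s) * ?b s))"
  proof -
    have "(\<Sum>s<nS. hat.F (Suc j) s ((ob, a) # \<tau>\<^sub>2) * (\<Sum>u<nS. transl j s u * ?b u))
      = (\<Sum>s<nS. \<Sum>s'<nS. hat.F (Suc (Suc j)) s' \<tau>\<^sub>2 * (E' (Suc j) s ob * T' (Suc j) a s s' * (\<Sum>u<nS. transl j s u * ?b u)))"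
      using \<tau>(2) by (simp add: sum_distrib_left sum_distrib_right mult_ac)
    also have "\<dots> = (\<Sum>s'<nS. hat.F (Suc (Suc j)) s' \<tau>\<^sub>2 * (\<Sum>s<nS. E' (Suc j) s ob * T' (Suc j) a s s' * (\<Sum>u<nS. transl j s u * ?b u)))"
      by (subst sum.swap) (simp only: sum_distrib_left)
    also have "\<dots> = (\<Sum>s'<nS. hat.F (Suc (Suc j)) s' \<tau>\<^sub>2 * (\<Sum>s<nS. (\<Sum>u<nS. E' (Suc j) u ob * T' (Suc j) a u s' * transl j u s) * ?b s))"
      unfolding sw ..
    finally show ?thesis .
  qed
  have h1: "hybrid (Suc j) (\<tau>\<^sub>1 @ (ob, a) # \<tau>\<^sub>2)
    = (\<Sum>s'<nS. hat.F (Suc (Suc j)) s' \<tau>\<^sub>2 * (\<Sum>u<nS. transl (Suc j) s' u * bel (\<tau>\<^sub>1 @ [(ob, a)]) u))"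
    unfolding hybrid_def using len by simp
  have h2: "hybrid j (\<tau>\<^sub>1 @ (ob, a) # \<tau>\<^sub>2)
    = (\<Sum>s<nS. hat.F (Suc j) s ((ob, a) # \<tau>\<^sub>2) * (\<Sum>u<nS. transl j s u * ?b u))"
    unfolding hybrid_def using len by (simp del: fut.simps)
  show ?thesis unfolding h1 h2 1 2 step_defect_def
    by (simp add: sum_subtractf algebra_simps)
qed

lemma hybrid_final:
  assumes "\<tau>\<^sub>1 \<in> tr (H - m)" "\<tau>\<^sub>2 \<in> tr m"
  shows "L (\<tau>\<^sub>1 @ \<tau>\<^sub>2) - hybrid (H - m) (\<tau>\<^sub>1 @ \<tau>\<^sub>2) = (\<Sum>s<nS. final_defect \<tau>\<^sub>2 s * bel \<tau>\<^sub>1 s)"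
proof -
  have len: "length \<tau>\<^sub>1 = H - m" using assms by (simp add: trajectories_def)
  have "(\<Sum>s<nS. hat.F (Suc (H - m)) s \<tau>\<^sub>2 * (\<Sum>u<nS. transl (H - m) s u * bel \<tau>\<^sub>1 u))
    = (\<Sum>s<nS. (\<Sum>u<nS. hat.F (Suc (H - m)) u \<tau>\<^sub>2 * transl (H - m) u s) * bel \<tau>\<^sub>1 s)"
    unfolding sum_distrib_left sum_distrib_right by (subst sum.swap) (simp add: mult_ac)
  then show ?thesis
    unfolding hybrid_def final_defect_def using len lik_append[OF tr_m_not_Nil[OF assms(2)]]
    by (simp add: left_diff_distrib sum_subtractf)
qed

lemma telescope:
  "\<bar>L \<tau> - hat.L \<tau>\<bar> \<le> \<bar>hat.L \<tau> - hybrid 0 \<tau>\<bar> + (\<Sum>j<H - m. \<bar>hybrid (Suc j) \<tau> - hybrid j \<tau>\<bar>)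
     + \<bar>L \<tau> - hybrid (H - m) \<tau>\<bar>"
proof -
  have "\<bar>hybrid (H - m) \<tau> - hybrid 0 \<tau>\<bar> \<le> (\<Sum>j<H - m. \<bar>hybrid (Suc j) \<tau> - hybrid j \<tau>\<bar>)"
    unfolding sum_lessThan_telescope[of "\<lambda>j. hybrid j \<tau>", symmetric] by (rule sum_abs)
  then show ?thesis by linarith
qed

definition init_err :: real where
  "init_err = (\<Sum>\<rho>\<in>tr m. \<bar>lik_diff \<rho>\<bar>)"

definition step_err :: "policy \<Rightarrow> nat \<Rightarrow> real" where
  "step_err \<pi> j = (\<Sum>\<tau>\<in>tr j. \<Sum>p\<in>triples. \<bar>\<Sum>s<nS. step_defect j p s * (policy_prob \<pi> [] \<tau> * bel \<tau> s)\<bar>)"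

definition final_err :: "policy \<Rightarrow> real" where
  "final_err \<pi> = (\<Sum>\<tau>\<in>tr (H - m). \<Sum>\<rho>\<in>tr m. \<bar>\<Sum>s<nS. final_defect \<rho> s * (policy_prob \<pi> [] \<tau> * bel \<tau> s)\<bar>)"

text \<open>\<open>step_err\<close> and \<open>final_err\<close> carry the policy weight inside the
  belief, the form that the pigeonhole principle takes; for the estimates it is pulled out
  again.\<close>

lemma weighted_defect:
  "\<bar>\<Sum>s<nS. d s * (policy_prob \<pi> hist \<tau> * b s)\<bar> = policy_prob \<pi> hist \<tau> * \<bar>\<Sum>s<nS. d s * b s\<bar>"
proof -
  have "(\<Sum>s<nS. d s * (policy_prob \<pi> hist \<tau> * b s)) = policy_prob \<pi> hist \<tau> * (\<Sum>s<nS. d s * b s)"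
    by (simp add: sum_distrib_left mult_ac)
  then show ?thesis by (simp add: abs_mult)
qed

lemma init_part:
  assumes \<pi>: "\<pi> \<in> policies nA nO H"
  shows "(\<Sum>\<tau>\<in>tr H. policy_prob \<pi> [] \<tau> * \<bar>hat.L \<tau> - hybrid 0 \<tau>\<bar>) \<le> B * init_err"
proof -
  let ?x = "\<lambda>s. \<bar>\<Sum>\<rho>\<in>tr m. P 0 s \<rho> * lik_diff \<rho>\<bar>"
  have "(\<Sum>\<tau>\<in>tr H. policy_prob \<pi> [] \<tau> * \<bar>hat.L \<tau> - hybrid 0 \<tau>\<bar>)
    \<le> (\<Sum>\<tau>\<in>tr H. policy_prob \<pi> [] \<tau> * (\<Sum>s<nS. hat.F (Suc 0) s \<tau> * ?x s))"
    unfolding hybrid_0 abs_minus_cancel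
    by (intro sum_mono mult_left_mono order_trans[OF sum_abs]) (auto simp: abs_mult)
  also have "\<dots> = (\<Sum>s<nS. (\<Sum>\<tau>\<in>tr H. policy_prob \<pi> [] \<tau> * hat.F (Suc 0) s \<tau>) * ?x s)"
    unfolding sum_distrib_left sum_distrib_right by (subst sum.swap) (simp add: mult_ac)
  also have "\<dots> = (\<Sum>s<nS. ?x s)"
    by (intro sum.cong refl) (simp add: hat.sum_policy_prob_fut[OF \<pi>])
  also have "\<dots> \<le> B * init_err" unfolding init_err_def by (rule P_bound) simp
  finally show ?thesis .
qed

text \<open>From a fixed state s' the continuations under the estimated model and the policy have
  total mass 1, so summing over them leaves only the defect.\<close>

lemma step_part:
  assumes \<pi>: "\<pi> \<in> policies nA nO H" and j: "j < H - m"
  shows "(\<Sum>\<tau>\<in>tr H. policy_prob \<pi> [] \<tau> * \<bar>hybrid (Suc j) \<tau> - hybrid j \<tau>\<bar>) \<le> step_err \<pi> j"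
proof -
  define k where "k = H - j - 1"
  have k: "k > 0" "H = j + Suc k" using j m unfolding k_def by auto
  let ?x = "\<lambda>\<tau>\<^sub>1 ob a s'. \<bar>\<Sum>s<nS. step_defect j (ob, a, s') s * bel \<tau>\<^sub>1 s\<bar>"
  have inner: "(\<Sum>\<tau>\<^sub>2\<in>tr k. policy_prob \<pi> [] (\<tau>\<^sub>1 @ (ob, a) # \<tau>\<^sub>2) *
      \<bar>hybrid (Suc j) (\<tau>\<^sub>1 @ (ob, a) # \<tau>\<^sub>2) - hybrid j (\<tau>\<^sub>1 @ (ob, a) # \<tau>\<^sub>2)\<bar>)
    \<le> policy_prob \<pi> [] \<tau>\<^sub>1 * (\<Sum>s'<nS. ?x \<tau>\<^sub>1 ob a s')"
    if \<tau>: "\<tau>\<^sub>1 \<in> tr j" and oa: "ob < nO" "a < nA" for \<tau>\<^sub>1 ob a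
  proof -
    have hist: "\<tau>\<^sub>1 @ [(ob, a)] \<in> tr (Suc (Suc j) - 1)" using \<tau> oa by (auto simp: trajectories_def)
    have "(\<Sum>\<tau>\<^sub>2\<in>tr k. policy_prob \<pi> [] (\<tau>\<^sub>1 @ (ob, a) # \<tau>\<^sub>2) *
      \<bar>hybrid (Suc j) (\<tau>\<^sub>1 @ (ob, a) # \<tau>\<^sub>2) - hybrid j (\<tau>\<^sub>1 @ (ob, a) # \<tau>\<^sub>2)\<bar>)
      \<le> (\<Sum>\<tau>\<^sub>2\<in>tr k. policy_prob \<pi> [] \<tau>\<^sub>1 * policy_prob \<pi> (\<tau>\<^sub>1 @ [(ob, a)]) \<tau>\<^sub>2 *
        (\<Sum>s'<nS. hat.F (Suc (Suc j)) s' \<tau>\<^sub>2 * ?x \<tau>\<^sub>1 ob a s'))"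
    proof (intro sum_mono mult_mono)
      fix \<tau>\<^sub>2 assume "\<tau>\<^sub>2 \<in> tr k"
      then have ne: "\<tau>\<^sub>2 \<noteq> []" using k by (auto simp: trajectories_def)
      show "\<bar>hybrid (Suc j) (\<tau>\<^sub>1 @ (ob, a) # \<tau>\<^sub>2) - hybrid j (\<tau>\<^sub>1 @ (ob, a) # \<tau>\<^sub>2)\<bar>
        \<le> (\<Sum>s'<nS. hat.F (Suc (Suc j)) s' \<tau>\<^sub>2 * ?x \<tau>\<^sub>1 ob a s')"
        unfolding hybrid_Suc[OF \<tau> ne] by (rule order_trans[OF sum_abs]) (simp add: abs_mult)
      \<comment> \<open>The weight of the action a is given up, so that \<open>step_err\<close> sees
        the policy only during the first j steps, after which the data policy acts
        uniformly.\<close>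
      have "pmf (\<pi> \<tau>\<^sub>1 ob) a * policy_prob \<pi> (\<tau>\<^sub>1 @ [(ob, a)]) \<tau>\<^sub>2 \<le> 1 * policy_prob \<pi> (\<tau>\<^sub>1 @ [(ob, a)]) \<tau>\<^sub>2"
        by (intro mult_right_mono pmf_le_1) simp
      then show "policy_prob \<pi> [] (\<tau>\<^sub>1 @ (ob, a) # \<tau>\<^sub>2) \<le> policy_prob \<pi> [] \<tau>\<^sub>1 * policy_prob \<pi> (\<tau>\<^sub>1 @ [(ob, a)]) \<tau>\<^sub>2"
        unfolding policy_prob_append by (simp add: mult_left_mono)
    qed auto
    also have "\<dots> = policy_prob \<pi> [] \<tau>\<^sub>1 * (\<Sum>s'<nS. (\<Sum>\<tau>\<^sub>2\<in>tr k. policy_prob \<pi> (\<tau>\<^sub>1 @ [(ob, a)]) \<tau>\<^sub>2 * hat.F (Suc (Suc j)) s' \<tau>\<^sub>2) * ?x \<tau>\<^sub>1 ob a s')"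
      unfolding sum_distrib_left sum_distrib_right by (subst sum.swap) (simp add: mult_ac)
    also have "\<dots> = policy_prob \<pi> [] \<tau>\<^sub>1 * (\<Sum>s'<nS. ?x \<tau>\<^sub>1 ob a s')"
      using hat.sum_policy_prob_fut[OF \<pi> hist, of k] k by simp
    finally show ?thesis .
  qed
  have "(\<Sum>\<tau>\<in>tr H. policy_prob \<pi> [] \<tau> * \<bar>hybrid (Suc j) \<tau> - hybrid j \<tau>\<bar>)
    = (\<Sum>\<tau>\<^sub>1\<in>tr j. \<Sum>ob<nO. \<Sum>a<nA. \<Sum>\<tau>\<^sub>2\<in>tr k. policy_prob \<pi> [] (\<tau>\<^sub>1 @ (ob, a) # \<tau>\<^sub>2) *
      \<bar>hybrid (Suc j) (\<tau>\<^sub>1 @ (ob, a) # \<tau>\<^sub>2) - hybrid j (\<tau>\<^sub>1 @ (ob, a) # \<tau>\<^sub>2)\<bar>)"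
    by (subst k(2), subst sum_trajectories_add, subst sum_trajectories_Suc, rule refl)
  also have "\<dots> \<le> (\<Sum>\<tau>\<^sub>1\<in>tr j. \<Sum>ob<nO. \<Sum>a<nA. policy_prob \<pi> [] \<tau>\<^sub>1 * (\<Sum>s'<nS. ?x \<tau>\<^sub>1 ob a s'))"
    by (intro sum_mono inner) auto
  also have "\<dots> = step_err \<pi> j"
    unfolding step_err_def weighted_defect sum.cartesian_product'
    by (simp add: sum_distrib_left)
  finally show ?thesis .
qed

lemma final_part:
  "(\<Sum>\<tau>\<in>tr H. policy_prob \<pi> [] \<tau> * \<bar>L \<tau> - hybrid (H - m) \<tau>\<bar>) \<le> final_err \<pi>"
proof -
  have H: "H = (H - m) + m" using m by simp
  have "(\<Sum>\<tau>\<in>tr H. policy_prob \<pi> [] \<tau> * \<bar>L \<tau> - hybrid (H - m) \<tau>\<bar>)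
    = (\<Sum>\<tau>\<in>tr (H - m). \<Sum>\<rho>\<in>tr m. policy_prob \<pi> [] (\<tau> @ \<rho>) * \<bar>L (\<tau> @ \<rho>) - hybrid (H - m) (\<tau> @ \<rho>)\<bar>)"
    using sum_trajectories_add[of _ nA nO "H - m" m] H by simp
  also have "\<dots> \<le> final_err \<pi>"
    unfolding final_err_def weighted_defect
  proof (intro sum_mono mult_mono)
    fix \<tau> \<rho> assume "\<tau> \<in> tr (H - m)" "\<rho> \<in> tr m"
    then show "\<bar>L (\<tau> @ \<rho>) - hybrid (H - m) (\<tau> @ \<rho>)\<bar> \<le> \<bar>\<Sum>s<nS. final_defect \<rho> s * bel \<tau> s\<bar>"
      by (simp add: hybrid_final)
    show "policy_prob \<pi> [] (\<tau> @ \<rho>) \<le> policy_prob \<pi> [] \<tau>"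
      unfolding policy_prob_append using policy_prob_le_1 by (simp add: mult_left_le)
  qed auto
  finally show ?thesis .
qed

lemma total_variation_decomposition:
  assumes \<pi>: "\<pi> \<in> policies nA nO H"
  shows "(\<Sum>\<tau>\<in>tr H. policy_prob \<pi> [] \<tau> * \<bar>lik_diff \<tau>\<bar>)
    \<le> B * init_err + (\<Sum>j<H - m. step_err \<pi> j) + final_err \<pi>"
proof -
  have "(\<Sum>\<tau>\<in>tr H. policy_prob \<pi> [] \<tau> * \<bar>lik_diff \<tau>\<bar>)
    \<le> (\<Sum>\<tau>\<in>tr H. policy_prob \<pi> [] \<tau> * (\<bar>hat.L \<tau> - hybrid 0 \<tau>\<bar>
        + (\<Sum>j<H - m. \<bar>hybrid (Suc j) \<tau> - hybrid j \<tau>\<bar>) + \<bar>L \<tau> - hybrid (H - m) \<tau>\<bar>))"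
    unfolding lik_diff_def by (intro sum_mono mult_left_mono telescope) auto
  also have "\<dots> = (\<Sum>\<tau>\<in>tr H. policy_prob \<pi> [] \<tau> * \<bar>hat.L \<tau> - hybrid 0 \<tau>\<bar>)
    + (\<Sum>j<H - m. \<Sum>\<tau>\<in>tr H. policy_prob \<pi> [] \<tau> * \<bar>hybrid (Suc j) \<tau> - hybrid j \<tau>\<bar>)
    + (\<Sum>\<tau>\<in>tr H. policy_prob \<pi> [] \<tau> * \<bar>L \<tau> - hybrid (H - m) \<tau>\<bar>)"
    by (subst sum.swap) (simp add: distrib_left sum.distrib sum_distrib_left)
  also have "\<dots> \<le> B * init_err + (\<Sum>j<H - m. step_err \<pi> j) + final_err \<pi>"
    using \<pi> by (intro add_mono sum_mono init_part step_part final_part) auto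
  finally show ?thesis .
qed

section \<open>Errors in terms of likelihood differences on windows\<close>

text \<open>Weighted by the policy for j steps only. The other n - j actions have weight 1, which is
  uniform exploration up to the factor nA^(n - j).\<close>

definition prefix_err :: "policy \<Rightarrow> nat \<Rightarrow> nat \<Rightarrow> real" where
  "prefix_err \<pi> j n = (\<Sum>\<tau>\<in>tr n. policy_prob \<pi> [] (take j \<tau>) * \<bar>lik_diff \<tau>\<bar>)"

lemma prefix_err_add:
  "prefix_err \<pi> j (j + n) = (\<Sum>\<tau>\<in>tr j. policy_prob \<pi> [] \<tau> * (\<Sum>\<rho>\<in>tr n. \<bar>lik_diff (\<tau> @ \<rho>)\<bar>))"
  unfolding prefix_err_def sum_trajectories_add
  by (auto simp: sum_distrib_left length_trajectories intro!: sum.cong)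

lemma init_err_eq: "init_err = prefix_err \<pi> 0 m"
  unfolding init_err_def prefix_err_def by simp

text \<open>\<open>transl_bel\<close> after j + 1 and after j steps turns the defect into window
  differences. Windows of length m + 1 come from the translation after the step, those of length m
  from the translation before it, with a factor nA since all actions are summed.\<close>

lemma step_err_le:
  assumes j: "j < H - m"
  shows "step_err \<pi> j \<le> B * prefix_err \<pi> j (j + Suc m) + real nA * B * prefix_err \<pi> j (j + m)"
proof -
  have "(\<Sum>p\<in>triples. \<bar>\<Sum>s<nS. step_defect j p s * bel \<tau> s\<bar>)
    \<le> B * (\<Sum>\<rho>\<in>tr (Suc m). \<bar>lik_diff (\<tau> @ \<rho>)\<bar>) + real nA * B * (\<Sum>\<rho>\<in>tr m. \<bar>lik_diff (\<tau> @ \<rho>)\<bar>)"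
    if \<tau>: "\<tau> \<in> tr j" for \<tau>
  proof -
    have len: "length \<tau> = j" using \<tau> by (simp add: trajectories_def)
    let ?x = "\<lambda>s. \<Sum>\<rho>\<in>tr m. P j s \<rho> * lik_diff (\<tau> @ \<rho>)"
    let ?y = "\<lambda>ob a s'. \<Sum>\<rho>\<in>tr m. P (Suc j) s' \<rho> * lik_diff (\<tau> @ (ob, a) # \<rho>)"
    have eq: "(\<Sum>s<nS. step_defect j (ob, a, s') s * bel \<tau> s)
      = ?y ob a s' - (\<Sum>u<nS. E' (Suc j) u ob * T' (Suc j) a u s' * ?x u)"
      if oa: "ob < nO" "a < nA" "s' < nS" for ob a s'
    proof -
      have \<tau>': "\<tau> @ [(ob, a)] \<in> tr (Suc j)" using \<tau> oa by (auto simp: trajectories_def)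
      have "(\<Sum>s<nS. step_defect j (ob, a, s') s * bel \<tau> s)
        = (\<Sum>u<nS. transl (Suc j) s' u * bel (\<tau> @ [(ob, a)]) u)
          - (\<Sum>u<nS. E' (Suc j) u ob * T' (Suc j) a u s' * (\<Sum>s<nS. transl j u s * bel \<tau> s))"
      proof -
        have "(\<Sum>u<nS. transl (Suc j) s' u * bel (\<tau> @ [(ob, a)]) u)
          = (\<Sum>s<nS. (\<Sum>u<nS. transl (Suc j) s' u * (E (Suc j) s ob * T (Suc j) a s u)) * bel \<tau> s)"
          unfolding bel_snoc len sum_distrib_left sum_distrib_right
          by (subst sum.swap) (simp add: mult_ac)
        moreover have "(\<Sum>u<nS. E' (Suc j) u ob * T' (Suc j) a u s' * (\<Sum>s<nS. transl j u s * bel \<tau> s))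
          = (\<Sum>s<nS. (\<Sum>u<nS. E' (Suc j) u ob * T' (Suc j) a u s' * transl j u s) * bel \<tau> s)"
          unfolding sum_distrib_left sum_distrib_right
          by (subst sum.swap) (simp add: mult_ac)
        ultimately show ?thesis by (simp add: step_defect_def left_diff_distrib sum_subtractf)
      qed
      also have "(\<Sum>u<nS. transl (Suc j) s' u * bel (\<tau> @ [(ob, a)]) u) = hat.bel (\<tau> @ [(ob, a)]) s' + ?y ob a s'"
        using transl_bel[OF \<tau>'] j oa by simp
      also have "(\<Sum>u<nS. E' (Suc j) u ob * T' (Suc j) a u s' * (\<Sum>s<nS. transl j u s * bel \<tau> s))
        = (\<Sum>u<nS. E' (Suc j) u ob * T' (Suc j) a u s' * (hat.bel \<tau> u + ?x u))"
        using j by (intro sum.cong refl arg_cong2[of _ _ _ _ "(*)"] transl_bel \<tau>) auto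
      \<comment> \<open>The estimated belief obeys the estimated step, so it cancels between the two
        parts of the defect.\<close>
      also have "\<dots> = hat.bel (\<tau> @ [(ob, a)]) s' + (\<Sum>u<nS. E' (Suc j) u ob * T' (Suc j) a u s' * ?x u)"
        unfolding hat.bel_snoc len distrib_left sum.distrib by (simp add: mult_ac)
      finally show ?thesis by simp
    qed
    have "(\<Sum>p\<in>triples. \<bar>\<Sum>s<nS. step_defect j p s * bel \<tau> s\<bar>)
      = (\<Sum>ob<nO. \<Sum>a<nA. \<Sum>s'<nS. \<bar>?y ob a s' - (\<Sum>u<nS. E' (Suc j) u ob * T' (Suc j) a u s' * ?x u)\<bar>)"
      unfolding sum.cartesian_product' by (intro sum.cong refl) (simp add: eq)
    also have "\<dots> \<le> (\<Sum>ob<nO. \<Sum>a<nA. \<Sum>s'<nS. \<bar>?y ob a s'\<bar> + (\<Sum>u<nS. E' (Suc j) u ob * T' (Suc j) a u s' * \<bar>?x u\<bar>))"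
      by (intro sum_mono order_trans[OF abs_triangle_ineq4] add_left_mono order_trans[OF sum_abs])
        (auto simp: abs_mult hat.E_nonneg hat.T_nonneg)
    also have "\<dots> = (\<Sum>ob<nO. \<Sum>a<nA. \<Sum>s'<nS. \<bar>?y ob a s'\<bar>)
      + (\<Sum>ob<nO. \<Sum>a<nA. \<Sum>s'<nS. \<Sum>u<nS. E' (Suc j) u ob * T' (Suc j) a u s' * \<bar>?x u\<bar>)"
      by (simp add: sum.distrib)
    also have "(\<Sum>ob<nO. \<Sum>a<nA. \<Sum>s'<nS. \<Sum>u<nS. E' (Suc j) u ob * T' (Suc j) a u s' * \<bar>?x u\<bar>)
      = (\<Sum>ob<nO. \<Sum>a<nA. \<Sum>u<nS. \<Sum>s'<nS. T' (Suc j) a u s' * (E' (Suc j) u ob * \<bar>?x u\<bar>))"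
    proof (rule sum.cong[OF refl], rule sum.cong[OF refl])
      fix ob a
      show "(\<Sum>s'<nS. \<Sum>u<nS. E' (Suc j) u ob * T' (Suc j) a u s' * \<bar>?x u\<bar>)
        = (\<Sum>u<nS. \<Sum>s'<nS. T' (Suc j) a u s' * (E' (Suc j) u ob * \<bar>?x u\<bar>))"
        by (subst sum.swap) (simp add: mult_ac)
    qed
    also have "\<dots> = (\<Sum>ob<nO. \<Sum>a<nA. \<Sum>u<nS. E' (Suc j) u ob * \<bar>?x u\<bar>)"
      using j m by (intro sum.cong refl) (simp add: hat.sum_T flip: sum_distrib_right)
    also have "\<dots> = real nA * (\<Sum>ob<nO. \<Sum>u<nS. E' (Suc j) u ob * \<bar>?x u\<bar>)"
      by (simp add: sum_distrib_left)
    also have "(\<Sum>ob<nO. \<Sum>u<nS. E' (Suc j) u ob * \<bar>?x u\<bar>) = (\<Sum>u<nS. \<bar>?x u\<bar>)"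
      using j by (subst sum.swap, intro sum.cong refl) (simp add: hat.sum_E flip: sum_distrib_right)
    also have "(\<Sum>ob<nO. \<Sum>a<nA. \<Sum>s'<nS. \<bar>?y ob a s'\<bar>)
      \<le> (\<Sum>ob<nO. \<Sum>a<nA. B * (\<Sum>\<rho>\<in>tr m. \<bar>lik_diff (\<tau> @ (ob, a) # \<rho>)\<bar>))"
      using j by (intro sum_mono P_bound) auto
    also have "\<dots> = B * (\<Sum>\<rho>\<in>tr (Suc m). \<bar>lik_diff (\<tau> @ \<rho>)\<bar>)"
      unfolding sum_trajectories_Suc by (simp add: sum_distrib_left)
    finally have "(\<Sum>p\<in>triples. \<bar>\<Sum>s<nS. step_defect j p s * bel \<tau> s\<bar>)
      \<le> B * (\<Sum>\<rho>\<in>tr (Suc m). \<bar>lik_diff (\<tau> @ \<rho>)\<bar>) + real nA * (\<Sum>u<nS. \<bar>?x u\<bar>)" by simp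
    also have "\<dots> \<le> B * (\<Sum>\<rho>\<in>tr (Suc m). \<bar>lik_diff (\<tau> @ \<rho>)\<bar>) + real nA * (B * (\<Sum>\<rho>\<in>tr m. \<bar>lik_diff (\<tau> @ \<rho>)\<bar>))"
      using j by (intro add_left_mono mult_left_mono P_bound) auto
    finally show ?thesis by (simp add: mult.assoc)
  qed
  then have "step_err \<pi> j \<le> (\<Sum>\<tau>\<in>tr j. policy_prob \<pi> [] \<tau> * (B * (\<Sum>\<rho>\<in>tr (Suc m). \<bar>lik_diff (\<tau> @ \<rho>)\<bar>)
      + real nA * B * (\<Sum>\<rho>\<in>tr m. \<bar>lik_diff (\<tau> @ \<rho>)\<bar>)))"
    unfolding step_err_def weighted_defect sum_distrib_left[of _ _ triples, symmetric]
    by (intro sum_mono mult_left_mono) auto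
  also have "\<dots> = B * prefix_err \<pi> j (j + Suc m) + real nA * B * prefix_err \<pi> j (j + m)"
    unfolding prefix_err_add by (simp add: sum_distrib_left sum.distrib distrib_left mult_ac)
  finally show ?thesis .
qed

text \<open>The same cancellation at step H - m + 1. The factor nA^m is the mass of all windows from
  a fixed state in the estimated model.\<close>

lemma final_err_le:
  "final_err \<pi> \<le> (1 + real nA ^ m * B) * prefix_err \<pi> (H - m) H"
proof -
  let ?n = "H - m"
  have "(\<Sum>\<rho>\<in>tr m. \<bar>\<Sum>s<nS. final_defect \<rho> s * bel \<tau> s\<bar>)
    \<le> (1 + real nA ^ m * B) * (\<Sum>\<rho>\<in>tr m. \<bar>lik_diff (\<tau> @ \<rho>)\<bar>)" if \<tau>: "\<tau> \<in> tr ?n" for \<tau>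
  proof -
    have len: "length \<tau> = ?n" using \<tau> by (simp add: trajectories_def)
    let ?x = "\<lambda>s. \<Sum>\<rho>\<in>tr m. P ?n s \<rho> * lik_diff (\<tau> @ \<rho>)"
    have eq: "(\<Sum>s<nS. final_defect \<rho> s * bel \<tau> s) = lik_diff (\<tau> @ \<rho>) - (\<Sum>u<nS. hat.F (Suc ?n) u \<rho> * ?x u)"
      if \<rho>: "\<rho> \<in> tr m" for \<rho>
    proof -
      have "(\<Sum>s<nS. final_defect \<rho> s * bel \<tau> s) = L (\<tau> @ \<rho>) - hybrid ?n (\<tau> @ \<rho>)"
        using hybrid_final[OF \<tau> \<rho>] by simp
      also have "hybrid ?n (\<tau> @ \<rho>) = (\<Sum>s<nS. hat.F (Suc ?n) s \<rho> * (hat.bel \<tau> s + ?x s))"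
        unfolding hybrid_def using len by (simp add: transl_bel[OF \<tau>])
      also have "\<dots> = hat.L (\<tau> @ \<rho>) + (\<Sum>u<nS. hat.F (Suc ?n) u \<rho> * ?x u)"
        using lik_append[OF tr_m_not_Nil[OF \<rho>]] len by (simp add: distrib_left sum.distrib)
      finally show ?thesis unfolding lik_diff_def by simp
    qed
    have "(\<Sum>\<rho>\<in>tr m. \<bar>\<Sum>s<nS. final_defect \<rho> s * bel \<tau> s\<bar>)
      \<le> (\<Sum>\<rho>\<in>tr m. \<bar>lik_diff (\<tau> @ \<rho>)\<bar> + (\<Sum>u<nS. hat.F (Suc ?n) u \<rho> * \<bar>?x u\<bar>))"
    proof (rule sum_mono)
      fix \<rho> assume \<rho>: "\<rho> \<in> tr m"
      have "\<bar>\<Sum>u<nS. hat.F (Suc ?n) u \<rho> * ?x u\<bar> \<le> (\<Sum>u<nS. hat.F (Suc ?n) u \<rho> * \<bar>?x u\<bar>)"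
        by (rule order_trans[OF sum_abs]) (simp add: abs_mult)
      then show "\<bar>\<Sum>s<nS. final_defect \<rho> s * bel \<tau> s\<bar> \<le> \<bar>lik_diff (\<tau> @ \<rho>)\<bar> + (\<Sum>u<nS. hat.F (Suc ?n) u \<rho> * \<bar>?x u\<bar>)"
        unfolding eq[OF \<rho>] by linarith
    qed
    also have "\<dots> = (\<Sum>\<rho>\<in>tr m. \<bar>lik_diff (\<tau> @ \<rho>)\<bar>) + (\<Sum>u<nS. (\<Sum>\<rho>\<in>tr m. hat.F (Suc ?n) u \<rho>) * \<bar>?x u\<bar>)"
      unfolding sum.distrib sum_distrib_right by (subst (2) sum.swap) (rule refl)
    also have "(\<Sum>u<nS. (\<Sum>\<rho>\<in>tr m. hat.F (Suc ?n) u \<rho>) * \<bar>?x u\<bar>) = real nA ^ m * (\<Sum>u<nS. \<bar>?x u\<bar>)"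
      using hat.sum_fut[of "Suc ?n" m] m by (simp add: sum_distrib_left)
    also have "(\<Sum>\<rho>\<in>tr m. \<bar>lik_diff (\<tau> @ \<rho>)\<bar>) + real nA ^ m * (\<Sum>u<nS. \<bar>?x u\<bar>)
      \<le> (\<Sum>\<rho>\<in>tr m. \<bar>lik_diff (\<tau> @ \<rho>)\<bar>) + real nA ^ m * (B * (\<Sum>\<rho>\<in>tr m. \<bar>lik_diff (\<tau> @ \<rho>)\<bar>))"
      by (intro add_left_mono mult_left_mono P_bound) auto
    finally show ?thesis by (simp add: algebra_simps)
  qed
  then have "final_err \<pi> \<le> (\<Sum>\<tau>\<in>tr ?n. policy_prob \<pi> [] \<tau> * ((1 + real nA ^ m * B) * (\<Sum>\<rho>\<in>tr m. \<bar>lik_diff (\<tau> @ \<rho>)\<bar>)))"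
    unfolding final_err_def weighted_defect sum_distrib_left[of _ _ "tr m", symmetric]
    by (intro sum_mono mult_left_mono) auto
  also have "\<dots> = (1 + real nA ^ m * B) * prefix_err \<pi> ?n (?n + m)"
    unfolding prefix_err_add by (simp add: sum_distrib_left mult_ac)
  finally show ?thesis using m by simp
qed

section \<open>Transfer to the data policies\<close>

text \<open>Truncated subtraction also covers histories of length i \<ge> j, after which all n
  actions are uniform.\<close>

lemma policy_prob_uniform_after:
  assumes "\<tau> \<in> tr n" "length hist = i"
  shows "policy_prob (uniform_after nA j \<pi>) hist \<tau>
    = policy_prob \<pi> hist (take (j - i) \<tau>) * (1 / real nA) ^ (n - (j - i))"
  using assms
proof (induction n arbitrary: \<tau> hist i)
  case 0
  then show ?case by simp
next
  case (Suc n)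
  obtain ob a \<tau>' where \<tau>: "\<tau> = (ob, a) # \<tau>'" "\<tau>' \<in> tr n" "ob < nO" "a < nA"
    using Suc.prems(1) unfolding trajectories_def length_Suc_conv by auto
  have IH: "policy_prob (uniform_after nA j \<pi>) (hist @ [(ob, a)]) \<tau>'
    = policy_prob \<pi> (hist @ [(ob, a)]) (take (j - Suc i) \<tau>') * (1 / real nA) ^ (n - (j - Suc i))"
    using Suc.prems by (intro Suc.IH \<tau>) auto
  show ?case
  proof (cases "i < j")
    case True
    then have "j - i = Suc (j - Suc i)" by simp
    then show ?thesis using Suc.prems IH True by (simp add: \<tau> uniform_after_def)
  next
    case False
    have "pmf (pmf_of_set {..<nA}) a = 1 / real nA"
      using nA \<tau> by (subst pmf_of_set) (auto simp: lessThan_empty_iff)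
    then show ?thesis using Suc.prems IH False by (simp add: \<tau> uniform_after_def)
  qed
qed

text \<open>Marginalisation does not increase total variation: the likelihood of a prefix is the
  policy-weighted sum over its continuations.\<close>

lemma lik_diff_marginal:
  assumes \<pi>: "\<pi> \<in> policies nA nO H" and n: "n \<le> H"
  shows "(\<Sum>\<tau>\<in>tr n. policy_prob \<pi> [] \<tau> * \<bar>lik_diff \<tau>\<bar>) \<le> (\<Sum>\<tau>\<in>tr H. policy_prob \<pi> [] \<tau> * \<bar>lik_diff \<tau>\<bar>)"
proof (cases "n = H")
  case False
  then have n: "n < H" using n by simp
  have "(\<Sum>\<tau>\<in>tr n. policy_prob \<pi> [] \<tau> * \<bar>lik_diff \<tau>\<bar>)
    \<le> (\<Sum>\<tau>\<in>tr n. policy_prob \<pi> [] \<tau> * (\<Sum>\<rho>\<in>tr (H - n). policy_prob \<pi> \<tau> \<rho> * \<bar>lik_diff (\<tau> @ \<rho>)\<bar>))"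
  proof (intro sum_mono mult_left_mono)
    fix \<tau> assume \<tau>: "\<tau> \<in> tr n"
    have "lik_diff \<tau> = (\<Sum>\<rho>\<in>tr (H - n). policy_prob \<pi> \<tau> \<rho> * lik_diff (\<tau> @ \<rho>))"
      using sum_policy_prob_L_future[OF \<pi> \<tau> n] hat.sum_policy_prob_L_future[OF \<pi> \<tau> n]
      unfolding lik_diff_def by (simp add: right_diff_distrib sum_subtractf)
    then show "\<bar>lik_diff \<tau>\<bar> \<le> (\<Sum>\<rho>\<in>tr (H - n). policy_prob \<pi> \<tau> \<rho> * \<bar>lik_diff (\<tau> @ \<rho>)\<bar>)"
      using sum_abs[of "\<lambda>\<rho>. policy_prob \<pi> \<tau> \<rho> * lik_diff (\<tau> @ \<rho>)" "tr (H - n)"] by (simp add: abs_mult)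
  qed auto
  also have "\<dots> = (\<Sum>\<tau>\<in>tr (n + (H - n)). policy_prob \<pi> [] \<tau> * \<bar>lik_diff \<tau>\<bar>)"
    unfolding sum_trajectories_add by (simp add: policy_prob_append sum_distrib_left mult.assoc)
  finally show ?thesis using n by simp
qed simp

text \<open>nA^(n - j) is the reciprocal of the probability that uniform exploration picks n - j
  prescribed actions; extending to full trajectories can only enlarge the distance.\<close>

lemma prefix_err_le:
  assumes \<pi>: "\<pi> \<in> policies nA nO H" and jn: "j \<le> n" "n \<le> H"
  shows "prefix_err \<pi> j n \<le> real nA ^ (n - j) *
    (\<Sum>\<tau>\<in>tr H. policy_prob (uniform_after nA j \<pi>) [] \<tau> * \<bar>lik_diff \<tau>\<bar>)"
proof -
  have "prefix_err \<pi> j n = (\<Sum>\<tau>\<in>tr n. real nA ^ (n - j) * (policy_prob (uniform_after nA j \<pi>) [] \<tau> * \<bar>lik_diff \<tau>\<bar>))"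
    unfolding prefix_err_def
  proof (rule sum.cong[OF refl])
    fix \<tau> assume "\<tau> \<in> tr n"
    then have "policy_prob (uniform_after nA j \<pi>) [] \<tau> = policy_prob \<pi> [] (take j \<tau>) * (1 / real nA) ^ (n - j)"
      using policy_prob_uniform_after[of \<tau> n "[]" 0 j \<pi>] by simp
    then have "real nA ^ (n - j) * policy_prob (uniform_after nA j \<pi>) [] \<tau> = policy_prob \<pi> [] (take j \<tau>)"
      using nA by (simp add: power_divide)
    then show "policy_prob \<pi> [] (take j \<tau>) * \<bar>lik_diff \<tau>\<bar>
      = real nA ^ (n - j) * (policy_prob (uniform_after nA j \<pi>) [] \<tau> * \<bar>lik_diff \<tau>\<bar>)"
      by (simp flip: mult.assoc)
  qed
  also have "\<dots> = real nA ^ (n - j) * (\<Sum>\<tau>\<in>tr n. policy_prob (uniform_after nA j \<pi>) [] \<tau> * \<bar>lik_diff \<tau>\<bar>)"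
    by (simp add: sum_distrib_left)
  also have "\<dots> \<le> real nA ^ (n - j) * (\<Sum>\<tau>\<in>tr H. policy_prob (uniform_after nA j \<pi>) [] \<tau> * \<bar>lik_diff \<tau>\<bar>)"
    using jn by (intro mult_left_mono lik_diff_marginal uniform_after_policies[OF \<pi> nA]) auto
  finally show ?thesis .
qed

section \<open>Sizes of the defects and the resulting data bounds\<close>

text \<open>Provides the constant F of the pigeonhole principle. Columns of the translation sum to
  at most B nA^m and all kernels are stochastic; nS nA counts the states and actions over which the
  sum runs freely.\<close>

lemma step_defect_le:
  assumes j: "j < H - m"
  shows "(\<Sum>p\<in>triples. \<Sum>s<nS. \<bar>step_defect j p s\<bar>) \<le> 2 * real nS * real nA * B * real nA ^ m"
proof -
  let ?c = "B * real nA ^ m"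
  have "(\<Sum>p\<in>triples. \<Sum>s<nS. \<bar>step_defect j p s\<bar>)
    \<le> (\<Sum>(ob, a, s')\<in>triples. \<Sum>s<nS. (\<Sum>u<nS. \<bar>transl (Suc j) s' u\<bar> * (E (Suc j) s ob * T (Suc j) a s u))
      + (\<Sum>u<nS. E' (Suc j) u ob * T' (Suc j) a u s' * \<bar>transl j u s\<bar>))"
  proof (intro sum_mono, clarsimp, intro sum_mono)
    fix ob a s' s
    show "\<bar>step_defect j (ob, a, s') s\<bar> \<le> (\<Sum>u<nS. \<bar>transl (Suc j) s' u\<bar> * (E (Suc j) s ob * T (Suc j) a s u))
      + (\<Sum>u<nS. E' (Suc j) u ob * T' (Suc j) a u s' * \<bar>transl j u s\<bar>)"
      unfolding step_defect_def prod.case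
      by (intro order_trans[OF abs_triangle_ineq4] add_mono order_trans[OF sum_abs] sum_mono)
        (auto simp: abs_mult T_nonneg E_nonneg hat.T_nonneg hat.E_nonneg)
  qed
  also have "\<dots> = (\<Sum>(ob, a, s')\<in>triples. \<Sum>s<nS. \<Sum>u<nS. \<bar>transl (Suc j) s' u\<bar> * (E (Suc j) s ob * T (Suc j) a s u))
    + (\<Sum>(ob, a, s')\<in>triples. \<Sum>s<nS. \<Sum>u<nS. E' (Suc j) u ob * T' (Suc j) a u s' * \<bar>transl j u s\<bar>)"
    by (simp add: sum.distrib case_prod_unfold)
  also have "(\<Sum>(ob, a, s')\<in>triples. \<Sum>s<nS. \<Sum>u<nS. \<bar>transl (Suc j) s' u\<bar> * (E (Suc j) s ob * T (Suc j) a s u))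
    \<le> real nS * real nA * ?c"
  proof -
    have "(\<Sum>(ob, a, s')\<in>triples. \<Sum>s<nS. \<Sum>u<nS. \<bar>transl (Suc j) s' u\<bar> * (E (Suc j) s ob * T (Suc j) a s u))
      = (\<Sum>ob<nO. \<Sum>a<nA. \<Sum>s<nS. \<Sum>s'<nS. \<Sum>u<nS. \<bar>transl (Suc j) s' u\<bar> * (E (Suc j) s ob * T (Suc j) a s u))"
      unfolding sum.cartesian_product' prod.case by (intro sum.cong refl sum.swap)
    also have "\<dots> = (\<Sum>ob<nO. \<Sum>a<nA. \<Sum>s<nS. \<Sum>u<nS. (\<Sum>s'<nS. \<bar>transl (Suc j) s' u\<bar>) * (E (Suc j) s ob * T (Suc j) a s u))"
      unfolding sum_distrib_right by (intro sum.cong refl sum.swap)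
    also have "\<dots> \<le> (\<Sum>ob<nO. \<Sum>a<nA. \<Sum>s<nS. \<Sum>u<nS. ?c * (E (Suc j) s ob * T (Suc j) a s u))"
      using j by (intro sum_mono mult_right_mono sum_transl_le mult_nonneg_nonneg E_nonneg T_nonneg) auto
    also have "\<dots> = (\<Sum>ob<nO. \<Sum>a<nA. \<Sum>s<nS. ?c * E (Suc j) s ob)"
    proof (intro sum.cong refl)
      fix ob a s assume "a \<in> {..<nA}" "s \<in> {..<nS}"
      then have "(\<Sum>u<nS. T (Suc j) a s u) = 1" using j m by (intro sum_T) auto
      then show "(\<Sum>u<nS. ?c * (E (Suc j) s ob * T (Suc j) a s u)) = ?c * E (Suc j) s ob"
        by (simp flip: sum_distrib_left)
    qed
    also have "\<dots> = real nA * (\<Sum>s<nS. ?c * (\<Sum>ob<nO. E (Suc j) s ob))"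
    proof -
      have "(\<Sum>ob<nO. \<Sum>a<nA. \<Sum>s<nS. ?c * E (Suc j) s ob) = real nA * (\<Sum>ob<nO. \<Sum>s<nS. ?c * E (Suc j) s ob)"
        by (simp add: sum_distrib_left)
      also have "(\<Sum>ob<nO. \<Sum>s<nS. ?c * E (Suc j) s ob) = (\<Sum>s<nS. \<Sum>ob<nO. ?c * E (Suc j) s ob)"
        by (rule sum.swap)
      finally show ?thesis by (simp only: sum_distrib_left)
    qed
    also have "\<dots> = real nS * real nA * ?c" using j by (simp add: sum_E)
    finally show ?thesis .
  qed
  also have "(\<Sum>(ob, a, s')\<in>triples. \<Sum>s<nS. \<Sum>u<nS. E' (Suc j) u ob * T' (Suc j) a u s' * \<bar>transl j u s\<bar>)
    \<le> real nS * real nA * ?c"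
  proof -
    have "(\<Sum>(ob, a, s')\<in>triples. \<Sum>s<nS. \<Sum>u<nS. E' (Suc j) u ob * T' (Suc j) a u s' * \<bar>transl j u s\<bar>)
      = (\<Sum>ob<nO. \<Sum>a<nA. \<Sum>s<nS. \<Sum>s'<nS. \<Sum>u<nS. E' (Suc j) u ob * T' (Suc j) a u s' * \<bar>transl j u s\<bar>)"
      unfolding sum.cartesian_product' prod.case by (intro sum.cong refl sum.swap)
    also have "\<dots> = (\<Sum>ob<nO. \<Sum>a<nA. \<Sum>s<nS. \<Sum>u<nS. E' (Suc j) u ob * \<bar>transl j u s\<bar> * (\<Sum>s'<nS. T' (Suc j) a u s'))"
    proof (rule sum.cong[OF refl], rule sum.cong[OF refl], rule sum.cong[OF refl])
      fix ob a s
      show "(\<Sum>s'<nS. \<Sum>u<nS. E' (Suc j) u ob * T' (Suc j) a u s' * \<bar>transl j u s\<bar>)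
        = (\<Sum>u<nS. E' (Suc j) u ob * \<bar>transl j u s\<bar> * (\<Sum>s'<nS. T' (Suc j) a u s'))"
        unfolding sum_distrib_left by (subst sum.swap) (simp add: mult_ac)
    qed
    also have "\<dots> = (\<Sum>ob<nO. \<Sum>a<nA. \<Sum>s<nS. \<Sum>u<nS. E' (Suc j) u ob * \<bar>transl j u s\<bar>)"
      using j m by (intro sum.cong refl) (simp add: hat.sum_T)
    also have "\<dots> = real nA * (\<Sum>s<nS. \<Sum>u<nS. \<Sum>ob<nO. E' (Suc j) u ob * \<bar>transl j u s\<bar>)"
    proof -
      have "(\<Sum>ob<nO. \<Sum>s<nS. \<Sum>u<nS. E' (Suc j) u ob * \<bar>transl j u s\<bar>)
        = (\<Sum>s<nS. \<Sum>ob<nO. \<Sum>u<nS. E' (Suc j) u ob * \<bar>transl j u s\<bar>)" by (rule sum.swap)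
      also have "\<dots> = (\<Sum>s<nS. \<Sum>u<nS. \<Sum>ob<nO. E' (Suc j) u ob * \<bar>transl j u s\<bar>)"
        by (intro sum.cong refl sum.swap)
      finally show ?thesis by (simp flip: sum_distrib_left)
    qed
    also have "\<dots> = real nA * (\<Sum>s<nS. \<Sum>u<nS. \<bar>transl j u s\<bar>)"
      using j by (intro arg_cong2[of _ _ _ _ "(*)"] sum.cong refl) (simp add: hat.sum_E flip: sum_distrib_right)
    also have "\<dots> \<le> real nA * (\<Sum>s<nS. ?c)"
      using j by (intro mult_left_mono sum_mono sum_transl_le) auto
    finally show ?thesis by (simp add: mult_ac)
  qed
  finally show ?thesis by (simp add: mult_ac)
qed

lemma final_defect_le:
  "(\<Sum>\<rho>\<in>tr m. \<Sum>s<nS. \<bar>final_defect \<rho> s\<bar>) \<le> real nS * real nA ^ m * (1 + B * real nA ^ m)"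
proof -
  let ?n = "H - m"
  have "(\<Sum>\<rho>\<in>tr m. \<Sum>s<nS. \<bar>final_defect \<rho> s\<bar>)
    \<le> (\<Sum>\<rho>\<in>tr m. \<Sum>s<nS. F (Suc ?n) s \<rho> + (\<Sum>u<nS. hat.F (Suc ?n) u \<rho> * \<bar>transl ?n u s\<bar>))"
    unfolding final_defect_def
    by (intro sum_mono order_trans[OF abs_triangle_ineq4] add_mono order_trans[OF sum_abs])
      (auto simp: abs_mult)
  also have "\<dots> = (\<Sum>s<nS. \<Sum>\<rho>\<in>tr m. F (Suc ?n) s \<rho> + (\<Sum>u<nS. hat.F (Suc ?n) u \<rho> * \<bar>transl ?n u s\<bar>))"
    by (rule sum.swap)
  also have "\<dots> = (\<Sum>s<nS. (\<Sum>\<rho>\<in>tr m. F (Suc ?n) s \<rho>) + (\<Sum>u<nS. (\<Sum>\<rho>\<in>tr m. hat.F (Suc ?n) u \<rho>) * \<bar>transl ?n u s\<bar>))"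
    unfolding sum.distrib sum_distrib_right by (intro arg_cong2[of _ _ _ _ "(+)"] sum.cong refl sum.swap)
  also have "\<dots> = (\<Sum>s<nS. real nA ^ m + real nA ^ m * (\<Sum>u<nS. \<bar>transl ?n u s\<bar>))"
    using m by (intro sum.cong refl) (simp add: sum_fut hat.sum_fut sum_distrib_left)
  also have "\<dots> \<le> (\<Sum>s<nS. real nA ^ m + real nA ^ m * (B * real nA ^ m))"
    by (intro sum_mono add_left_mono mult_left_mono sum_transl_le) auto
  finally show ?thesis by (simp add: algebra_simps)
qed

text \<open>The sample size may involve nA only through nA^m, so the weight nA^(m + 1) of the longer
  windows is absorbed into a square; this uses m \<ge> 1.\<close>

lemma nA_power_le: "real nA * real nA ^ m \<le> (real nA ^ m)\<^sup>2" "1 \<le> real nA ^ m"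
proof -
  have "real nA ^ 1 \<le> real nA ^ m" using nA m by (intro power_increasing) auto
  then show "real nA * real nA ^ m \<le> (real nA ^ m)\<^sup>2"
    unfolding power2_eq_square by (intro mult_right_mono) auto
  show "1 \<le> real nA ^ m" using nA by (intro one_le_power) auto
qed

lemma step_data:
  assumes \<pi>: "\<pi> \<in> policies nA nO H" and j: "j < H - m"
  shows "step_err \<pi> j \<le> 2 * B * (real nA ^ m)\<^sup>2 *
    (\<Sum>\<tau>\<in>tr H. policy_prob (uniform_after nA j \<pi>) [] \<tau> * \<bar>lik_diff \<tau>\<bar>)" (is "_ \<le> _ * ?U")
proof -
  have U: "?U \<ge> 0" by (intro sum_nonneg) auto
  have "step_err \<pi> j \<le> B * (real nA ^ Suc m * ?U) + real nA * B * (real nA ^ m * ?U)"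
    using step_err_le[OF j] prefix_err_le[OF \<pi>, of j "j + Suc m"] prefix_err_le[OF \<pi>, of j "j + m"] j B
    by (smt (verit) add_diff_cancel_left' le_add1 less_diff_conv mult_left_mono mult_nonneg_nonneg of_nat_0_le_iff
      Suc_leI add_Suc_right order_less_imp_le)
  also have "\<dots> = 2 * B * (real nA * real nA ^ m) * ?U" by simp
  also have "\<dots> \<le> 2 * B * (real nA ^ m)\<^sup>2 * ?U"
    using B U by (intro mult_right_mono mult_left_mono nA_power_le) auto
  finally show ?thesis .
qed

lemma final_data:
  assumes \<pi>: "\<pi> \<in> policies nA nO H"
  shows "final_err \<pi> \<le> (1 + B) * (real nA ^ m)\<^sup>2 *
    (\<Sum>\<tau>\<in>tr H. policy_prob (uniform_after nA (H - m) \<pi>) [] \<tau> * \<bar>lik_diff \<tau>\<bar>)" (is "_ \<le> _ * ?U")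
proof -
  have U: "?U \<ge> 0" by (intro sum_nonneg) auto
  have W: "1 \<le> real nA ^ m" by (rule nA_power_le)
  have "final_err \<pi> \<le> (1 + real nA ^ m * B) * prefix_err \<pi> (H - m) H" by (rule final_err_le)
  also have "\<dots> \<le> (1 + real nA ^ m * B) * (real nA ^ (H - (H - m)) * ?U)"
    using B by (intro mult_left_mono prefix_err_le \<pi>) auto
  also have "H - (H - m) = m" using m by simp
  also have "(1 + real nA ^ m * B) * (real nA ^ m * ?U) \<le> (real nA ^ m * (1 + B)) * (real nA ^ m * ?U)"
    using B U W by (intro mult_right_mono) (auto simp: distrib_left)
  finally show ?thesis by (simp add: power2_eq_square mult_ac)
qed

lemma init_data:
  assumes \<pi>: "\<pi> \<in> policies nA nO H"
  shows "init_err \<le> real nA ^ m *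
    (\<Sum>\<tau>\<in>tr H. policy_prob (uniform_after nA 0 \<pi>) [] \<tau> * \<bar>lik_diff \<tau>\<bar>)"
  using prefix_err_le[OF \<pi>, of 0 m] m by (simp add: init_err_eq[of \<pi>])

lemma init_err_le: "nS > 0 \<Longrightarrow> init_err \<le> 2 * real nA ^ m"
proof -
  have "init_err \<le> (\<Sum>\<rho>\<in>tr m. L \<rho> + hat.L \<rho>)"
    unfolding init_err_def lik_diff_def
    by (intro sum_mono order_trans[OF abs_triangle_ineq4]) auto
  also have "\<dots> = (\<Sum>s<nS. mu s * (\<Sum>\<rho>\<in>tr m. F (Suc 0) s \<rho>)) + (\<Sum>s<nS. mu' s * (\<Sum>\<rho>\<in>tr m. hat.F (Suc 0) s \<rho>))"
    unfolding lik_def sum.distrib sum_distrib_left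
    by (intro arg_cong2[of _ _ _ _ "(+)"] sum.swap)
  also have "\<dots> = 2 * real nA ^ m"
    using m by (simp add: sum_fut hat.sum_fut sum_mu hat.sum_mu flip: sum_distrib_right)
  finally show ?thesis .
qed

end

section \<open>Trajectory laws of a model\<close>

abbreviation model_lik :: "nat \<Rightarrow> model \<Rightarrow> traj \<Rightarrow> real" where
  "model_lik nS \<theta> \<equiv> lik nS (pmf (initial \<theta>)) (\<lambda>h a s. pmf (transition \<theta> h a s)) (\<lambda>h s. pmf (emission \<theta> h s))"

abbreviation model_fut :: "nat \<Rightarrow> model \<Rightarrow> nat \<Rightarrow> nat \<Rightarrow> traj \<Rightarrow> real" where
  "model_fut nS \<theta> \<equiv> fut nS (\<lambda>h a s. pmf (transition \<theta> h a s)) (\<lambda>h s. pmf (emission \<theta> h s))"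

lemma models_initial: "\<theta> \<in> models nS nA nO H \<Longrightarrow> set_pmf (initial \<theta>) \<subseteq> {..<nS}"
  by (simp add: models_def)

lemma models_transition:
  "\<lbrakk>\<theta> \<in> models nS nA nO H; 1 \<le> h; h < H; a < nA; s < nS\<rbrakk> \<Longrightarrow> set_pmf (transition \<theta> h a s) \<subseteq> {..<nS}"
  by (simp add: models_def)

lemma models_emission:
  "\<lbrakk>\<theta> \<in> models nS nA nO H; 1 \<le> h; h \<le> H; s < nS\<rbrakk> \<Longrightarrow> set_pmf (emission \<theta> h s) \<subseteq> {..<nO}"
  by (simp add: models_def)

lemma hmm_model:
  assumes "\<theta> \<in> models nS nA nO H"
  shows "hmm nS nA nO H (pmf (initial \<theta>)) (\<lambda>h a s. pmf (transition \<theta> h a s)) (\<lambda>h s. pmf (emission \<theta> h s))"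
  using models_initial[OF assms] models_transition[OF assms] models_emission[OF assms]
  by unfold_locales (simp_all add: sum_pmf_lessThan_eq_1)

section \<open>Factorisation of the trajectory law\<close>

lemma pmf_bind_finite:
  assumes "finite A" "\<And>x. x \<in> set_pmf p \<Longrightarrow> pmf (f x) y \<noteq> 0 \<Longrightarrow> x \<in> A"
  shows "pmf (bind_pmf p f) y = (\<Sum>x\<in>A. pmf p x * pmf (f x) y)"
  unfolding pmf_bind by (subst integral_measure_pmf[OF assms(1)]) (use assms(2) in auto)

lemma set_pmf_rollout: "set_pmf (rollout \<theta> \<pi> n hist s) \<subseteq> {hist @ \<tau> | \<tau>. length \<tau> = n}"
proof (induction n arbitrary: hist s)
  case (Suc n)
  show ?case
  proof
    fix x assume "x \<in> set_pmf (rollout \<theta> \<pi> (Suc n) hist s)"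
    then obtain ob a s' where "x \<in> set_pmf (rollout \<theta> \<pi> n (hist @ [(ob, a)]) s')"
      by (cases "n = 0") auto
    then obtain \<tau> where "x = hist @ (ob, a) # \<tau>" "length \<tau> = n"
      using Suc.IH[of "hist @ [(ob, a)]" s'] by auto
    then show "x \<in> {hist @ \<tau> | \<tau>. length \<tau> = Suc n}" by force
  qed
qed simp

lemma pmf_rollout:
  assumes \<theta>: "\<theta> \<in> models nS nA nO H"
  shows "\<lbrakk>\<tau> \<in> trajectories nA nO n; s < nS; length hist + n \<le> H\<rbrakk> \<Longrightarrow>
    pmf (rollout \<theta> \<pi> n hist s) (hist @ \<tau>) = policy_prob \<pi> hist \<tau> * model_fut nS \<theta> (Suc (length hist)) s \<tau>"
proof (induction n arbitrary: \<tau> hist s)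
  case (Suc n)
  obtain ob a \<tau>' where \<tau>: "\<tau> = (ob, a) # \<tau>'" "\<tau>' \<in> trajectories nA nO n" "ob < nO" "a < nA"
    using Suc.prems(1) unfolding trajectories_def length_Suc_conv by auto
  define R where "R ob' a' = (if n = 0 then return_pmf (hist @ [(ob', a')])
    else bind_pmf (transition \<theta> (length hist + 1) a' s) (rollout \<theta> \<pi> n (hist @ [(ob', a')])))" for ob' a'
  \<comment> \<open>A rollout keeps its history as a prefix, so \<tau> fixes the pair (ob, a), and
    the sums below have a single term.\<close>
  have R: "hist @ \<tau> \<in> set_pmf (R ob' a') \<Longrightarrow> ob' = ob \<and> a' = a" for ob' a'
    unfolding R_def \<tau>(1) using set_pmf_rollout[of \<theta> \<pi> n "hist @ [(ob', a')]"]
    by (auto split: if_splits)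
  have "pmf (rollout \<theta> \<pi> (Suc n) hist s) (hist @ \<tau>)
    = pmf (bind_pmf (emission \<theta> (length hist + 1) s) (\<lambda>ob'. bind_pmf (\<pi> hist ob') (R ob'))) (hist @ \<tau>)"
    unfolding R_def by simp
  also have "\<dots> = (\<Sum>ob'\<in>{ob}. pmf (emission \<theta> (length hist + 1) s) ob' * pmf (bind_pmf (\<pi> hist ob') (R ob')) (hist @ \<tau>))"
    by (rule pmf_bind_finite) (use R in \<open>auto simp: pmf_eq_0_set_pmf\<close>)
  also have "\<dots> = pmf (emission \<theta> (length hist + 1) s) ob * (\<Sum>a'\<in>{a}. pmf (\<pi> hist ob) a' * pmf (R ob a') (hist @ \<tau>))"
    by (subst pmf_bind_finite[of "{a}"]) (use R in \<open>auto simp: pmf_eq_0_set_pmf\<close>)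
  also have "\<dots> = pmf (emission \<theta> (length hist + 1) s) ob * (pmf (\<pi> hist ob) a * pmf (R ob a) (hist @ \<tau>))"
    by simp
  also have "pmf (R ob a) (hist @ \<tau>) = policy_prob \<pi> (hist @ [(ob, a)]) \<tau>' * (if \<tau>' = [] then 1 else
      \<Sum>s'<nS. pmf (transition \<theta> (Suc (length hist)) a s) s' * model_fut nS \<theta> (Suc (Suc (length hist))) s' \<tau>')"
  proof (cases "n = 0")
    case True
    then show ?thesis using \<tau> by (simp add: R_def)
  next
    case False
    then have ne: "\<tau>' \<noteq> []" using \<tau> by (auto simp: trajectories_def)
    have sub: "set_pmf (transition \<theta> (Suc (length hist)) a s) \<subseteq> {..<nS}"
      using Suc.prems \<tau> False by (intro models_transition[OF \<theta>]) auto
    have "pmf (R ob a) (hist @ \<tau>) = pmf (bind_pmf (transition \<theta> (Suc (length hist)) a s) (rollout \<theta> \<pi> n (hist @ [(ob, a)]))) ((hist @ [(ob, a)]) @ \<tau>')"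
      using False \<tau> by (simp add: R_def)
    also have "\<dots> = (\<Sum>s'<nS. pmf (transition \<theta> (Suc (length hist)) a s) s' * pmf (rollout \<theta> \<pi> n (hist @ [(ob, a)]) s') ((hist @ [(ob, a)]) @ \<tau>'))"
      using sub by (intro pmf_bind_finite) auto
    also have "\<dots> = (\<Sum>s'<nS. pmf (transition \<theta> (Suc (length hist)) a s) s' * (policy_prob \<pi> (hist @ [(ob, a)]) \<tau>' * model_fut nS \<theta> (Suc (Suc (length hist))) s' \<tau>'))"
      using Suc.prems \<tau> by (intro sum.cong refl arg_cong2[of _ _ _ _ "(*)"]) (subst Suc.IH, auto)
    finally show ?thesis using ne by (simp add: sum_distrib_left mult_ac)
  qed
  finally show ?case unfolding \<tau>(1) by simp
qed (simp)

text \<open>The policy and model factors separate, so distances and ratios of two models under one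
  policy reduce to \<open>model_lik\<close>.\<close>

lemma pmf_traj_pmf:
  assumes \<theta>: "\<theta> \<in> models nS nA nO H" and \<tau>: "\<tau> \<in> trajectories nA nO H"
  shows "pmf (traj_pmf H \<theta> \<pi>) \<tau> = policy_prob \<pi> [] \<tau> * model_lik nS \<theta> \<tau>"
proof -
  have "pmf (traj_pmf H \<theta> \<pi>) \<tau> = (\<Sum>s<nS. pmf (initial \<theta>) s * pmf (rollout \<theta> \<pi> H [] s) \<tau>)"
    unfolding traj_pmf_def using \<theta> by (intro pmf_bind_finite) (auto simp: models_def)
  also have "\<dots> = (\<Sum>s<nS. pmf (initial \<theta>) s * (policy_prob \<pi> [] \<tau> * model_fut nS \<theta> (Suc 0) s \<tau>))"
    using pmf_rollout[OF \<theta> \<tau>, of _ "[]" \<pi>] by (intro sum.cong refl) simp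
  finally show ?thesis unfolding lik_def by (simp add: sum_distrib_left mult_ac)
qed

lemma set_pmf_traj_pmf:
  assumes \<theta>: "\<theta> \<in> models nS nA nO H" and \<pi>: "\<pi> \<in> policies nA nO H"
  shows "set_pmf (traj_pmf H \<theta> \<pi>) \<subseteq> trajectories nA nO H"
proof -
  have "set_pmf (rollout \<theta> \<pi> n hist s) \<subseteq> trajectories nA nO H"
    if "hist \<in> trajectories nA nO (length hist)" "length hist + n = H" "s < nS" for n hist s
    using that
  proof (induction n arbitrary: hist s)
    case (Suc n)
    have em: "set_pmf (emission \<theta> (length hist + 1) s) \<subseteq> {..<nO}"
      using Suc.prems by (intro models_emission[OF \<theta>]) auto
    have po: "set_pmf (\<pi> hist ob) \<subseteq> {..<nA}" if "ob < nO" for ob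
      using \<pi> Suc.prems that by (auto simp: policies_def trajectories_def)
    have tn: "set_pmf (transition \<theta> (length hist + 1) a s) \<subseteq> {..<nS}" if "a < nA" "n \<noteq> 0" for a
      using Suc.prems that by (intro models_transition[OF \<theta>]) auto
    have snoc: "hist @ [(ob, a)] \<in> trajectories nA nO (length (hist @ [(ob, a)]))" if "ob < nO" "a < nA" for ob a
      using that Suc.prems by (auto simp: trajectories_def)
    show ?case
    proof
      fix x assume "x \<in> set_pmf (rollout \<theta> \<pi> (Suc n) hist s)"
      then have "\<exists>ob\<in>set_pmf (emission \<theta> (length hist + 1) s). \<exists>a\<in>set_pmf (\<pi> hist ob). \<exists>s'.
        (if n = 0 then s' = s else s' \<in> set_pmf (transition \<theta> (length hist + 1) a s))
        \<and> x \<in> set_pmf (rollout \<theta> \<pi> n (hist @ [(ob, a)]) s')"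
        by (cases "n = 0") auto
      then obtain ob a s' where oa: "ob \<in> set_pmf (emission \<theta> (length hist + 1) s)" "a \<in> set_pmf (\<pi> hist ob)"
        and s': "if n = 0 then s' = s else s' \<in> set_pmf (transition \<theta> (length hist + 1) a s)"
        and x: "x \<in> set_pmf (rollout \<theta> \<pi> n (hist @ [(ob, a)]) s')" by blast
      have ob: "ob < nO" using oa em by auto
      have a: "a < nA" using oa po[OF ob] by auto
      have "s' < nS" using s' Suc.prems tn[OF a] by (auto split: if_splits)
      then show "x \<in> trajectories nA nO H"
        using x Suc.IH[OF snoc[OF ob a], of s'] Suc.prems by auto
    qed
  qed simp
  from this[of "[]" H] have "set_pmf (rollout \<theta> \<pi> H [] s) \<subseteq> trajectories nA nO H" if "s < nS" for s
    using that by simp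
  then show ?thesis unfolding traj_pmf_def using models_initial[OF \<theta>] by auto
qed

section \<open>Emission-action matrices as window likelihoods\<close>

text \<open>A window of pairs has one action more than \<open>obs_pmf\<close> takes. As
  \<open>fut\<close> ignores the last action, any b may pad the list.\<close>

lemma pmf_obs_pmf:
  assumes \<theta>: "\<theta> \<in> models nS nA nO H"
  shows "\<lbrakk>length obs = Suc (length acts); 1 \<le> h; h + length acts \<le> H; s < nS; set acts \<subseteq> {..<nA}\<rbrakk> \<Longrightarrow>
    pmf (obs_pmf \<theta> h s acts) obs = model_fut nS \<theta> h s (zip obs (acts @ [b]))"
proof (induction acts arbitrary: obs h s)
  case Nil
  then obtain ob where obs: "obs = [ob]" by (auto simp: length_Suc_conv)
  have "pmf (map_pmf (\<lambda>ob. [ob]) (emission \<theta> h s)) ((\<lambda>ob. [ob]) ob) = pmf (emission \<theta> h s) ob"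
    by (rule pmf_map_inj') (auto simp: inj_on_def)
  then show ?case by (simp add: obs)
next
  case (Cons a acts)
  obtain ob obs' where obs: "obs = ob # obs'" "length obs' = Suc (length acts)"
    using Cons.prems(1) by (auto simp: length_Suc_conv)
  have ne: "zip obs' (acts @ [b]) \<noteq> []" using obs by (cases obs') (auto simp: zip_eq_Nil_iff)
  let ?R = "\<lambda>ob'. bind_pmf (transition \<theta> h a s) (\<lambda>s'. bind_pmf (obs_pmf \<theta> (h + 1) s' acts) (\<lambda>obs. return_pmf (ob' # obs)))"
  have "pmf (obs_pmf \<theta> h s (a # acts)) obs = (\<Sum>ob'\<in>{ob}. pmf (emission \<theta> h s) ob' * pmf (?R ob') obs)"
    unfolding obs_pmf.simps by (rule pmf_bind_finite) (auto simp: obs pmf_eq_0_set_pmf)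
  also have "\<dots> = pmf (emission \<theta> h s) ob * pmf (?R ob) obs" by simp
  also have "pmf (?R ob) obs = (\<Sum>s'<nS. pmf (transition \<theta> h a s) s' * pmf (bind_pmf (obs_pmf \<theta> (h + 1) s' acts) (\<lambda>obs. return_pmf (ob # obs))) obs)"
  proof (rule pmf_bind_finite)
    have "set_pmf (transition \<theta> h a s) \<subseteq> {..<nS}" using Cons.prems by (intro models_transition[OF \<theta>]) auto
    then show "s' \<in> {..<nS}" if "s' \<in> set_pmf (transition \<theta> h a s)" for s' using that by auto
  qed simp
  also have "\<dots> = (\<Sum>s'<nS. pmf (transition \<theta> h a s) s' * pmf (obs_pmf \<theta> (Suc h) s' acts) obs')"
  proof (intro sum.cong refl arg_cong2[of _ _ _ _ "(*)"])
    fix s'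
    have "bind_pmf (obs_pmf \<theta> (h + 1) s' acts) (\<lambda>obs. return_pmf (ob # obs)) = map_pmf ((#) ob) (obs_pmf \<theta> (Suc h) s' acts)"
      by (simp add: map_pmf_def)
    then show "pmf (bind_pmf (obs_pmf \<theta> (h + 1) s' acts) (\<lambda>obs. return_pmf (ob # obs))) obs = pmf (obs_pmf \<theta> (Suc h) s' acts) obs'"
      unfolding obs by (simp add: pmf_map_inj')
  qed
  also have "\<dots> = (\<Sum>s'<nS. pmf (transition \<theta> h a s) s' * model_fut nS \<theta> (Suc h) s' (zip obs' (acts @ [b])))"
    using Cons.prems obs by (intro sum.cong refl arg_cong2[of _ _ _ _ "(*)"] Cons.IH) auto
  finally show ?case using ne by (simp add: obs)
qed

text \<open>The rows of the matrix are the windows padded with the action 0. Summing over all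
  windows adds further squares, which preserves the lower bound.\<close>

lemma revealing_lower_bound:
  assumes \<theta>: "\<theta> \<in> models nS nA nO H" and m: "1 \<le> m" "m \<le> H" and nA: "nA > 0" and \<alpha>: "\<alpha> > 0"
    and rev: "min_singular_value nS nA nO H m \<theta> \<ge> \<alpha>" and j: "j \<le> H - m"
  shows "\<alpha>^2 * (\<Sum>s<nS. v s ^ 2)
    \<le> (\<Sum>\<rho>\<in>trajectories nA nO m. (\<Sum>s<nS. model_fut nS \<theta> (Suc j) s \<rho> * v s)^2)"
proof -
  let ?M = "emission_action_mat nS nA nO m \<theta> (Suc j)"
  let ?r = "nA ^ (m - 1) * nO ^ m"
  let ?X = "row_index nA nO m"
  have "singular_value nS ?M \<ge> min_singular_value nS nA nO H m \<theta>"
    unfolding min_singular_value_def using j m by (intro Min_le) auto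
  then have "singular_value nS ?M \<ge> \<alpha>" using rev by simp
  moreover have "?M \<in> carrier_mat ?r nS" by (simp add: emission_action_mat_def)
  ultimately have "\<alpha>^2 * (\<Sum>s<nS. v s ^ 2) \<le> (\<Sum>i<?r. (\<Sum>s<nS. ?M $$ (i, s) * v s)^2)"
    by (intro singular_value_lower_bound \<alpha>)
  also have "\<dots> = (\<Sum>i<?r. case ?X ! i of (acts, obs) \<Rightarrow> (\<Sum>s<nS. pmf (obs_pmf \<theta> (Suc j) s acts) obs * v s)^2)"
    by (intro sum.cong refl) (auto simp: emission_action_mat_def split: prod.split)
  also have "\<dots> = (\<Sum>x\<in>set ?X. case x of (acts, obs) \<Rightarrow> (\<Sum>s<nS. pmf (obs_pmf \<theta> (Suc j) s acts) obs * v s)^2)"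
  proof (rule sum.reindex_bij_betw)
    have "distinct ?X" unfolding row_index_def
      by (intro distinct_product distinct_n_lists) auto
    moreover have "length ?X = ?r" by (simp add: row_index_def length_n_lists)
    ultimately show "bij_betw (\<lambda>i. ?X ! i) {..<?r} (set ?X)"
      by (intro bij_betw_nth) auto
  qed
  also have "\<dots> = (\<Sum>x\<in>set ?X. (\<Sum>s<nS. model_fut nS \<theta> (Suc j) s (zip (snd x) (fst x @ [0])) * v s)^2)"
  proof (intro sum.cong refl, clarify)
    fix acts obs assume "(acts, obs) \<in> set ?X"
    then have *: "length acts = m - 1" "length obs = m" "set acts \<subseteq> {..<nA}"
      unfolding row_index_def by (auto simp: set_n_lists)
    have "pmf (obs_pmf \<theta> (Suc j) s acts) obs = model_fut nS \<theta> (Suc j) s (zip obs (acts @ [0]))" if "s < nS" for s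
      using * m j that by (intro pmf_obs_pmf[OF \<theta>]) auto
    then show "(\<Sum>s<nS. pmf (obs_pmf \<theta> (Suc j) s acts) obs * v s)^2
      = (\<Sum>s<nS. model_fut nS \<theta> (Suc j) s (zip (snd (acts, obs)) (fst (acts, obs) @ [0])) * v s)^2" by simp
  qed
  also have "\<dots> = (\<Sum>\<rho>\<in>(\<lambda>x. zip (snd x) (fst x @ [0])) ` set ?X. (\<Sum>s<nS. model_fut nS \<theta> (Suc j) s \<rho> * v s)^2)"
  proof (rule sum.reindex[symmetric, unfolded o_def])
    show "inj_on (\<lambda>x. zip (snd x) (fst x @ [0])) (set ?X)"
    proof (rule inj_onI, clarify)
      fix acts obs acts' obs' assume *: "(acts, obs) \<in> set ?X" "(acts', obs') \<in> set ?X"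
        and eq: "zip (snd (acts, obs)) (fst (acts, obs) @ [0]) = zip (snd (acts', obs')) (fst (acts', obs') @ [0])"
      have len: "length obs = length (acts @ [0])" "length obs' = length (acts' @ [0])"
        using * m unfolding row_index_def by (auto simp: set_n_lists)
      show "acts = acts' \<and> obs = obs'"
        using arg_cong[OF eq, of "map fst"] arg_cong[OF eq, of "map snd"] len
        by (simp add: map_fst_zip map_snd_zip)
    qed
  qed
  also have "\<dots> \<le> (\<Sum>\<rho>\<in>trajectories nA nO m. (\<Sum>s<nS. model_fut nS \<theta> (Suc j) s \<rho> * v s)^2)"
  proof (rule sum_mono2)
    show "(\<lambda>x. zip (snd x) (fst x @ [0])) ` set ?X \<subseteq> trajectories nA nO m"
    proof (clarify)
      fix acts obs assume "(acts, obs) \<in> set ?X"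
      then have *: "length acts = m - 1" "length obs = m" "set acts \<subseteq> {..<nA}" "set obs \<subseteq> {..<nO}"
        unfolding row_index_def by (auto simp: set_n_lists)
      have "set (zip obs (acts @ [0])) \<subseteq> {..<nO} \<times> {..<nA}"
      proof (clarify, intro conjI SigmaI)
        fix ob a assume "(ob, a) \<in> set (zip obs (acts @ [0]))"
        then have "ob \<in> set obs" "a \<in> set (acts @ [0])" by (auto dest: set_zip_leftD set_zip_rightD)
        then show "ob \<in> {..<nO}" "a \<in> {..<nA}" using * nA by auto
      qed
      then show "zip (snd (acts, obs)) (fst (acts, obs) @ [0]) \<in> trajectories nA nO m"
        using * m by (auto simp: trajectories_def)
    qed
  qed auto
  finally show ?thesis .
qed

text \<open>Twice the total variation distance between the trajectory laws of two models.\<close>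

definition traj_dist :: "nat \<Rightarrow> nat \<Rightarrow> nat \<Rightarrow> nat \<Rightarrow> model \<Rightarrow> model \<Rightarrow> policy \<Rightarrow> real" where
  "traj_dist nS nA nO H \<theta> \<theta>' \<pi> =
     (\<Sum>\<tau>\<in>trajectories nA nO H. policy_prob \<pi> [] \<tau> * \<bar>model_lik nS \<theta> \<tau> - model_lik nS \<theta>' \<tau>\<bar>)"

lemma traj_dist_nonneg: "traj_dist nS nA nO H \<theta> \<theta>' \<pi> \<ge> 0"
  unfolding traj_dist_def by (intro sum_nonneg) auto

text \<open>Summary of the comparison that hides the left inverses. The shape matters:
  \<open>ld\<close>, \<open>sd\<close> and \<open>fd\<close> do not depend on the policy, and
  \<open>g\<close> does not depend on the estimated model, so functionals and vectors from different
  iterations can be paired.\<close>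

lemma model_comparison:
  fixes \<theta> \<theta>' :: model and nS nA nO H m :: nat and \<alpha> :: real
  assumes \<theta>: "\<theta> \<in> models nS nA nO H" and \<theta>': "\<theta>' \<in> models nS nA nO H"
    and rev: "min_singular_value nS nA nO H m \<theta>' \<ge> \<alpha>"
    and \<alpha>: "\<alpha> > 0" and m: "1 \<le> m" "m \<le> H" and pos: "nS > 0" "nA > 0"
  defines "B \<equiv> sqrt (real nS) / \<alpha>" and "W \<equiv> real nA ^ m"
    and "dst \<equiv> traj_dist nS nA nO H \<theta> \<theta>'"
    and "g \<equiv> \<lambda>\<pi> \<tau> s. policy_prob \<pi> [] \<tau> *
      fwd nS (\<lambda>h a s. pmf (transition \<theta> h a s)) (\<lambda>h s. pmf (emission \<theta> h s)) (pmf (initial \<theta>)) (Suc 0) \<tau> s"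
  obtains ld :: "traj \<Rightarrow> real" and sd :: "nat \<Rightarrow> nat \<times> nat \<times> nat \<Rightarrow> nat \<Rightarrow> real" and fd :: "traj \<Rightarrow> nat \<Rightarrow> real"
  where
    "(\<Sum>\<rho>\<in>trajectories nA nO m. \<bar>ld \<rho>\<bar>) \<le> 2 * W"
    "\<And>j. j < H - m \<Longrightarrow> (\<Sum>p\<in>{..<nO} \<times> {..<nA} \<times> {..<nS}. \<Sum>s<nS. \<bar>sd j p s\<bar>) \<le> 2 * real nS * B * W\<^sup>2"
    "(\<Sum>\<rho>\<in>trajectories nA nO m. \<Sum>s<nS. \<bar>fd \<rho> s\<bar>) \<le> real nS * (1 + B) * W\<^sup>2"
    "\<And>\<pi>. \<pi> \<in> policies nA nO H \<Longrightarrow>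
      dst \<pi> \<le> B * (\<Sum>\<rho>\<in>trajectories nA nO m. \<bar>ld \<rho>\<bar>)
        + (\<Sum>j<H - m. \<Sum>\<tau>\<in>trajectories nA nO j. \<Sum>p\<in>{..<nO} \<times> {..<nA} \<times> {..<nS}. \<bar>\<Sum>s<nS. sd j p s * g \<pi> \<tau> s\<bar>)
        + (\<Sum>\<tau>\<in>trajectories nA nO (H - m). \<Sum>\<rho>\<in>trajectories nA nO m. \<bar>\<Sum>s<nS. fd \<rho> s * g \<pi> \<tau> s\<bar>)"
    "\<And>\<pi>. \<pi> \<in> policies nA nO H \<Longrightarrow>
      (\<Sum>\<rho>\<in>trajectories nA nO m. \<bar>ld \<rho>\<bar>) \<le> W * dst (uniform_after nA 0 \<pi>)"
    "\<And>\<pi> j. \<pi> \<in> policies nA nO H \<Longrightarrow> j < H - m \<Longrightarrow>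
      (\<Sum>\<tau>\<in>trajectories nA nO j. \<Sum>p\<in>{..<nO} \<times> {..<nA} \<times> {..<nS}. \<bar>\<Sum>s<nS. sd j p s * g \<pi> \<tau> s\<bar>)
        \<le> 2 * B * W\<^sup>2 * dst (uniform_after nA j \<pi>)"
    "\<And>\<pi>. \<pi> \<in> policies nA nO H \<Longrightarrow>
      (\<Sum>\<tau>\<in>trajectories nA nO (H - m). \<Sum>\<rho>\<in>trajectories nA nO m. \<bar>\<Sum>s<nS. fd \<rho> s * g \<pi> \<tau> s\<bar>)
        \<le> (1 + B) * W\<^sup>2 * dst (uniform_after nA (H - m) \<pi>)"
proof -
  have "\<exists>P. \<forall>j \<le> H - m.
    (\<forall>v s. s < nS \<longrightarrow> (\<Sum>\<rho>\<in>trajectories nA nO m. P j s \<rho> * (\<Sum>s'<nS. model_fut nS \<theta>' (Suc j) s' \<rho> * v s')) = v s) \<and>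
    (\<forall>x. (\<Sum>s<nS. \<bar>\<Sum>\<rho>\<in>trajectories nA nO m. P j s \<rho> * x \<rho>\<bar>) \<le> B * (\<Sum>\<rho>\<in>trajectories nA nO m. \<bar>x \<rho>\<bar>))"
    (is "\<exists>P. \<forall>j \<le> H - m. ?A j (P j)")
  proof -
    have "\<exists>P. ?A j P" if j: "j \<le> H - m" for j
      by (rule bounded_left_inverse[of "trajectories nA nO m" \<alpha> nS "\<lambda>\<rho> s. model_fut nS \<theta>' (Suc j) s \<rho>"])
        (use \<alpha> j pos m rev in \<open>auto simp: B_def intro!: revealing_lower_bound[OF \<theta>']\<close>)
    then show ?thesis by (intro choice) blast
  qed
  then obtain P where P: "\<And>j v s. j \<le> H - m \<Longrightarrow> s < nS \<Longrightarrow>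
      (\<Sum>\<rho>\<in>trajectories nA nO m. P j s \<rho> * (\<Sum>s'<nS. model_fut nS \<theta>' (Suc j) s' \<rho> * v s')) = v s"
    "\<And>j x. j \<le> H - m \<Longrightarrow> (\<Sum>s<nS. \<bar>\<Sum>\<rho>\<in>trajectories nA nO m. P j s \<rho> * x \<rho>\<bar>) \<le> B * (\<Sum>\<rho>\<in>trajectories nA nO m. \<bar>x \<rho>\<bar>)"
    by blast
  interpret hat: hmm nS nA nO H "pmf (initial \<theta>')" "\<lambda>h a s. pmf (transition \<theta>' h a s)" "\<lambda>h s. pmf (emission \<theta>' h s)"
    by (rule hmm_model[OF \<theta>'])
  interpret tru: hmm nS nA nO H "pmf (initial \<theta>)" "\<lambda>h a s. pmf (transition \<theta> h a s)" "\<lambda>h s. pmf (emission \<theta> h s)"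
    by (rule hmm_model[OF \<theta>])
  interpret pair: hmm_pair nS nA nO H "pmf (initial \<theta>)" "\<lambda>h a s. pmf (transition \<theta> h a s)" "\<lambda>h s. pmf (emission \<theta> h s)"
    "pmf (initial \<theta>')" "\<lambda>h a s. pmf (transition \<theta>' h a s)" "\<lambda>h s. pmf (emission \<theta>' h s)" m B P
    by unfold_locales (use m \<alpha> pos P in \<open>auto simp: B_def\<close>)
  have B: "B \<ge> 0" using \<alpha> by (simp add: B_def)
  have W: "1 \<le> W" "real nA * W \<le> W\<^sup>2" unfolding W_def by (rule pair.nA_power_le)+
  have WW: "W \<le> W\<^sup>2" using W unfolding power2_eq_square by simp
  have dst: "dst \<pi> = (\<Sum>\<tau>\<in>trajectories nA nO H. policy_prob \<pi> [] \<tau> * \<bar>pair.lik_diff \<tau>\<bar>)" for \<pi>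
    unfolding dst_def traj_dist_def pair.lik_diff_def ..
  show thesis
  proof (rule that[of pair.lik_diff pair.step_defect pair.final_defect])
    show "(\<Sum>\<rho>\<in>trajectories nA nO m. \<bar>pair.lik_diff \<rho>\<bar>) \<le> 2 * W"
      using pair.init_err_le[OF pos(1)] unfolding pair.init_err_def W_def .
    show "(\<Sum>p\<in>{..<nO} \<times> {..<nA} \<times> {..<nS}. \<Sum>s<nS. \<bar>pair.step_defect j p s\<bar>) \<le> 2 * real nS * B * W\<^sup>2"
      if "j < H - m" for j
    proof -
      have "2 * real nS * real nA * B * W = 2 * real nS * B * (real nA * W)" by simp
      also have "\<dots> \<le> 2 * real nS * B * W\<^sup>2" using B W by (intro mult_left_mono) auto
      finally show ?thesis using pair.step_defect_le[OF that] unfolding W_def by linarith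
    qed
    show "(\<Sum>\<rho>\<in>trajectories nA nO m. \<Sum>s<nS. \<bar>pair.final_defect \<rho> s\<bar>) \<le> real nS * (1 + B) * W\<^sup>2"
    proof -
      have "real nS * W * (1 + B * W) = real nS * (W + B * W\<^sup>2)" by (simp add: power2_eq_square algebra_simps)
      also have "\<dots> \<le> real nS * (W\<^sup>2 + B * W\<^sup>2)" using WW by (intro mult_left_mono) auto
      finally show ?thesis using pair.final_defect_le unfolding W_def by (simp add: algebra_simps)
    qed
  next
    fix \<pi> assume \<pi>: "\<pi> \<in> policies nA nO H"
    show "dst \<pi> \<le> B * (\<Sum>\<rho>\<in>trajectories nA nO m. \<bar>pair.lik_diff \<rho>\<bar>)
        + (\<Sum>j<H - m. \<Sum>\<tau>\<in>trajectories nA nO j. \<Sum>p\<in>{..<nO} \<times> {..<nA} \<times> {..<nS}. \<bar>\<Sum>s<nS. pair.step_defect j p s * g \<pi> \<tau> s\<bar>)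
        + (\<Sum>\<tau>\<in>trajectories nA nO (H - m). \<Sum>\<rho>\<in>trajectories nA nO m. \<bar>\<Sum>s<nS. pair.final_defect \<rho> s * g \<pi> \<tau> s\<bar>)"
      using pair.total_variation_decomposition[OF \<pi>]
      unfolding dst pair.init_err_def pair.step_err_def pair.final_err_def g_def .
    show "(\<Sum>\<rho>\<in>trajectories nA nO m. \<bar>pair.lik_diff \<rho>\<bar>) \<le> W * dst (uniform_after nA 0 \<pi>)"
      using pair.init_data[OF \<pi>] unfolding dst pair.init_err_def W_def .
    show "(\<Sum>\<tau>\<in>trajectories nA nO (H - m). \<Sum>\<rho>\<in>trajectories nA nO m. \<bar>\<Sum>s<nS. pair.final_defect \<rho> s * g \<pi> \<tau> s\<bar>)
        \<le> (1 + B) * W\<^sup>2 * dst (uniform_after nA (H - m) \<pi>)"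
      using pair.final_data[OF \<pi>] unfolding dst pair.final_err_def g_def W_def .
    show "(\<Sum>\<tau>\<in>trajectories nA nO j. \<Sum>p\<in>{..<nO} \<times> {..<nA} \<times> {..<nS}. \<bar>\<Sum>s<nS. pair.step_defect j p s * g \<pi> \<tau> s\<bar>)
        \<le> 2 * B * W\<^sup>2 * dst (uniform_after nA j \<pi>)" if "j < H - m" for j
      using pair.step_data[OF \<pi> that] unfolding dst pair.step_err_def g_def W_def .
  qed
qed

text \<open>The pigeonhole principle is used for the initial error, for each of the H - m steps and
  for the final error. In iteration k the functionals come from \<open>\<theta>' k\<close> and the
  vectors from \<open>\<pi> k\<close>; \<gamma> bounds what the estimate of iteration k gets wrong
  on the earlier data policies.\<close>

lemma sum_traj_dist_le:
  fixes \<theta> :: model and \<theta>' :: "nat \<Rightarrow> model" and \<pi> :: "nat \<Rightarrow> policy" and nS nA nO H m K :: nat and \<alpha> \<gamma> :: real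
  assumes \<theta>: "\<theta> \<in> models nS nA nO H"
    and \<theta>': "\<And>k. k < K \<Longrightarrow> \<theta>' k \<in> models nS nA nO H"
    and rev: "\<And>k. k < K \<Longrightarrow> min_singular_value nS nA nO H m (\<theta>' k) \<ge> \<alpha>"
    and \<pi>: "\<And>k. k < K \<Longrightarrow> \<pi> k \<in> policies nA nO H"
    and \<alpha>: "\<alpha> > 0" and m: "1 \<le> m" "m \<le> H" and pos: "nS > 0" "nA > 0" and \<gamma>: "\<gamma> \<ge> 0"
    and data: "\<And>k j. k < K \<Longrightarrow> j \<le> H - m \<Longrightarrow>
      (\<Sum>t<k. traj_dist nS nA nO H \<theta> (\<theta>' k) (uniform_after nA j (\<pi> t))) \<le> \<gamma>"
  shows "(\<Sum>k<K. traj_dist nS nA nO H \<theta> (\<theta>' k) (\<pi> k))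
    \<le> 24 * real H * (real nS)\<^sup>2 * (real nA ^ m)\<^sup>2 * (1 + sqrt (real nS) / \<alpha>) * (1 + \<gamma>) * ln (real nS + real K)"
proof -
  define B where "B = sqrt (real nS) / \<alpha>"
  define W where "W = real nA ^ m"
  define g where "g = (\<lambda>\<pi> \<tau> s. policy_prob \<pi> [] \<tau> *
      fwd nS (\<lambda>h a s. pmf (transition \<theta> h a s)) (\<lambda>h s. pmf (emission \<theta> h s)) (pmf (initial \<theta>)) (Suc 0) \<tau> s)"
  define D where "D k = traj_dist nS nA nO H \<theta> (\<theta>' k)" for k
  let ?tr = "trajectories nA nO" and ?tri = "{..<nO} \<times> {..<nA} \<times> {..<nS}"
  interpret hmm nS nA nO H "pmf (initial \<theta>)" "\<lambda>h a s. pmf (transition \<theta> h a s)" "\<lambda>h s. pmf (emission \<theta> h s)"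
    by (rule hmm_model[OF \<theta>])
  have B: "B \<ge> 0" using \<alpha> by (simp add: B_def)
  have W: "W \<ge> 1" unfolding W_def using pos by (intro one_le_power) auto
  \<comment> \<open>One predicate for all seven conclusions, so that the three families of functions
    can be chosen for all k at once.\<close>
  define Q where "Q k ld sd fd \<longleftrightarrow>
    (\<Sum>\<rho>\<in>?tr m. \<bar>ld \<rho>\<bar>) \<le> 2 * W \<and>
    (\<forall>j < H - m. (\<Sum>p\<in>?tri. \<Sum>s<nS. \<bar>sd j p s\<bar>) \<le> 2 * real nS * B * W\<^sup>2) \<and>
    (\<Sum>\<rho>\<in>?tr m. \<Sum>s<nS. \<bar>fd \<rho> s\<bar>) \<le> real nS * (1 + B) * W\<^sup>2 \<and>
    (\<forall>\<pi>\<in>policies nA nO H.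
      D k \<pi> \<le> B * (\<Sum>\<rho>\<in>?tr m. \<bar>ld \<rho>\<bar>)
        + (\<Sum>j<H - m. \<Sum>\<tau>\<in>?tr j. \<Sum>p\<in>?tri. \<bar>\<Sum>s<nS. sd j p s * g \<pi> \<tau> s\<bar>)
        + (\<Sum>\<tau>\<in>?tr (H - m). \<Sum>\<rho>\<in>?tr m. \<bar>\<Sum>s<nS. fd \<rho> s * g \<pi> \<tau> s\<bar>)) \<and>
    (\<forall>\<pi>\<in>policies nA nO H. (\<Sum>\<rho>\<in>?tr m. \<bar>ld \<rho>\<bar>) \<le> W * D k (uniform_after nA 0 \<pi>)) \<and>
    (\<forall>\<pi>\<in>policies nA nO H. \<forall>j < H - m.
      (\<Sum>\<tau>\<in>?tr j. \<Sum>p\<in>?tri. \<bar>\<Sum>s<nS. sd j p s * g \<pi> \<tau> s\<bar>) \<le> 2 * B * W\<^sup>2 * D k (uniform_after nA j \<pi>)) \<and>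
    (\<forall>\<pi>\<in>policies nA nO H.
      (\<Sum>\<tau>\<in>?tr (H - m). \<Sum>\<rho>\<in>?tr m. \<bar>\<Sum>s<nS. fd \<rho> s * g \<pi> \<tau> s\<bar>)
        \<le> (1 + B) * W\<^sup>2 * D k (uniform_after nA (H - m) \<pi>))" for k ld sd fd
  have "\<exists>ld sd fd. Q k ld sd fd" if k: "k < K" for k
  proof (rule model_comparison[OF \<theta> \<theta>'[OF k] rev[OF k] \<alpha> m pos, folded B_def W_def D_def], goal_cases)
    case (1 ld sd fd)
    show ?case unfolding Q_def g_def
      apply (rule exI[of _ ld], rule exI[of _ sd], rule exI[of _ fd])
      apply (intro conjI allI ballI impI)
      apply (rule 1)
      apply (rule 1, assumption)
      apply (rule 1)
      apply (rule 1, assumption)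
      apply (rule 1, assumption)
      apply (rule 1, assumption, assumption)
      apply (rule 1, assumption)
      done
  qed
  then have "\<exists>ld sd fd. \<forall>k<K. Q k (ld k) (sd k) (fd k)" by metis
  then obtain ld sd fd where "\<And>k. k < K \<Longrightarrow> Q k (ld k) (sd k) (fd k)" by blast
  note Q = this[unfolded Q_def]
  note ld = Q[THEN conjunct1] and sd = Q[THEN conjunct2, THEN conjunct1, rule_format]
    and fd = Q[THEN conjunct2, THEN conjunct2, THEN conjunct1]
    and dec = Q[THEN conjunct2, THEN conjunct2, THEN conjunct2, THEN conjunct1, rule_format]
    and ld_data = Q[THEN conjunct2, THEN conjunct2, THEN conjunct2, THEN conjunct2, THEN conjunct1, rule_format]
    and sd_data = Q[THEN conjunct2, THEN conjunct2, THEN conjunct2, THEN conjunct2, THEN conjunct2, THEN conjunct1, rule_format]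
    and fd_data = Q[THEN conjunct2, THEN conjunct2, THEN conjunct2, THEN conjunct2, THEN conjunct2, THEN conjunct2, rule_format]
  have scaled: "(\<Sum>t<k. e t) \<le> C * \<gamma>"
    if k: "k < K" and j: "j \<le> H - m" and C: "C \<ge> 0"
      and e: "\<And>t. t < k \<Longrightarrow> e t \<le> C * D k (uniform_after nA j (\<pi> t))" for k j C and e :: "nat \<Rightarrow> real"
  proof -
    have "(\<Sum>t<k. e t) \<le> (\<Sum>t<k. C * D k (uniform_after nA j (\<pi> t)))" by (intro sum_mono e) auto
    also have "\<dots> \<le> C * \<gamma>" using data[OF k j] C unfolding D_def by (simp add: mult_left_mono flip: sum_distrib_left)
    finally show ?thesis .
  qed
  \<comment> \<open>Weighted beliefs sum to the total probability of the prefixes, so the pigeonhole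
    principle applies with G = 1.\<close>
  have g1: "(\<Sum>\<tau>\<in>?tr j. \<Sum>s<nS. \<bar>g (\<pi> k) \<tau> s\<bar>) \<le> 1" if "k < K" "j < H" for k j
  proof -
    have "(\<Sum>\<tau>\<in>?tr j. \<Sum>s<nS. \<bar>g (\<pi> k) \<tau> s\<bar>) = (\<Sum>\<tau>\<in>?tr j. policy_prob (\<pi> k) [] \<tau> * lik nS (pmf (initial \<theta>)) (\<lambda>h a s. pmf (transition \<theta> h a s)) (\<lambda>h s. pmf (emission \<theta> h s)) \<tau>)"
      using sum_bel that unfolding g_def by (intro sum.cong refl) (simp add: abs_mult flip: sum_distrib_left)
    then show ?thesis using sum_policy_prob_L[OF \<pi>[OF that(1)], of j] that by simp
  qed
  define lg where "lg = ln (real nS + real K)"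
  have lg: "lg \<ge> 0" unfolding lg_def using pos by (intro ln_ge_zero) auto
  have init: "(\<Sum>k<K. \<Sum>\<rho>\<in>?tr m. \<bar>ld k \<rho>\<bar>) \<le> 8 * W * (1 + \<gamma>) * lg"
  proof -
    \<comment> \<open>The initial error is the same for all policies: dimension 1 and the constant
      vector 1.\<close>
    have "(\<Sum>k<K. \<Sum>i\<in>{()}. \<Sum>\<rho>\<in>?tr m. \<bar>\<Sum>r<(1::nat). ld k \<rho> * 1\<bar>) \<le> 4 * (1 * (2 * W) + W * \<gamma>) * real 1 * ln (real 1 + real K)"
    proof (rule l1_pigeonhole[where f = "\<lambda>k \<rho> _. ld k \<rho>" and g = "\<lambda>_ _ _. 1" and I = "{()}" and d = 1])
      show "(\<Sum>t<k. \<Sum>i\<in>{()}. \<Sum>\<rho>\<in>?tr m. \<bar>\<Sum>r<(1::nat). ld k \<rho> * 1\<bar>) \<le> W * \<gamma>" if k: "k < K" for k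
        using W scaled[OF k, of 0 W "\<lambda>_. \<Sum>\<rho>\<in>?tr m. \<bar>ld k \<rho>\<bar>"] ld_data[OF k] \<pi> k by auto
    qed (use W \<gamma> ld in auto)
    also have "\<dots> \<le> (8 * W * (1 + \<gamma>)) * ln (real 1 + real K)"
      using W \<gamma> by (intro mult_right_mono) (auto simp: algebra_simps)
    also have "\<dots> \<le> 8 * W * (1 + \<gamma>) * lg"
      unfolding lg_def using W \<gamma> pos by (intro mult_left_mono) auto
    finally show ?thesis by simp
  qed
  have step: "(\<Sum>k<K. \<Sum>\<tau>\<in>?tr j. \<Sum>p\<in>?tri. \<bar>\<Sum>s<nS. sd k j p s * g (\<pi> k) \<tau> s\<bar>)
    \<le> 8 * (real nS)\<^sup>2 * W\<^sup>2 * B * (1 + \<gamma>) * lg" if j: "j < H - m" for j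
  proof -
    have "(\<Sum>k<K. \<Sum>\<tau>\<in>?tr j. \<Sum>p\<in>?tri. \<bar>\<Sum>s<nS. sd k j p s * g (\<pi> k) \<tau> s\<bar>)
      \<le> 4 * (1 * (2 * real nS * B * W\<^sup>2) + 2 * B * W\<^sup>2 * \<gamma>) * real nS * ln (real nS + real K)"
    proof (rule l1_pigeonhole[where f = "\<lambda>k p s. sd k j p s" and g = "\<lambda>k. g (\<pi> k)"])
      show "(\<Sum>t<k. \<Sum>\<tau>\<in>?tr j. \<Sum>p\<in>?tri. \<bar>\<Sum>s<nS. sd k j p s * g (\<pi> t) \<tau> s\<bar>) \<le> 2 * B * W\<^sup>2 * \<gamma>" if k: "k < K" for k
        by (rule scaled[OF k, of j]) (use j B k sd_data \<pi> in auto)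
    qed (use pos B \<gamma> sd g1 j in auto)
    also have "\<dots> \<le> (8 * (real nS)\<^sup>2 * W\<^sup>2 * B * (1 + \<gamma>)) * lg"
      unfolding lg_def[symmetric]
    proof (intro mult_right_mono lg)
      have "4 * (1 * (2 * real nS * B * W\<^sup>2) + 2 * B * W\<^sup>2 * \<gamma>) * real nS = 8 * W\<^sup>2 * B * real nS * (real nS + \<gamma>)"
        by (simp add: algebra_simps)
      also have "\<dots> \<le> 8 * W\<^sup>2 * B * real nS * (real nS * (1 + \<gamma>))"
        using pos \<gamma> B by (intro mult_left_mono) (auto simp: algebra_simps mult_le_cancel_left1)
      finally show "4 * (1 * (2 * real nS * B * W\<^sup>2) + 2 * B * W\<^sup>2 * \<gamma>) * real nS \<le> 8 * (real nS)\<^sup>2 * W\<^sup>2 * B * (1 + \<gamma>)"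
        by (simp add: power2_eq_square mult_ac)
    qed
    finally show ?thesis .
  qed
  have final: "(\<Sum>k<K. \<Sum>\<tau>\<in>?tr (H - m). \<Sum>\<rho>\<in>?tr m. \<bar>\<Sum>s<nS. fd k \<rho> s * g (\<pi> k) \<tau> s\<bar>)
    \<le> 8 * (real nS)\<^sup>2 * W\<^sup>2 * (1 + B) * (1 + \<gamma>) * lg"
  proof -
    have "(\<Sum>k<K. \<Sum>\<tau>\<in>?tr (H - m). \<Sum>\<rho>\<in>?tr m. \<bar>\<Sum>s<nS. fd k \<rho> s * g (\<pi> k) \<tau> s\<bar>)
      \<le> 4 * (1 * (real nS * (1 + B) * W\<^sup>2) + (1 + B) * W\<^sup>2 * \<gamma>) * real nS * ln (real nS + real K)"
    proof (rule l1_pigeonhole[where f = "\<lambda>k p s. fd k p s" and g = "\<lambda>k. g (\<pi> k)"])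
      show "(\<Sum>t<k. \<Sum>\<tau>\<in>?tr (H - m). \<Sum>\<rho>\<in>?tr m. \<bar>\<Sum>s<nS. fd k \<rho> s * g (\<pi> t) \<tau> s\<bar>) \<le> (1 + B) * W\<^sup>2 * \<gamma>" if k: "k < K" for k
        by (rule scaled[OF k, of "H - m"]) (use B k fd_data \<pi> in auto)
    qed (use pos B \<gamma> fd g1 m in auto)
    also have "\<dots> \<le> (8 * (real nS)\<^sup>2 * W\<^sup>2 * (1 + B) * (1 + \<gamma>)) * lg"
      unfolding lg_def[symmetric]
    proof (intro mult_right_mono lg)
      have "4 * (1 * (real nS * (1 + B) * W\<^sup>2) + (1 + B) * W\<^sup>2 * \<gamma>) * real nS = 4 * W\<^sup>2 * (1 + B) * real nS * (real nS + \<gamma>)"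
        by (simp add: algebra_simps)
      also have "\<dots> \<le> 8 * W\<^sup>2 * (1 + B) * real nS * (real nS * (1 + \<gamma>))"
        using pos \<gamma> B by (intro mult_mono) (auto simp: algebra_simps mult_le_cancel_left1)
      finally show "4 * (1 * (real nS * (1 + B) * W\<^sup>2) + (1 + B) * W\<^sup>2 * \<gamma>) * real nS \<le> 8 * (real nS)\<^sup>2 * W\<^sup>2 * (1 + B) * (1 + \<gamma>)"
        by (simp add: power2_eq_square mult_ac)
    qed
    finally show ?thesis .
  qed
  \<comment> \<open>A common bound for all H - m + 2 contributions; H - m + 2 \<le> 3 H turns the
    constant 8 into 24.\<close>
  define R where "R = 8 * (real nS)\<^sup>2 * W\<^sup>2 * (1 + B) * (1 + \<gamma>) * lg"
  have R: "R \<ge> 0" unfolding R_def using B \<gamma> lg by simp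
  have "(\<Sum>k<K. D k (\<pi> k)) \<le> (\<Sum>k<K. B * (\<Sum>\<rho>\<in>?tr m. \<bar>ld k \<rho>\<bar>)
        + (\<Sum>j<H - m. \<Sum>\<tau>\<in>?tr j. \<Sum>p\<in>?tri. \<bar>\<Sum>s<nS. sd k j p s * g (\<pi> k) \<tau> s\<bar>)
        + (\<Sum>\<tau>\<in>?tr (H - m). \<Sum>\<rho>\<in>?tr m. \<bar>\<Sum>s<nS. fd k \<rho> s * g (\<pi> k) \<tau> s\<bar>))"
    using \<pi> by (intro sum_mono dec) auto
  also have "\<dots> = B * (\<Sum>k<K. \<Sum>\<rho>\<in>?tr m. \<bar>ld k \<rho>\<bar>)
        + (\<Sum>j<H - m. \<Sum>k<K. \<Sum>\<tau>\<in>?tr j. \<Sum>p\<in>?tri. \<bar>\<Sum>s<nS. sd k j p s * g (\<pi> k) \<tau> s\<bar>)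
        + (\<Sum>k<K. \<Sum>\<tau>\<in>?tr (H - m). \<Sum>\<rho>\<in>?tr m. \<bar>\<Sum>s<nS. fd k \<rho> s * g (\<pi> k) \<tau> s\<bar>)"
    unfolding sum.distrib by (subst sum.swap[of _ "{..<H - m}"]) (simp only: sum_distrib_left)
  also have "\<dots> \<le> R + (\<Sum>j<H - m. R) + R"
  proof (intro add_mono sum_mono)
    have "B * (\<Sum>k<K. \<Sum>\<rho>\<in>?tr m. \<bar>ld k \<rho>\<bar>) \<le> B * (8 * W * (1 + \<gamma>) * lg)"
      by (intro mult_left_mono init B)
    also have "\<dots> = 8 * (1 * W * B) * (1 + \<gamma>) * lg" by simp
    also have "\<dots> \<le> 8 * ((real nS)\<^sup>2 * W\<^sup>2 * (1 + B)) * (1 + \<gamma>) * lg"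
      using W B \<gamma> lg pos
      by (intro mult_right_mono mult_left_mono mult_mono) (auto simp: power2_eq_square mult_ge1_I)
    finally show "B * (\<Sum>k<K. \<Sum>\<rho>\<in>?tr m. \<bar>ld k \<rho>\<bar>) \<le> R" unfolding R_def by (simp add: mult_ac)
  next
    fix j assume "j \<in> {..<H - m}"
    then have "(\<Sum>k<K. \<Sum>\<tau>\<in>?tr j. \<Sum>p\<in>?tri. \<bar>\<Sum>s<nS. sd k j p s * g (\<pi> k) \<tau> s\<bar>)
      \<le> 8 * (real nS)\<^sup>2 * W\<^sup>2 * B * (1 + \<gamma>) * lg" by (intro step) simp
    also have "\<dots> \<le> R" unfolding R_def using \<gamma> lg B by (intro mult_right_mono mult_left_mono) auto
    finally show "(\<Sum>k<K. \<Sum>\<tau>\<in>?tr j. \<Sum>p\<in>?tri. \<bar>\<Sum>s<nS. sd k j p s * g (\<pi> k) \<tau> s\<bar>) \<le> R" .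
  qed (use final in \<open>simp add: R_def\<close>)
  also have "\<dots> = (real (H - m) + 2) * R" by (simp add: algebra_simps)
  also have "\<dots> \<le> (3 * real H) * R" using R m by (intro mult_right_mono) auto
  finally show ?thesis unfolding D_def R_def lg_def W_def B_def by (simp add: mult_ac)
qed

section \<open>The law of the collected data\<close>

definition weight_prod :: "(policy \<Rightarrow> traj \<Rightarrow> real) \<Rightarrow> dataset \<Rightarrow> real" where
  "weight_prod w D = (\<Prod>(\<pi>, \<tau>)\<leftarrow>D. w \<pi> \<tau>)"

lemma weight_prod_simps [simp]:
  "weight_prod w [] = 1"
  "weight_prod w ((\<pi>, \<tau>) # D) = w \<pi> \<tau> * weight_prod w D"
  "weight_prod w (D @ D') = weight_prod w D * weight_prod w D'"
  by (simp_all add: weight_prod_def)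

lemma weight_prod_nonneg: "(\<And>\<pi> \<tau>. 0 \<le> w \<pi> \<tau>) \<Longrightarrow> 0 \<le> weight_prod w D"
  by (induction D) auto

lemma weight_prod_pos: "(\<And>\<pi> \<tau>. (\<pi>, \<tau>) \<in> set D \<Longrightarrow> 0 < w \<pi> \<tau>) \<Longrightarrow> 0 < weight_prod w D"
proof (induction D)
  case (Cons x D)
  then show ?case by (cases x) auto
qed simp

lemma weight_prod_mono:
  "(\<And>\<pi> \<tau>. (\<pi>, \<tau>) \<in> set D \<Longrightarrow> 0 \<le> w \<pi> \<tau> \<and> w \<pi> \<tau> \<le> w' \<pi> \<tau>) \<Longrightarrow> 0 \<le> weight_prod w D \<and> weight_prod w D \<le> weight_prod w' D"
proof (induction D)
  case (Cons x D)
  obtain \<pi> \<tau> where x: "x = (\<pi>, \<tau>)" by force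
  have "0 \<le> weight_prod w D \<and> weight_prod w D \<le> weight_prod w' D" using Cons by auto
  moreover have "0 \<le> w \<pi> \<tau> \<and> w \<pi> \<tau> \<le> w' \<pi> \<tau>" using Cons.prems x by auto
  ultimately show ?case unfolding x by (auto intro!: mult_mono)
qed simp

lemma weight_prod_mult: "weight_prod (\<lambda>\<pi> \<tau>. w \<pi> \<tau> * w' \<pi> \<tau>) D = weight_prod w D * weight_prod w' D"
  by (induction D) auto

lemma weight_prod_sqrt: "weight_prod (\<lambda>\<pi> \<tau>. sqrt (w \<pi> \<tau>)) D = sqrt (weight_prod w D)"
  by (induction D) (auto simp: real_sqrt_mult)

lemma weight_prod_exp: "weight_prod (\<lambda>\<pi> \<tau>. exp (w \<pi>)) D = exp (\<Sum>\<pi>\<leftarrow>map fst D. w \<pi>)"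
  by (induction D) (auto simp: exp_add)

text \<open>With value - \<infinity> at 0, the sum of logarithms is the logarithm of the product
  even when a factor vanishes, so confidence sets can be handled through products of reals.\<close>

lemma log_likelihood_eq:
  "log_likelihood H D \<theta> = extended_ln (weight_prod (\<lambda>\<pi>. pmf (traj_pmf H \<theta> \<pi>)) D)"
proof (induction D)
  case Nil
  then show ?case by (simp add: log_likelihood_def extended_ln_def)
next
  case (Cons x D)
  obtain \<pi> \<tau> where x: "x = (\<pi>, \<tau>)" by force
  let ?p = "pmf (traj_pmf H \<theta> \<pi>) \<tau>" and ?q = "weight_prod (\<lambda>\<pi>. pmf (traj_pmf H \<theta> \<pi>)) D"
  have "?p \<ge> 0" "?q \<ge> 0" by (auto intro: weight_prod_nonneg)
  then have "extended_ln ?p + extended_ln ?q = extended_ln (?p * ?q)"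
    by (auto simp: extended_ln_def mult_le_0_iff ln_mult not_le)
  then show ?case using Cons unfolding x by (simp add: log_likelihood_def)
qed

text \<open>Holds on the support of \<open>omle\<close>. Positivity makes division by the true
  likelihood harmless.\<close>

definition valid_data :: "nat \<Rightarrow> nat \<Rightarrow> nat \<Rightarrow> model \<Rightarrow> dataset \<Rightarrow> bool" where
  "valid_data nA nO H \<theta> D \<longleftrightarrow> (\<forall>(\<pi>, \<tau>)\<in>set D. \<pi> \<in> policies nA nO H \<and> \<tau> \<in> trajectories nA nO H
     \<and> pmf (traj_pmf H \<theta> \<pi>) \<tau> > 0)"

lemma valid_data_lists: "valid_data nA nO H \<theta> D \<Longrightarrow> D \<in> lists (policies nA nO H \<times> trajectories nA nO H)"
  by (auto simp: valid_data_def lists_eq_set)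

lemma set_collect_episodes:
  assumes \<theta>: "\<theta> \<in> models nS nA nO H" and nA: "nA > 0" and \<pi>: "\<pi> \<in> policies nA nO H"
  shows "E \<in> set_pmf (collect_episodes nA H \<theta> \<pi> hs) \<Longrightarrow>
    valid_data nA nO H \<theta> E \<and> map fst E = map (\<lambda>h. uniform_after nA h \<pi>) hs"
proof (induction hs arbitrary: E)
  case (Cons h hs)
  then obtain \<tau> D where \<tau>: "\<tau> \<in> set_pmf (traj_pmf H \<theta> (uniform_after nA h \<pi>))"
    and D: "D \<in> set_pmf (collect_episodes nA H \<theta> \<pi> hs)" and E: "E = (uniform_after nA h \<pi>, \<tau>) # D" by auto
  have u: "uniform_after nA h \<pi> \<in> policies nA nO H" by (rule uniform_after_policies[OF \<pi> nA])
  then have "\<tau> \<in> trajectories nA nO H" using set_pmf_traj_pmf[OF \<theta> u] \<tau> by auto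
  then show ?case using Cons.IH[OF D] u \<tau> unfolding E by (auto simp: valid_data_def pmf_positive)
qed (auto simp: valid_data_def)

lemma set_omle:
  assumes \<theta>: "\<theta> \<in> models nS nA nO H" and nA: "nA > 0"
    and plan: "\<And>D. D \<in> lists (policies nA nO H \<times> trajectories nA nO H) \<Longrightarrow> snd (plan D) \<in> policies nA nO H"
  shows "(\<pi>s, D) \<in> set_pmf (omle nA H m \<theta> plan k) \<Longrightarrow>
    length \<pi>s = k \<and> length D = k * (H - m + 1) \<and> set \<pi>s \<subseteq> policies nA nO H \<and> valid_data nA nO H \<theta> D
    \<and> map fst D = concat (map (\<lambda>\<pi>. map (\<lambda>h. uniform_after nA h \<pi>) [0..<H - m + 1]) \<pi>s)"
proof (induction k arbitrary: \<pi>s D)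
  case 0
  then show ?case by (simp add: valid_data_def)
next
  case (Suc k)
  then obtain \<pi>s' D' E where D': "(\<pi>s', D') \<in> set_pmf (omle nA H m \<theta> plan k)"
    and E: "E \<in> set_pmf (collect_episodes nA H \<theta> (snd (plan D')) [0..<H - m + 1])"
    and eq: "\<pi>s = \<pi>s' @ [snd (plan D')]" "D = D' @ E" by (auto simp del: upt_Suc)
  note IH = Suc.IH[OF D']
  have p: "snd (plan D') \<in> policies nA nO H" using IH valid_data_lists plan by blast
  note E' = set_collect_episodes[OF \<theta> nA p E]
  then have "length E = H - m + 1" by (metis diff_zero length_map length_upt)
  then show ?case using IH E' p unfolding eq by (auto simp: valid_data_def simp del: upt_Suc)
qed

text \<open>Places all iterations on the probability space of the complete run, so that a union
  bound over k can use the tail bounds of the shorter runs.\<close>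

lemma omle_prefix:
  assumes \<theta>: "\<theta> \<in> models nS nA nO H" and nA: "nA > 0"
    and plan: "\<And>D. D \<in> lists (policies nA nO H \<times> trajectories nA nO H) \<Longrightarrow> snd (plan D) \<in> policies nA nO H"
    and k: "k \<le> K"
  shows "map_pmf (\<lambda>(\<pi>s, D). (take k \<pi>s, take (k * (H - m + 1)) D)) (omle nA H m \<theta> plan K) = omle nA H m \<theta> plan k"
  using k
proof (induction K rule: dec_induct)
  case base
  have "map_pmf (\<lambda>(\<pi>s, D). (take k \<pi>s, take (k * (H - m + 1)) D)) (omle nA H m \<theta> plan k)
    = map_pmf id (omle nA H m \<theta> plan k)"
    using set_omle[OF \<theta> nA plan] by (intro map_pmf_cong refl) auto
  then show ?case by simp
next
  case (step K)
  let ?f = "\<lambda>(\<pi>s :: policy list, D :: dataset). (take k \<pi>s, take (k * (H - m + 1)) D)"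
  have "map_pmf ?f (omle nA H m \<theta> plan (Suc K)) = bind_pmf (omle nA H m \<theta> plan K) (\<lambda>x. return_pmf (?f x))"
    unfolding omle.simps map_bind_pmf
  proof (intro bind_pmf_cong refl, goal_cases)
    case (1 x)
    obtain \<pi>s D where x: "x = (\<pi>s, D)" by force
    from 1 have "(\<pi>s, D) \<in> set_pmf (omle nA H m \<theta> plan K)" by (simp add: x)
    from set_omle[OF \<theta> nA plan this] have len: "length \<pi>s = K" "length D = K * (H - m + 1)" by auto
    obtain n where n: "n = H - m + 1" by blast
    have "k * n \<le> K * n" using step by (intro mult_right_mono) auto
    then have "take k (\<pi>s @ [snd (plan D)]) = take k \<pi>s" "take (k * n) (D @ E) = take (k * n) D" for E
      using len step n by auto
    then show ?case
      unfolding x n[symmetric] by (simp add: map_bind_pmf del: upt_Suc take_append)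
  qed
  also have "\<dots> = map_pmf ?f (omle nA H m \<theta> plan K)" by (simp add: map_pmf_def)
  finally show ?case using step by simp
qed

lemma omle_policy:
  assumes \<theta>: "\<theta> \<in> models nS nA nO H" and nA: "nA > 0"
    and plan: "\<And>D. D \<in> lists (policies nA nO H \<times> trajectories nA nO H) \<Longrightarrow> snd (plan D) \<in> policies nA nO H"
  shows "(\<pi>s, D) \<in> set_pmf (omle nA H m \<theta> plan K) \<Longrightarrow> k < K \<Longrightarrow> \<pi>s ! k = snd (plan (take (k * (H - m + 1)) D))"
proof (induction K arbitrary: \<pi>s D)
  case (Suc K)
  then obtain \<pi>s' D' E where D': "(\<pi>s', D') \<in> set_pmf (omle nA H m \<theta> plan K)"
    and eq: "\<pi>s = \<pi>s' @ [snd (plan D')]" "D = D' @ E" by (auto simp del: upt_Suc)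
  from set_omle[OF \<theta> nA plan D'] have len: "length \<pi>s' = K" "length D' = K * (H - m + 1)" by auto
  show ?case
  proof (cases "k = K")
    case True
    then show ?thesis using len by (simp add: eq nth_append)
  next
    case False
    then have k: "k < K" using Suc.prems by simp
    then have "k * (H - m + 1) \<le> K * (H - m + 1)" by (intro mult_right_mono) auto
    then show ?thesis using Suc.IH[OF D' k] len k by (simp add: eq nth_append)
  qed
qed simp

section \<open>Moments of products along the adaptive run\<close>

lemma nn_integral_collect_episodes:
  assumes \<theta>: "\<theta> \<in> models nS nA nO H" and nA: "nA > 0" and \<pi>: "\<pi> \<in> policies nA nO H"
    and w: "\<And>\<pi> \<tau>. 0 \<le> w \<pi> \<tau>" and c: "c \<ge> 0"
    and bound: "\<And>\<pi>. \<pi> \<in> policies nA nO H \<Longrightarrow> (\<Sum>\<tau>\<in>trajectories nA nO H. pmf (traj_pmf H \<theta> \<pi>) \<tau> * w \<pi> \<tau>) \<le> c"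
  shows "(\<integral>\<^sup>+E. ennreal (weight_prod w E) \<partial>measure_pmf (collect_episodes nA H \<theta> \<pi> hs)) \<le> ennreal (c ^ length hs)"
proof (induction hs)
  case (Cons h hs)
  let ?u = "uniform_after nA h \<pi>"
  have u: "?u \<in> policies nA nO H" by (rule uniform_after_policies[OF \<pi> nA])
  note nn = weight_prod_nonneg[of w, OF w]
  have "(\<integral>\<^sup>+E. ennreal (weight_prod w E) \<partial>measure_pmf (collect_episodes nA H \<theta> \<pi> (h # hs)))
    = (\<integral>\<^sup>+\<tau>. ennreal (w ?u \<tau>) * (\<integral>\<^sup>+D. ennreal (weight_prod w D) \<partial>measure_pmf (collect_episodes nA H \<theta> \<pi> hs)) \<partial>measure_pmf (traj_pmf H \<theta> ?u))"
    by (simp add: ennreal_mult w nn nn_integral_cmult)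
  also have "\<dots> \<le> (\<integral>\<^sup>+\<tau>. ennreal (w ?u \<tau>) * ennreal (c ^ length hs) \<partial>measure_pmf (traj_pmf H \<theta> ?u))"
    by (intro nn_integral_mono mult_left_mono Cons.IH) auto
  also have "\<dots> = (\<integral>\<^sup>+\<tau>. ennreal (w ?u \<tau>) \<partial>measure_pmf (traj_pmf H \<theta> ?u)) * ennreal (c ^ length hs)"
    by (rule nn_integral_multc) simp
  also have "(\<integral>\<^sup>+\<tau>. ennreal (w ?u \<tau>) \<partial>measure_pmf (traj_pmf H \<theta> ?u))
    = (\<Sum>\<tau>\<in>trajectories nA nO H. ennreal (w ?u \<tau>) * pmf (traj_pmf H \<theta> ?u) \<tau>)"
    using set_pmf_traj_pmf[OF \<theta> u] by (intro nn_integral_measure_pmf_support) auto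
  also have "\<dots> = ennreal (\<Sum>\<tau>\<in>trajectories nA nO H. pmf (traj_pmf H \<theta> ?u) \<tau> * w ?u \<tau>)"
    by (simp add: ennreal_mult' w mult.commute flip: sum_ennreal)
  also have "\<dots> * ennreal (c ^ length hs) \<le> ennreal c * ennreal (c ^ length hs)"
    by (intro mult_right_mono ennreal_leI bound u) simp
  finally show ?case using c by (simp add: ennreal_mult)
qed simp

text \<open>A supermartingale argument: given the past, the next policy is fixed, and each of its H
  - m + 1 episodes multiplies the mean by at most c. Since c is uniform over policies, adaptivity
  does no harm.\<close>

lemma nn_integral_omle:
  assumes \<theta>: "\<theta> \<in> models nS nA nO H" and nA: "nA > 0"
    and plan: "\<And>D. D \<in> lists (policies nA nO H \<times> trajectories nA nO H) \<Longrightarrow> snd (plan D) \<in> policies nA nO H"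
    and w: "\<And>\<pi> \<tau>. 0 \<le> w \<pi> \<tau>" and c: "c \<ge> 0"
    and bound: "\<And>\<pi>. \<pi> \<in> policies nA nO H \<Longrightarrow> (\<Sum>\<tau>\<in>trajectories nA nO H. pmf (traj_pmf H \<theta> \<pi>) \<tau> * w \<pi> \<tau>) \<le> c"
  shows "(\<integral>\<^sup>+x. ennreal (weight_prod w (snd x)) \<partial>measure_pmf (omle nA H m \<theta> plan k)) \<le> ennreal (c ^ (k * (H - m + 1)))"
proof (induction k)
  case (Suc k)
  note nn = weight_prod_nonneg[of w, OF w]
  let ?n = "H - m + 1"
  have "(\<integral>\<^sup>+x. ennreal (weight_prod w (snd x)) \<partial>measure_pmf (omle nA H m \<theta> plan (Suc k)))
    = (\<integral>\<^sup>+x. ennreal (weight_prod w (snd x)) *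
        (\<integral>\<^sup>+E. ennreal (weight_prod w E) \<partial>measure_pmf (collect_episodes nA H \<theta> (snd (plan (snd x))) [0..<?n]))
      \<partial>measure_pmf (omle nA H m \<theta> plan k))"
    by (simp add: case_prod_unfold ennreal_mult w nn nn_integral_cmult del: upt_Suc)
  also have "\<dots> \<le> (\<integral>\<^sup>+x. ennreal (weight_prod w (snd x)) * ennreal (c ^ ?n) \<partial>measure_pmf (omle nA H m \<theta> plan k))"
  proof (intro nn_integral_mono_AE, subst AE_measure_pmf_iff, intro ballI mult_left_mono)
    fix x assume "x \<in> set_pmf (omle nA H m \<theta> plan k)"
    then have "(fst x, snd x) \<in> set_pmf (omle nA H m \<theta> plan k)" by simp
    from set_omle[OF \<theta> nA plan this] have "valid_data nA nO H \<theta> (snd x)" by blast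
    then have "snd (plan (snd x)) \<in> policies nA nO H" by (intro plan valid_data_lists)
    from nn_integral_collect_episodes[OF \<theta> nA this w c bound, of "[0..<?n]"]
    show "(\<integral>\<^sup>+E. ennreal (weight_prod w E) \<partial>measure_pmf (collect_episodes nA H \<theta> (snd (plan (snd x))) [0..<?n])) \<le> ennreal (c ^ ?n)"
      by (simp del: upt_Suc)
  qed simp
  also have "\<dots> = (\<integral>\<^sup>+x. ennreal (weight_prod w (snd x)) \<partial>measure_pmf (omle nA H m \<theta> plan k)) * ennreal (c ^ ?n)"
    by (rule nn_integral_multc) simp
  also have "\<dots> \<le> ennreal (c ^ (k * ?n)) * ennreal (c ^ ?n)"
    by (intro mult_right_mono Suc.IH) simp
  also have "\<dots> = ennreal (c ^ (Suc k * ?n))"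
  proof -
    obtain n where n: "n = ?n" by blast
    show ?thesis unfolding n[symmetric] using c by (simp add: ennreal_mult[symmetric] power_add mult.commute)
  qed
  finally show ?case .
qed simp

text \<open>Markov's inequality for the product of weights.\<close>

lemma omle_tail_bound:
  assumes \<theta>: "\<theta> \<in> models nS nA nO H" and nA: "nA > 0"
    and plan: "\<And>D. D \<in> lists (policies nA nO H \<times> trajectories nA nO H) \<Longrightarrow> snd (plan D) \<in> policies nA nO H"
    and w: "\<And>\<pi> \<tau>. 0 \<le> w \<pi> \<tau>" and c: "c \<ge> 0"
    and bound: "\<And>\<pi>. \<pi> \<in> policies nA nO H \<Longrightarrow> (\<Sum>\<tau>\<in>trajectories nA nO H. pmf (traj_pmf H \<theta> \<pi>) \<tau> * w \<pi> \<tau>) \<le> c"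
  shows "measure_pmf.prob (omle nA H m \<theta> plan k) {x. exp \<beta> \<le> weight_prod w (snd x)} \<le> c ^ (k * (H - m + 1)) * exp (- \<beta>)"
proof -
  let ?M = "measure_pmf (omle nA H m \<theta> plan k)"
  note nn = weight_prod_nonneg[of w, OF w]
  have "emeasure ?M {x. exp \<beta> \<le> weight_prod w (snd x)} = (\<integral>\<^sup>+x. indicator {x. exp \<beta> \<le> weight_prod w (snd x)} x \<partial>?M)"
    by (simp add: nn_integral_indicator)
  also have "\<dots> \<le> (\<integral>\<^sup>+x. ennreal (weight_prod w (snd x)) * ennreal (exp (- \<beta>)) \<partial>?M)"
  proof (rule nn_integral_mono)
    fix x
    have "1 \<le> weight_prod w (snd x) * exp (- \<beta>)" if "exp \<beta> \<le> weight_prod w (snd x)"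
      using that by (simp add: exp_minus field_simps)
    then show "indicator {x. exp \<beta> \<le> weight_prod w (snd x)} x \<le> ennreal (weight_prod w (snd x)) * ennreal (exp (- \<beta>))"
      using nn by (auto simp: indicator_def ennreal_mult[symmetric] ennreal_1[symmetric] simp del: ennreal_1)
  qed
  also have "\<dots> = (\<integral>\<^sup>+x. ennreal (weight_prod w (snd x)) \<partial>?M) * ennreal (exp (- \<beta>))"
    by (rule nn_integral_multc) simp
  also have "\<dots> \<le> ennreal (c ^ (k * (H - m + 1))) * ennreal (exp (- \<beta>))"
    by (intro mult_right_mono nn_integral_omle[OF \<theta> nA plan w c bound]) auto
  also have "\<dots> = ennreal (c ^ (k * (H - m + 1)) * exp (- \<beta>))" using c by (simp add: ennreal_mult)
  finally show ?thesis using c by (simp add: measure_pmf.emeasure_eq_measure)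
qed

section \<open>Brackets for the likelihood\<close>

definition round_up :: "nat \<Rightarrow> real \<Rightarrow> nat" where
  "round_up N x = nat \<lceil>real N * x\<rceil>"

lemma round_up_bounds:
  assumes "N > 0" "0 \<le> x" "x \<le> 1"
  shows "x \<le> real (round_up N x) / real N" "real (round_up N x) / real N \<le> x + 1 / real N" "round_up N x \<le> N"
proof -
  have "0 \<le> real N * x" using assms by simp
  then have nn: "0 \<le> \<lceil>real N * x\<rceil>" unfolding zero_le_ceiling by linarith
  have r: "real (round_up N x) = of_int \<lceil>real N * x\<rceil>" unfolding round_up_def using nn by simp
  show "x \<le> real (round_up N x) / real N" unfolding r using assms
    by (simp add: pos_le_divide_eq mult.commute le_of_int_ceiling)
  have "of_int \<lceil>real N * x\<rceil> \<le> real N * x + 1" by (rule of_int_ceiling_le_add_one)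
  then show "real (round_up N x) / real N \<le> x + 1 / real N" unfolding r using assms by (simp add: field_simps)
  have "real N * x \<le> real N * 1" using assms by (intro mult_left_mono) auto
  then have "\<lceil>real N * x\<rceil> \<le> int N" unfolding ceiling_le_iff by (simp only: mult_1_right of_int_of_nat_eq)
  then show "round_up N x \<le> N" unfolding round_up_def by (simp only: nat_le_iff)
qed

definition table_lik :: "nat \<Rightarrow> nat \<Rightarrow> nat \<Rightarrow> nat \<Rightarrow> nat \<Rightarrow> (nat \<Rightarrow> nat) \<Rightarrow> (nat \<times> nat \<times> nat \<times> nat \<Rightarrow> nat) \<Rightarrow>
    (nat \<times> nat \<times> nat \<Rightarrow> nat) \<Rightarrow> traj \<Rightarrow> real" where
  "table_lik nS nA nO H N f g e = lik nS (\<lambda>s. if s \<in> {..<nS} then real (f s) / real N else 0)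
     (\<lambda>h a s s'. if (h, a, s, s') \<in> {1..<H} \<times> {..<nA} \<times> {..<nS} \<times> {..<nS} then real (g (h, a, s, s')) / real N else 0)
     (\<lambda>h s ob. if (h, s, ob) \<in> {1..H} \<times> {..<nS} \<times> {..<nO} then real (e (h, s, ob)) / real N else 0)"

text \<open>The likelihood is monotone in all parameters, so rounding them up dominates it. The
  tables are restricted to the index ranges, outside of which a model is arbitrary; this makes the
  family finite.\<close>

definition upper_lik :: "nat \<Rightarrow> nat \<Rightarrow> nat \<Rightarrow> nat \<Rightarrow> nat \<Rightarrow> model \<Rightarrow> traj \<Rightarrow> real" where
  "upper_lik nS nA nO H N \<theta> = table_lik nS nA nO H N
     (\<lambda>s\<in>{..<nS}. round_up N (pmf (initial \<theta>) s))
     (\<lambda>(h, a, s, s')\<in>{1..<H} \<times> {..<nA} \<times> {..<nS} \<times> {..<nS}. round_up N (pmf (transition \<theta> h a s) s'))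
     (\<lambda>(h, s, ob)\<in>{1..H} \<times> {..<nS} \<times> {..<nO}. round_up N (pmf (emission \<theta> h s) ob))"

definition upper_cover :: "nat \<Rightarrow> nat \<Rightarrow> nat \<Rightarrow> nat \<Rightarrow> nat \<Rightarrow> (traj \<Rightarrow> real) set" where
  "upper_cover nS nA nO H N = upper_lik nS nA nO H N ` models nS nA nO H"

text \<open>Each entry takes one of the values 0, ..., N, and the exponent counts the entries of the
  initial distribution, of H - 1 steps of transitions and of H steps of emissions.\<close>

lemma upper_cover_card:
  assumes N: "N > 0"
  shows "finite (upper_cover nS nA nO H N)"
    "card (upper_cover nS nA nO H N) \<le> (N + 1) ^ (nS + (H - 1) * nA * nS\<^sup>2 + H * nS * nO)"
proof -
  define P1 :: "(nat \<Rightarrow> nat) set" where "P1 = PiE {..<nS} (\<lambda>_. {..N})"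
  define P2 where "P2 = PiE ({1..<H} \<times> {..<nA} \<times> {..<nS} \<times> {..<nS}) (\<lambda>_. {..N})"
  define P3 where "P3 = PiE ({1..H} \<times> {..<nS} \<times> {..<nO}) (\<lambda>_. {..N})"
  have fin: "finite P1" "finite P2" "finite P3" unfolding P1_def P2_def P3_def by (auto intro!: finite_PiE)
  have sub: "upper_cover nS nA nO H N \<subseteq> (\<lambda>(f, g, e). table_lik nS nA nO H N f g e) ` (P1 \<times> P2 \<times> P3)"
  proof
    fix w assume "w \<in> upper_cover nS nA nO H N"
    then obtain \<theta> where w: "w = upper_lik nS nA nO H N \<theta>" unfolding upper_cover_def by auto
    note le = round_up_bounds(3)[OF N pmf_nonneg pmf_le_1]
    show "w \<in> (\<lambda>(f, g, e). table_lik nS nA nO H N f g e) ` (P1 \<times> P2 \<times> P3)"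
      unfolding w upper_lik_def P1_def P2_def P3_def
      by (rule image_eqI[where x = "(_, _, _)"], simp only: prod.case, intro SigmaI restrict_PiE_iff[THEN iffD2])
        (auto simp: le)
  qed
  show "finite (upper_cover nS nA nO H N)" by (rule finite_subset[OF sub]) (use fin in auto)
  have "card (upper_cover nS nA nO H N) \<le> card (P1 \<times> P2 \<times> P3)"
    using fin by (intro order_trans[OF card_mono[OF _ sub] card_image_le]) auto
  also have "\<dots> = (N + 1) ^ nS * ((N + 1) ^ ((H - 1) * (nA * (nS * nS))) * (N + 1) ^ (H * (nS * nO)))"
    unfolding P1_def P2_def P3_def card_cartesian_product by (simp add: card_PiE card_cartesian_product)
  also have "\<dots> = (N + 1) ^ (nS + (H - 1) * nA * nS\<^sup>2 + H * nS * nO)"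
    by (simp only: power_add[symmetric] power2_eq_square mult.assoc add.assoc)
  finally show "card (upper_cover nS nA nO H N) \<le> (N + 1) ^ (nS + (H - 1) * nA * nS\<^sup>2 + H * nS * nO)" .
qed

context
  fixes nS nA nO H N :: nat and \<theta> :: model
  assumes N: "N > 0" and \<theta>: "\<theta> \<in> models nS nA nO H" and pos: "nS > 0" "nO > 0" "H > 0"
begin

private definition "mu' = (\<lambda>s. if s \<in> {..<nS} then real (round_up N (pmf (initial \<theta>) s)) / real N else 0)"
private definition "T' = (\<lambda>h a s s'. if (h, a, s, s') \<in> {1..<H} \<times> {..<nA} \<times> {..<nS} \<times> {..<nS}
  then real (round_up N (pmf (transition \<theta> h a s) s')) / real N else 0)"
private definition "E' = (\<lambda>h s ob. if (h, s, ob) \<in> {1..H} \<times> {..<nS} \<times> {..<nO}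
  then real (round_up N (pmf (emission \<theta> h s) ob)) / real N else 0)"

private lemma upper_lik_eq: "upper_lik nS nA nO H N \<theta> = lik nS mu' T' E'"
  unfolding upper_lik_def table_lik_def mu'_def T'_def E'_def
  by (intro arg_cong3[of _ _ _ _ _ _ "lik nS"] ext) auto

private lemma nonneg: "mu' s \<ge> 0" "T' h a s s' \<ge> 0" "E' h s ob \<ge> 0"
  unfolding mu'_def T'_def E'_def by auto

private lemma row_sum:
  assumes "set_pmf p \<subseteq> {..<n}"
  shows "(\<Sum>x<n. real (round_up N (pmf p x)) / real N) \<le> 1 + real n / real N"
proof -
  have "(\<Sum>x<n. real (round_up N (pmf p x)) / real N) \<le> (\<Sum>x<n. pmf p x + 1 / real N)"
    by (intro sum_mono round_up_bounds N pmf_nonneg pmf_le_1)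
  then show ?thesis using sum_pmf_lessThan_eq_1[OF assms] by (simp add: sum.distrib)
qed

lemma upper_lik_nonneg: "0 \<le> upper_lik nS nA nO H N \<theta> \<tau>"
  unfolding upper_lik_eq lik_def by (intro sum_nonneg mult_nonneg_nonneg nonneg fut_nonneg)

lemma upper_lik_ge:
  assumes "\<tau> \<in> trajectories nA nO H"
  shows "model_lik nS \<theta> \<tau> \<le> upper_lik nS nA nO H N \<theta> \<tau>"
  unfolding upper_lik_eq lik_def
proof (intro sum_mono mult_mono nonneg)
  fix s assume s: "s \<in> {..<nS}"
  show "pmf (initial \<theta>) s \<le> mu' s" using s unfolding mu'_def by (auto intro: round_up_bounds(1)[OF N pmf_nonneg pmf_le_1])
  show "model_fut nS \<theta> (Suc 0) s \<tau> \<le> fut nS T' E' (Suc 0) s \<tau>"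
    by (rule fut_mono[OF _ _ _ _ assms, where H = H])
      (use s in \<open>auto simp: T'_def E'_def intro: round_up_bounds(1)[OF N pmf_nonneg pmf_le_1]\<close>)
qed (auto intro: fut_nonneg)

text \<open>Rounding adds at most 1 / N per entry, so row sums are at most 1 + S / N or 1 + O / N.
  The initial factor and H pairs of transition and emission factors give the exponent (S + H (S +
  O)) / N, and S + H S + H O \<le> 3 S O H.\<close>

lemma upper_lik_mass:
  "(\<Sum>\<tau>\<in>trajectories nA nO H. policy_prob \<pi> [] \<tau> * upper_lik nS nA nO H N \<theta> \<tau>)
    \<le> exp (3 * real nS * real nO * real H / real N)"
proof -
  let ?t = "1 + real nS / real N" and ?e = "1 + real nO / real N"
  have te: "?t \<ge> 1" "?e \<ge> 1" by auto
  have "(\<Sum>\<tau>\<in>trajectories nA nO H. policy_prob \<pi> [] \<tau> * upper_lik nS nA nO H N \<theta> \<tau>)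
    = (\<Sum>s<nS. mu' s * (\<Sum>\<tau>\<in>trajectories nA nO H. policy_prob \<pi> [] \<tau> * fut nS T' E' (Suc 0) s \<tau>))"
    unfolding upper_lik_eq lik_def sum_distrib_left
    by (subst sum.swap) (simp add: mult_ac)
  also have "\<dots> \<le> (\<Sum>s<nS. mu' s * (?t * ?e) ^ H)"
  proof (intro sum_mono mult_left_mono nonneg)
    fix s assume s: "s \<in> {..<nS}"
    show "(\<Sum>\<tau>\<in>trajectories nA nO H. policy_prob \<pi> [] \<tau> * fut nS T' E' (Suc 0) s \<tau>) \<le> (?t * ?e) ^ H"
    proof (rule sum_policy_prob_fut_le[OF nonneg(2,3), where H = H])
      fix h a s assume "1 \<le> h" "h < H" "a < nA" "s < nS"
      then show "(\<Sum>s'<nS. T' h a s s') \<le> ?t"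
        using row_sum[OF models_transition[OF \<theta>, of h a s]] by (simp add: T'_def)
    next
      fix h s assume "1 \<le> h" "h \<le> H" "s < nS"
      then show "(\<Sum>ob<nO. E' h s ob) \<le> ?e"
        using row_sum[OF models_emission[OF \<theta>, of h s]] by (simp add: E'_def)
    qed (use s te in auto)
  qed
  also have "\<dots> \<le> ?t * (?t * ?e) ^ H"
    unfolding sum_distrib_right[symmetric] using row_sum[OF models_initial[OF \<theta>]] te
    by (intro mult_right_mono) (auto simp: mu'_def)
  also have "\<dots> \<le> exp (real nS / real N) * (exp (real nS / real N) * exp (real nO / real N)) ^ H"
    using te by (intro mult_mono power_mono exp_ge_add_one_self) auto
  also have "\<dots> = exp (real nS / real N + real H * (real nS / real N + real nO / real N))"
    by (simp add: exp_add exp_of_nat_mult)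
  also have "\<dots> \<le> exp (3 * real nS * real nO * real H / real N)"
  proof -
    have "real nS * 1 * 1 \<le> real nS * real nO * real H" "1 * real nO * real H \<le> real nS * real nO * real H"
      "real nS * 1 * real H \<le> real nS * real nO * real H"
      using pos by (intro mult_mono; simp)+
    then have "real nS + real H * (real nS + real nO) \<le> 3 * real nS * real nO * real H"
      by (simp add: algebra_simps)
    then have "(real nS + real H * (real nS + real nO)) / real N \<le> 3 * real nS * real nO * real H / real N"
      by (rule divide_right_mono) simp
    then show ?thesis by (simp add: add_divide_distrib distrib_left)
  qed
  finally show ?thesis .
qed

end

text \<open>Bhattacharyya coefficient of the law of a trajectory and the upper bracket \<open>w\<close>.\<close>

definition affinity :: "nat \<Rightarrow> nat \<Rightarrow> nat \<Rightarrow> nat \<Rightarrow> model \<Rightarrow> (traj \<Rightarrow> real) \<Rightarrow> policy \<Rightarrow> real" where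
  "affinity nS nA nO H \<theta> w \<pi> = (\<Sum>\<tau>\<in>trajectories nA nO H. policy_prob \<pi> [] \<tau> * sqrt (w \<tau> * model_lik nS \<theta> \<tau>))"

lemma model_lik_nonneg [simp]: "model_lik nS \<theta> \<tau> \<ge> 0"
  unfolding lik_def by (intro sum_nonneg mult_nonneg_nonneg fut_nonneg) auto

text \<open>Only an inequality, since trajectories impossible under \<theta> contribute 0 on the
  left but may have positive w.\<close>

lemma likelihood_ratio_mean:
  assumes \<theta>: "\<theta> \<in> models nS nA nO H" and w: "\<And>\<tau>. 0 \<le> w \<tau>"
  shows "(\<Sum>\<tau>\<in>trajectories nA nO H. pmf (traj_pmf H \<theta> \<pi>) \<tau> * (w \<tau> / model_lik nS \<theta> \<tau>))
    \<le> (\<Sum>\<tau>\<in>trajectories nA nO H. policy_prob \<pi> [] \<tau> * w \<tau>)"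
proof (rule sum_mono)
  fix \<tau> assume "\<tau> \<in> trajectories nA nO H"
  then show "pmf (traj_pmf H \<theta> \<pi>) \<tau> * (w \<tau> / model_lik nS \<theta> \<tau>) \<le> policy_prob \<pi> [] \<tau> * w \<tau>"
    using w by (simp add: pmf_traj_pmf[OF \<theta>])
qed

text \<open>The factor \<open>exp (1 - \<rho>)\<close> replaces \<open>1 / \<rho>\<close>, since \<open>\<rho> exp (1 - \<rho>) \<le> 1\<close>.\<close>

lemma root_likelihood_ratio_mean:
  assumes \<theta>: "\<theta> \<in> models nS nA nO H" and w: "\<And>\<tau>. 0 \<le> w \<tau>"
  shows "(\<Sum>\<tau>\<in>trajectories nA nO H. pmf (traj_pmf H \<theta> \<pi>) \<tau> *
    (sqrt (w \<tau> / model_lik nS \<theta> \<tau>) * exp (1 - affinity nS nA nO H \<theta> w \<pi>))) \<le> 1"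
proof -
  let ?r = "affinity nS nA nO H \<theta> w \<pi>"
  have "pmf (traj_pmf H \<theta> \<pi>) \<tau> * sqrt (w \<tau> / model_lik nS \<theta> \<tau>) = policy_prob \<pi> [] \<tau> * sqrt (w \<tau> * model_lik nS \<theta> \<tau>)"
    if "\<tau> \<in> trajectories nA nO H" for \<tau>
  proof -
    have "model_lik nS \<theta> \<tau> * sqrt (w \<tau> / model_lik nS \<theta> \<tau>) = sqrt (w \<tau> * model_lik nS \<theta> \<tau>)"
    proof -
      have "model_lik nS \<theta> \<tau> * sqrt (w \<tau> / model_lik nS \<theta> \<tau>) = sqrt (w \<tau>) * (model_lik nS \<theta> \<tau> / sqrt (model_lik nS \<theta> \<tau>))"
        by (simp add: real_sqrt_divide)
      then show ?thesis by (simp only: real_div_sqrt model_lik_nonneg real_sqrt_mult)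
    qed
    then show ?thesis by (simp add: pmf_traj_pmf[OF \<theta> that] mult.assoc)
  qed
  then have "(\<Sum>\<tau>\<in>trajectories nA nO H. pmf (traj_pmf H \<theta> \<pi>) \<tau> *
    (sqrt (w \<tau> / model_lik nS \<theta> \<tau>) * exp (1 - ?r))) = ?r * exp (1 - ?r)"
    unfolding affinity_def sum_distrib_right by (intro sum.cong refl) (simp flip: mult.assoc)
  also have "\<dots> \<le> exp (?r - 1) * exp (1 - ?r)"
    using exp_ge_add_one_self[of "?r - 1"] by (intro mult_right_mono) auto
  also have "\<dots> = 1" by (simp flip: exp_add)
  finally show ?thesis .
qed

text \<open>Cauchy--Schwarz for \<open>|w - L| = |\<surd>w - \<surd>L| (\<surd>w + \<surd>L)\<close>.\<close>

lemma traj_dist_affinity: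
  assumes \<theta>: "\<theta> \<in> models nS nA nO H" and \<theta>': "\<theta>' \<in> models nS nA nO H" and \<pi>: "\<pi> \<in> policies nA nO H"
    and w: "\<And>\<tau>. 0 \<le> w \<tau>" and ge: "\<And>\<tau>. \<tau> \<in> trajectories nA nO H \<Longrightarrow> model_lik nS \<theta>' \<tau> \<le> w \<tau>"
    and mass: "(\<Sum>\<tau>\<in>trajectories nA nO H. policy_prob \<pi> [] \<tau> * w \<tau>) \<le> 1 + \<eta>" and \<eta>: "\<eta> \<le> 1"
  shows "(traj_dist nS nA nO H \<theta> \<theta>' \<pi>)\<^sup>2 \<le> 24 * (1 - affinity nS nA nO H \<theta> w \<pi>) + 14 * \<eta>"
proof -
  let ?X = "trajectories nA nO H" and ?L = "model_lik nS \<theta>" and ?L' = "model_lik nS \<theta>'" and ?p = "policy_prob \<pi> []"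
  define a where "a = (\<Sum>\<tau>\<in>?X. ?p \<tau> * w \<tau>)"
  define r where "r = affinity nS nA nO H \<theta> w \<pi>"
  interpret hmm nS nA nO H "pmf (initial \<theta>)" "\<lambda>h a s. pmf (transition \<theta> h a s)" "\<lambda>h s. pmf (emission \<theta> h s)"
    by (rule hmm_model[OF \<theta>])
  interpret hat: hmm nS nA nO H "pmf (initial \<theta>')" "\<lambda>h a s. pmf (transition \<theta>' h a s)" "\<lambda>h s. pmf (emission \<theta>' h s)"
    by (rule hmm_model[OF \<theta>'])
  have one: "(\<Sum>\<tau>\<in>?X. ?p \<tau> * ?L \<tau>) = 1" "(\<Sum>\<tau>\<in>?X. ?p \<tau> * ?L' \<tau>) = 1"
    using sum_policy_prob_L[OF \<pi>, of H] hat.sum_policy_prob_L[OF \<pi>, of H] by auto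
  have a1: "a \<ge> 1" unfolding a_def one(2)[symmetric] by (intro sum_mono mult_left_mono ge) auto
  define d1 where "d1 = (\<Sum>\<tau>\<in>?X. ?p \<tau> * \<bar>?L \<tau> - w \<tau>\<bar>)"
  \<comment> \<open>Triangle inequality through w; the second part is the excess mass a - 1, because
    w dominates the likelihood of \<open>\<theta>'\<close>.\<close>
  have "traj_dist nS nA nO H \<theta> \<theta>' \<pi> \<le> (\<Sum>\<tau>\<in>?X. ?p \<tau> * (\<bar>?L \<tau> - w \<tau>\<bar> + (w \<tau> - ?L' \<tau>)))"
    unfolding traj_dist_def
  proof (intro sum_mono mult_left_mono)
    fix \<tau> assume "\<tau> \<in> ?X"
    then show "\<bar>?L \<tau> - ?L' \<tau>\<bar> \<le> \<bar>?L \<tau> - w \<tau>\<bar> + (w \<tau> - ?L' \<tau>)" using ge[of \<tau>] by linarith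
  qed auto
  also have "\<dots> = d1 + (a - 1)"
    unfolding d1_def a_def by (simp add: distrib_left right_diff_distrib sum.distrib sum_subtractf one)
  finally have td: "traj_dist nS nA nO H \<theta> \<theta>' \<pi> \<le> d1 + (a - 1)" .
  have "d1 = (\<Sum>\<tau>\<in>?X. (sqrt (?p \<tau>) * \<bar>sqrt (?L \<tau>) - sqrt (w \<tau>)\<bar>) * (sqrt (?p \<tau>) * (sqrt (?L \<tau>) + sqrt (w \<tau>))))"
    unfolding d1_def
  proof (intro sum.cong refl)
    fix \<tau>
    have "?L \<tau> - w \<tau> = (sqrt (?L \<tau>) - sqrt (w \<tau>)) * (sqrt (?L \<tau>) + sqrt (w \<tau>))"
      using w[of \<tau>] by (simp add: algebra_simps)
    then have "\<bar>?L \<tau> - w \<tau>\<bar> = \<bar>sqrt (?L \<tau>) - sqrt (w \<tau>)\<bar> * (sqrt (?L \<tau>) + sqrt (w \<tau>))"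
      using w[of \<tau>] by (simp add: abs_mult)
    then have "?p \<tau> * \<bar>?L \<tau> - w \<tau>\<bar> = (sqrt (?p \<tau>) * sqrt (?p \<tau>)) * (\<bar>sqrt (?L \<tau>) - sqrt (w \<tau>)\<bar> * (sqrt (?L \<tau>) + sqrt (w \<tau>)))"
      by simp
    then show "?p \<tau> * \<bar>?L \<tau> - w \<tau>\<bar> = (sqrt (?p \<tau>) * \<bar>sqrt (?L \<tau>) - sqrt (w \<tau>)\<bar>) * (sqrt (?p \<tau>) * (sqrt (?L \<tau>) + sqrt (w \<tau>)))"
      by (simp only: mult_ac)
  qed
  then have CS: "d1\<^sup>2 \<le> (\<Sum>\<tau>\<in>?X. (sqrt (?p \<tau>) * \<bar>sqrt (?L \<tau>) - sqrt (w \<tau>)\<bar>)\<^sup>2) * (\<Sum>\<tau>\<in>?X. (sqrt (?p \<tau>) * (sqrt (?L \<tau>) + sqrt (w \<tau>)))\<^sup>2)"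
    by (simp only: Cauchy_Schwarz_ineq_sum)
  have A: "(\<Sum>\<tau>\<in>?X. (sqrt (?p \<tau>) * \<bar>sqrt (?L \<tau>) - sqrt (w \<tau>)\<bar>)\<^sup>2) = 1 + a - 2 * r"
  proof -
    have "(\<Sum>\<tau>\<in>?X. (sqrt (?p \<tau>) * \<bar>sqrt (?L \<tau>) - sqrt (w \<tau>)\<bar>)\<^sup>2)
      = (\<Sum>\<tau>\<in>?X. ?p \<tau> * ?L \<tau> + ?p \<tau> * w \<tau> - 2 * (?p \<tau> * sqrt (w \<tau> * ?L \<tau>)))"
      using w by (intro sum.cong refl) (simp add: power_mult_distrib power2_diff real_sqrt_mult algebra_simps)
    then show ?thesis unfolding a_def r_def affinity_def by (simp add: sum.distrib sum_subtractf one sum_distrib_left)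
  qed
  have A2: "(\<Sum>\<tau>\<in>?X. (sqrt (?p \<tau>) * (sqrt (?L \<tau>) + sqrt (w \<tau>)))\<^sup>2) \<le> 2 + 2 * a"
  proof -
    have "(\<Sum>\<tau>\<in>?X. (sqrt (?p \<tau>) * (sqrt (?L \<tau>) + sqrt (w \<tau>)))\<^sup>2) \<le> (\<Sum>\<tau>\<in>?X. 2 * (?p \<tau> * ?L \<tau>) + 2 * (?p \<tau> * w \<tau>))"
    proof (rule sum_mono)
      fix \<tau>
      have "(sqrt (?L \<tau>) + sqrt (w \<tau>))\<^sup>2 \<le> 2 * ?L \<tau> + 2 * w \<tau>"
        using sum_squares_bound[of "sqrt (?L \<tau>)" "sqrt (w \<tau>)"] w[of \<tau>] by (simp add: power2_sum)
      then have "?p \<tau> * (sqrt (?L \<tau>) + sqrt (w \<tau>))\<^sup>2 \<le> ?p \<tau> * (2 * ?L \<tau> + 2 * w \<tau>)" by (rule mult_left_mono) simp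
      then show "(sqrt (?p \<tau>) * (sqrt (?L \<tau>) + sqrt (w \<tau>)))\<^sup>2 \<le> 2 * (?p \<tau> * ?L \<tau>) + 2 * (?p \<tau> * w \<tau>)"
      proof -
        have "(sqrt (?p \<tau>) * (sqrt (?L \<tau>) + sqrt (w \<tau>)))\<^sup>2 = ?p \<tau> * (sqrt (?L \<tau>) + sqrt (w \<tau>))\<^sup>2"
          by (simp add: power_mult_distrib)
        moreover have "?p \<tau> * (2 * ?L \<tau> + 2 * w \<tau>) = 2 * (?p \<tau> * ?L \<tau>) + 2 * (?p \<tau> * w \<tau>)"
          by (simp add: algebra_simps)
        ultimately show ?thesis using \<open>?p \<tau> * (sqrt (?L \<tau>) + sqrt (w \<tau>))\<^sup>2 \<le> ?p \<tau> * (2 * ?L \<tau> + 2 * w \<tau>)\<close> by linarith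
      qed
    qed
    then show ?thesis by (simp add: sum.distrib one a_def flip: sum_distrib_left)
  qed
  have nn: "1 + a - 2 * r \<ge> 0" unfolding A[symmetric] by (intro sum_nonneg) auto
  have d1: "d1\<^sup>2 \<le> (1 + a - 2 * r) * (2 + 2 * a)"
    using CS[unfolded A] mult_left_mono[OF A2 nn] by linarith
  have a2: "a \<le> 1 + \<eta>" unfolding a_def by (rule mass)
  have "(traj_dist nS nA nO H \<theta> \<theta>' \<pi>)\<^sup>2 \<le> (d1 + (a - 1))\<^sup>2"
    by (rule power_mono[OF td traj_dist_nonneg])
  also have "\<dots> \<le> 2 * d1\<^sup>2 + 2 * (a - 1)\<^sup>2"
    using sum_squares_bound[of d1 "a - 1"] by (simp add: power2_sum)
  also have "\<dots> \<le> 2 * ((1 + a - 2 * r) * (2 + 2 * a)) + 2 * \<eta>"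
  proof -
    have "(a - 1)\<^sup>2 \<le> \<eta> * 1" unfolding power2_eq_square using a1 a2 \<eta> by (intro mult_mono) auto
    then show ?thesis using d1 by linarith
  qed
  \<comment> \<open>a \<le> 1 + \<eta> \<le> 2 gives 2 + 2 a \<le> 6. Then 12 (1 + a - 2 r) \<le> 24
    (1 - r) + 12 \<eta>, which together with 2 \<eta> explains 24 and 14.\<close>
  also have "\<dots> \<le> 2 * ((1 + a - 2 * r) * 6) + 2 * \<eta>"
    using nn a2 \<eta> by (intro add_right_mono mult_left_mono) auto
  also have "\<dots> \<le> 24 * (1 - r) + 14 * \<eta>" using a2 by simp
  finally show ?thesis unfolding r_def .
qed

section \<open>Confidence sets and regret\<close>

abbreviation likelihood_ratio :: "nat \<Rightarrow> model \<Rightarrow> (traj \<Rightarrow> real) \<Rightarrow> policy \<Rightarrow> traj \<Rightarrow> real" where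
  "likelihood_ratio nS \<theta> w \<pi> \<tau> \<equiv> w \<tau> / model_lik nS \<theta> \<tau>"

abbreviation root_likelihood_ratio :: "nat \<Rightarrow> nat \<Rightarrow> nat \<Rightarrow> nat \<Rightarrow> model \<Rightarrow> (traj \<Rightarrow> real) \<Rightarrow> policy \<Rightarrow> traj \<Rightarrow> real" where
  "root_likelihood_ratio nS nA nO H \<theta> w \<pi> \<tau> \<equiv>
     sqrt (w \<tau> / model_lik nS \<theta> \<tau>) * exp (1 - affinity nS nA nO H \<theta> w \<pi>)"

text \<open>On valid data the true likelihood is positive, so multiplying it by the ratio gives back
  w, which dominates the other model; the policy factors are common to both sides.\<close>

lemma weight_prod_model_le:
  assumes \<theta>: "\<theta> \<in> models nS nA nO H" and \<theta>': "\<theta>' \<in> models nS nA nO H" and D: "valid_data nA nO H \<theta> D"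
    and ge: "\<And>\<tau>. \<tau> \<in> trajectories nA nO H \<Longrightarrow> model_lik nS \<theta>' \<tau> \<le> w \<tau>"
  shows "weight_prod (\<lambda>\<pi>. pmf (traj_pmf H \<theta>' \<pi>)) D
    \<le> weight_prod (\<lambda>\<pi>. pmf (traj_pmf H \<theta> \<pi>)) D * weight_prod (likelihood_ratio nS \<theta> w) D"
  unfolding weight_prod_mult[symmetric]
proof (rule conjunct2[OF weight_prod_mono])
  fix \<pi> \<tau> assume "(\<pi>, \<tau>) \<in> set D"
  then have \<tau>: "\<tau> \<in> trajectories nA nO H" "pmf (traj_pmf H \<theta> \<pi>) \<tau> > 0" using D by (auto simp: valid_data_def)
  then have "model_lik nS \<theta> \<tau> \<noteq> 0" by (auto simp: pmf_traj_pmf[OF \<theta>])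
  then show "0 \<le> pmf (traj_pmf H \<theta>' \<pi>) \<tau> \<and>
    pmf (traj_pmf H \<theta>' \<pi>) \<tau> \<le> pmf (traj_pmf H \<theta> \<pi>) \<tau> * likelihood_ratio nS \<theta> w \<pi> \<tau>"
    using ge \<tau> by (simp add: pmf_traj_pmf[OF \<theta>] pmf_traj_pmf[OF \<theta>'] mult_left_mono)
qed

lemma weight_prod_true_pos: "valid_data nA nO H \<theta> D \<Longrightarrow> weight_prod (\<lambda>\<pi>. pmf (traj_pmf H \<theta> \<pi>)) D > 0"
  by (rule weight_prod_pos) (auto simp: valid_data_def)

lemma true_model_in_confidence_set:
  assumes \<theta>: "\<theta> \<in> initial_confidence_set nS nA nO H m \<alpha>" and D: "valid_data nA nO H \<theta> D"
    and ratio: "\<And>\<theta>'. \<theta>' \<in> models nS nA nO H \<Longrightarrow>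
      weight_prod (\<lambda>\<pi>. pmf (traj_pmf H \<theta>' \<pi>)) D \<le> weight_prod (\<lambda>\<pi>. pmf (traj_pmf H \<theta> \<pi>)) D * exp \<beta>"
  shows "\<theta> \<in> confidence_set nS nA nO H m \<alpha> \<beta> D"
proof -
  define q where "q = weight_prod (\<lambda>\<pi>. pmf (traj_pmf H \<theta> \<pi>)) D"
  have q: "q > 0" unfolding q_def by (rule weight_prod_true_pos[OF D])
  have \<theta>m: "\<theta> \<in> models nS nA nO H" using \<theta> by (simp add: initial_confidence_set_def)
  have "(SUP \<theta>'\<in>models nS nA nO H. log_likelihood H D \<theta>') \<le> ereal (ln q + \<beta>)"
  proof (rule SUP_least)
    fix \<theta>' assume \<theta>': "\<theta>' \<in> models nS nA nO H"
    define p where "p = weight_prod (\<lambda>\<pi>. pmf (traj_pmf H \<theta>' \<pi>)) D"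
    have "ln p \<le> ln q + \<beta>" if "p > 0"
    proof -
      have "ln p \<le> ln (q * exp \<beta>)" using ratio[OF \<theta>'] that q unfolding p_def q_def by (subst ln_le_cancel_iff) auto
      then show ?thesis using q by (simp add: ln_mult)
    qed
    then show "log_likelihood H D \<theta>' \<le> ereal (ln q + \<beta>)"
      unfolding log_likelihood_eq p_def[symmetric] extended_ln_def by auto
  qed
  then have "(SUP \<theta>'\<in>models nS nA nO H. log_likelihood H D \<theta>') - ereal \<beta> \<le> ereal (ln q + \<beta>) - ereal \<beta>"
    by (rule ereal_minus_mono) simp
  also have "\<dots> = log_likelihood H D \<theta>" unfolding log_likelihood_eq q_def[symmetric] extended_ln_def using q by simp
  finally show ?thesis using \<theta> \<theta>m unfolding confidence_set_def by simp
qed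

text \<open>The supremum in the confidence set is at least the value at the true model, whose
  likelihood is positive on valid data; this also excludes the value - \<infinity> for
  \<open>\<theta>'\<close>.\<close>

lemma confidence_set_likelihood:
  assumes \<theta>: "\<theta> \<in> models nS nA nO H" and D: "valid_data nA nO H \<theta> D"
    and \<theta>': "\<theta>' \<in> confidence_set nS nA nO H m \<alpha> \<beta> D"
  shows "weight_prod (\<lambda>\<pi>. pmf (traj_pmf H \<theta> \<pi>)) D * exp (- \<beta>) \<le> weight_prod (\<lambda>\<pi>. pmf (traj_pmf H \<theta>' \<pi>)) D"
proof -
  define q where "q = weight_prod (\<lambda>\<pi>. pmf (traj_pmf H \<theta> \<pi>)) D"
  define p where "p = weight_prod (\<lambda>\<pi>. pmf (traj_pmf H \<theta>' \<pi>)) D"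
  have q: "q > 0" unfolding q_def by (rule weight_prod_true_pos[OF D])
  have "ereal (ln q - \<beta>) = log_likelihood H D \<theta> - ereal \<beta>"
    unfolding log_likelihood_eq q_def[symmetric] extended_ln_def using q by simp
  also have "\<dots> \<le> (SUP \<theta>'\<in>models nS nA nO H. log_likelihood H D \<theta>') - ereal \<beta>"
    by (intro ereal_minus_mono SUP_upper \<theta>) simp
  also have "\<dots> \<le> log_likelihood H D \<theta>'" using \<theta>' by (simp add: confidence_set_def)
  also have "\<dots> = extended_ln p" unfolding log_likelihood_eq p_def ..
  finally have p: "p > 0" "ln q - \<beta> \<le> ln p" by (auto simp: extended_ln_def split: if_splits)
  have "q * exp (- \<beta>) = exp (ln q - \<beta>)" using q by (simp add: exp_diff exp_minus field_simps)
  also have "\<dots> \<le> exp (ln p)" using p(2) by (simp only: exp_le_cancel_iff)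
  finally show ?thesis using p unfolding p_def q_def by simp
qed

section \<open>Values and rewards\<close>

lemma policy_value_eq:
  assumes \<theta>: "\<theta> \<in> models nS nA nO H" and \<pi>: "\<pi> \<in> policies nA nO H"
  shows "policy_value H r \<theta> \<pi> = (\<Sum>\<tau>\<in>trajectories nA nO H. policy_prob \<pi> [] \<tau> * model_lik nS \<theta> \<tau> * (\<Sum>h=1..H. r h (fst (\<tau> ! (h - 1)))))"
proof -
  have "policy_value H r \<theta> \<pi> = (\<Sum>\<tau>\<in>trajectories nA nO H. pmf (traj_pmf H \<theta> \<pi>) \<tau> *\<^sub>R (\<Sum>h=1..H. r h (fst (\<tau> ! (h - 1)))))"
    unfolding policy_value_def using set_pmf_traj_pmf[OF \<theta> \<pi>] by (intro integral_measure_pmf) auto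
  then show ?thesis by (simp add: pmf_traj_pmf[OF \<theta>] cong: sum.cong)
qed

context
  fixes nA nO H :: nat and r :: "nat \<Rightarrow> nat \<Rightarrow> real"
  assumes r: "\<forall>h\<in>{1..H}. \<forall>ob<nO. 0 \<le> r h ob \<and> r h ob \<le> 1"
begin

lemma total_reward_bounds:
  assumes "\<tau> \<in> trajectories nA nO H"
  shows "0 \<le> (\<Sum>h=1..H. r h (fst (\<tau> ! (h - 1))))" "(\<Sum>h=1..H. r h (fst (\<tau> ! (h - 1)))) \<le> real H"
proof -
  have *: "0 \<le> r h (fst (\<tau> ! (h - 1))) \<and> r h (fst (\<tau> ! (h - 1))) \<le> 1" if h: "h \<in> {1..H}" for h
  proof -
    have "\<tau> ! (h - 1) \<in> set \<tau>" using assms h by (intro nth_mem) (auto simp: trajectories_def)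
    then have "fst (\<tau> ! (h - 1)) < nO" using assms by (auto simp: trajectories_def)
    then show ?thesis using r h by blast
  qed
  show "0 \<le> (\<Sum>h=1..H. r h (fst (\<tau> ! (h - 1))))" using * by (intro sum_nonneg) auto
  have "(\<Sum>h=1..H. r h (fst (\<tau> ! (h - 1)))) \<le> (\<Sum>h=1..H. 1)" using * by (intro sum_mono) auto
  then show "(\<Sum>h=1..H. r h (fst (\<tau> ! (h - 1)))) \<le> real H" by simp
qed

lemma policy_value_bounds:
  assumes \<theta>: "\<theta> \<in> models nS nA nO H" and \<pi>: "\<pi> \<in> policies nA nO H"
  shows "0 \<le> policy_value H r \<theta> \<pi>" "policy_value H r \<theta> \<pi> \<le> real H"
proof -
  interpret hmm nS nA nO H "pmf (initial \<theta>)" "\<lambda>h a s. pmf (transition \<theta> h a s)" "\<lambda>h s. pmf (emission \<theta> h s)"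
    by (rule hmm_model[OF \<theta>])
  show "0 \<le> policy_value H r \<theta> \<pi>" unfolding policy_value_eq[OF \<theta> \<pi>]
    by (rule sum_nonneg, rule mult_nonneg_nonneg, simp, rule total_reward_bounds(1))
  have "policy_value H r \<theta> \<pi> \<le> (\<Sum>\<tau>\<in>trajectories nA nO H. policy_prob \<pi> [] \<tau> * model_lik nS \<theta> \<tau> * real H)"
    unfolding policy_value_eq[OF \<theta> \<pi>] using total_reward_bounds by (intro sum_mono mult_left_mono) auto
  then show "policy_value H r \<theta> \<pi> \<le> real H"
    using sum_policy_prob_L[OF \<pi>, of H] by (simp flip: sum_distrib_right)
qed

lemma policy_value_diff:
  assumes \<theta>: "\<theta> \<in> models nS nA nO H" and \<theta>': "\<theta>' \<in> models nS nA nO H" and \<pi>: "\<pi> \<in> policies nA nO H"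
  shows "policy_value H r \<theta>' \<pi> - policy_value H r \<theta> \<pi> \<le> real H * traj_dist nS nA nO H \<theta> \<theta>' \<pi>"
proof -
  let ?R = "\<lambda>\<tau>. \<Sum>h=1..H. r h (fst (\<tau> ! (h - 1)))"
  have "policy_value H r \<theta>' \<pi> - policy_value H r \<theta> \<pi>
    = (\<Sum>\<tau>\<in>trajectories nA nO H. policy_prob \<pi> [] \<tau> * ((model_lik nS \<theta>' \<tau> - model_lik nS \<theta> \<tau>) * ?R \<tau>))"
    unfolding policy_value_eq[OF \<theta> \<pi>] policy_value_eq[OF \<theta>' \<pi>] sum_subtractf[symmetric]
    by (intro sum.cong refl) (simp add: algebra_simps)
  also have "\<dots> \<le> (\<Sum>\<tau>\<in>trajectories nA nO H. policy_prob \<pi> [] \<tau> * (\<bar>model_lik nS \<theta> \<tau> - model_lik nS \<theta>' \<tau>\<bar> * real H))"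
  proof (intro sum_mono mult_left_mono)
    fix \<tau> assume \<tau>: "\<tau> \<in> trajectories nA nO H"
    have "(model_lik nS \<theta>' \<tau> - model_lik nS \<theta> \<tau>) * ?R \<tau> \<le> \<bar>model_lik nS \<theta> \<tau> - model_lik nS \<theta>' \<tau>\<bar> * ?R \<tau>"
      using total_reward_bounds[OF \<tau>] by (intro mult_right_mono) auto
    also have "\<dots> \<le> \<bar>model_lik nS \<theta> \<tau> - model_lik nS \<theta>' \<tau>\<bar> * real H"
      using total_reward_bounds[OF \<tau>] by (intro mult_left_mono) auto
    finally show "(model_lik nS \<theta>' \<tau> - model_lik nS \<theta> \<tau>) * ?R \<tau> \<le> \<bar>model_lik nS \<theta> \<tau> - model_lik nS \<theta>' \<tau>\<bar> * real H" .
  qed auto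
  also have "\<dots> = real H * traj_dist nS nA nO H \<theta> \<theta>' \<pi>"
    unfolding traj_dist_def by (simp add: sum_distrib_left mult_ac)
  finally show ?thesis .
qed

end

lemma policies_nonempty: "nA > 0 \<Longrightarrow> policies nA nO H \<noteq> {}"
proof -
  assume "nA > 0"
  then have "(\<lambda>_ _. return_pmf 0) \<in> policies nA nO H" by (auto simp: policies_def)
  then show ?thesis by blast
qed

text \<open>Of the n data policies of each iteration, only the one that turns uniform after step j
  is kept.\<close>

lemma sum_list_uniform_le:
  assumes "\<And>\<pi>. 0 \<le> f \<pi>" "j < n"
  shows "(\<Sum>\<pi>\<leftarrow>\<pi>s. f (uniform_after nA j \<pi>)) \<le> (\<Sum>\<pi>\<leftarrow>concat (map (\<lambda>\<pi>. map (\<lambda>h. uniform_after nA h \<pi>) [0..<n]) \<pi>s). f \<pi> :: real)"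
proof (induction \<pi>s)
  case (Cons \<pi> \<pi>s)
  have "f (uniform_after nA j \<pi>) \<le> (\<Sum>h\<leftarrow>[0..<n]. f (uniform_after nA h \<pi>))"
    using assms by (intro member_le_sum_list) auto
  then show ?case using Cons by (simp add: o_def del: upt_Suc)
qed simp

section \<open>The good event and the regret on it\<close>

text \<open>Union bound over K prefixes of the data and all brackets. For each, the plain ratio is
  too large with probability at most 3 exp (- \<beta>) and the root ratio with at most exp (-
  \<beta>), whence the 4.\<close>

lemma omle_deviation:
  assumes \<theta>: "\<theta> \<in> models nS nA nO H" and pos: "nS > 0" "nA > 0" "nO > 0" "H > 0" and m: "1 \<le> m" "m \<le> H"
    and plan: "\<And>D. D \<in> lists (policies nA nO H \<times> trajectories nA nO H) \<Longrightarrow> snd (plan D) \<in> policies nA nO H"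
    and N: "4 * nS * nO * H\<^sup>2 * K \<le> N" "N > 0"
  shows "measure_pmf.prob (omle nA H m \<theta> plan K)
    {x. \<exists>k<K. \<exists>w\<in>upper_cover nS nA nO H N.
       exp \<beta> \<le> weight_prod (likelihood_ratio nS \<theta> w) (take (k * (H - m + 1)) (snd x)) \<or>
       exp \<beta> \<le> weight_prod (root_likelihood_ratio nS nA nO H \<theta> w) (take (k * (H - m + 1)) (snd x))}
    \<le> 4 * real K * real (card (upper_cover nS nA nO H N)) * exp (- \<beta>)"
proof -
  let ?C = "upper_cover nS nA nO H N"
  define n where "n = H - m + 1"
  let ?M = "measure_pmf (omle nA H m \<theta> plan K)"
  define A where "A f k = {x :: policy list \<times> dataset. exp \<beta> \<le> weight_prod f (take (k * n) (snd x))}" for f k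
  note fin = upper_cover_card(1)[OF N(2), of nS nA nO H]
  have w0: "0 \<le> w \<tau>" if w: "w \<in> ?C" for w \<tau>
    using w upper_lik_nonneg[OF N(2) _ pos(1,3,4)] unfolding upper_cover_def by auto
  have prefix: "measure_pmf.prob (omle nA H m \<theta> plan K) (A f k)
      = measure_pmf.prob (omle nA H m \<theta> plan k) {x. exp \<beta> \<le> weight_prod f (snd x)}" if "k < K" for f k
  proof -
    have "omle nA H m \<theta> plan k = map_pmf (\<lambda>(\<pi>s, D). (take k \<pi>s, take (k * n) D)) (omle nA H m \<theta> plan K)"
      unfolding n_def using omle_prefix[where plan = plan, OF \<theta> pos(2) plan, of k K m] that by simp
    then show ?thesis by (simp add: A_def vimage_def case_prod_unfold)
  qed
  have first: "measure ?M (A (likelihood_ratio nS \<theta> w) k) \<le> 3 * exp (- \<beta>)" if k: "k < K" and w: "w \<in> ?C" for k w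
  proof -
    obtain \<theta>' where \<theta>': "\<theta>' \<in> models nS nA nO H" "w = upper_lik nS nA nO H N \<theta>'" using w unfolding upper_cover_def by auto
    define c where "c = exp (3 * real nS * real nO * real H / real N)"
    have "measure_pmf.prob (omle nA H m \<theta> plan k) {x. exp \<beta> \<le> weight_prod (likelihood_ratio nS \<theta> w) (snd x)} \<le> c ^ (k * n) * exp (- \<beta>)"
      unfolding n_def
    proof (rule omle_tail_bound[where plan = plan, OF \<theta> pos(2) plan])
      fix \<pi>
      have "(\<Sum>\<tau>\<in>trajectories nA nO H. policy_prob \<pi> [] \<tau> * w \<tau>) \<le> c"
        unfolding c_def \<theta>'(2) by (rule upper_lik_mass[OF N(2) \<theta>'(1) pos(1,3,4)])
      then show "(\<Sum>\<tau>\<in>trajectories nA nO H. pmf (traj_pmf H \<theta> \<pi>) \<tau> * likelihood_ratio nS \<theta> w \<pi> \<tau>) \<le> c"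
        by (rule order_trans[OF likelihood_ratio_mean[OF \<theta> w0[OF w]]])
    qed (use w0[OF w] in \<open>auto simp: c_def\<close>)
    \<comment> \<open>The excess mass of a bracket accumulates over at most K H episodes; the lower
      bound on N keeps the total exponent below 1, and e \<le> 3.\<close>
    also have "c ^ (k * n) \<le> 3"
    proof -
      have "real (k * n) * (3 * real nS * real nO * real H) \<le> real (K * H) * (3 * real nS * real nO * real H)"
        using k m unfolding n_def by (intro mult_right_mono of_nat_mono mult_le_mono) auto
      also have "\<dots> = 3 / 4 * real (4 * nS * nO * H\<^sup>2 * K)" by (simp add: power2_eq_square)
      also have "\<dots> \<le> 1 * real N" using N(1) by (intro mult_mono of_nat_mono) auto
      finally have "real (k * n) * (3 * real nS * real nO * real H / real N) \<le> 1" using N(2) by (simp add: field_simps)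
      then have "exp (real (k * n) * (3 * real nS * real nO * real H / real N)) \<le> exp 1" by simp
      then show ?thesis unfolding c_def exp_of_nat_mult[symmetric] using exp_le by linarith
    qed
    finally show ?thesis using prefix[OF k] by simp
  qed
  have second: "measure ?M (A (root_likelihood_ratio nS nA nO H \<theta> w) k) \<le> exp (- \<beta>)" if k: "k < K" and w: "w \<in> ?C" for k w
  proof -
    have "measure_pmf.prob (omle nA H m \<theta> plan k) {x. exp \<beta> \<le> weight_prod (root_likelihood_ratio nS nA nO H \<theta> w) (snd x)}
      \<le> 1 ^ (k * (H - m + 1)) * exp (- \<beta>)"
      by (rule omle_tail_bound[where plan = plan, OF \<theta> pos(2) plan])
        (use w0[OF w] root_likelihood_ratio_mean[OF \<theta>, of w] in auto)
    then show ?thesis using prefix[OF k] by simp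
  qed
  have "measure ?M {x. \<exists>k<K. \<exists>w\<in>?C.
       exp \<beta> \<le> weight_prod (likelihood_ratio nS \<theta> w) (take (k * n) (snd x)) \<or>
       exp \<beta> \<le> weight_prod (root_likelihood_ratio nS nA nO H \<theta> w) (take (k * n) (snd x))}
    \<le> measure ?M (\<Union>(k, w)\<in>{..<K} \<times> ?C. A (likelihood_ratio nS \<theta> w) k \<union> A (root_likelihood_ratio nS nA nO H \<theta> w) k)"
    by (intro measure_pmf.finite_measure_mono) (auto simp: A_def)
  also have "\<dots> \<le> (\<Sum>(k, w)\<in>{..<K} \<times> ?C. measure ?M (A (likelihood_ratio nS \<theta> w) k \<union> A (root_likelihood_ratio nS nA nO H \<theta> w) k))"
    using measure_pmf.finite_measure_subadditive_finite[of "{..<K} \<times> ?C"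
      "\<lambda>(k, w). A (likelihood_ratio nS \<theta> w) k \<union> A (root_likelihood_ratio nS nA nO H \<theta> w) k"] fin
    by (simp add: case_prod_unfold)
  also have "\<dots> \<le> (\<Sum>(k, w)\<in>{..<K} \<times> ?C. 4 * exp (- \<beta>))"
  proof (rule sum_mono)
    fix p assume "p \<in> {..<K} \<times> ?C"
    then obtain k w where p: "p = (k, w)" "k < K" "w \<in> ?C" by auto
    show "(case p of (k, w) \<Rightarrow> measure ?M (A (likelihood_ratio nS \<theta> w) k \<union> A (root_likelihood_ratio nS nA nO H \<theta> w) k))
      \<le> (case p of (k, w) \<Rightarrow> 4 * exp (- \<beta>))"
      unfolding p(1) prod.case
      using measure_Un_le[of "A (likelihood_ratio nS \<theta> w) k" ?M "A (root_likelihood_ratio nS nA nO H \<theta> w) k"]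
        first[OF p(2,3)] second[OF p(2,3)] by simp
  qed
  also have "\<dots> = 4 * real K * real (card ?C) * exp (- \<beta>)"
    using fin by (simp add: card_cartesian_product case_prod_unfold)
  finally show ?thesis unfolding n_def .
qed

text \<open>Deterministic on the good event: the plain ratios keep the true model in every
  confidence set, which gives optimism, and the root ratios bound the data distances of each
  estimate.\<close>

lemma omle_regret:
  fixes nS nA nO H m K N :: nat and \<theta> :: model and \<alpha> \<beta> :: real
  assumes \<theta>: "\<theta> \<in> models nS nA nO H" and pos: "nS > 0" "nA > 0" "nO > 0" "H > 0" and m: "1 \<le> m" "m \<le> H"
    and r: "\<forall>h\<in>{1..H}. \<forall>ob<nO. 0 \<le> r h ob \<and> r h ob \<le> 1"
    and \<alpha>: "\<alpha> > 0" and rev: "min_singular_value nS nA nO H m \<theta> \<ge> \<alpha>"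
    and planner: "optimistic_planner nS nA nO H m \<alpha> \<beta> r plan"
    and N: "4 * nS * nO * H\<^sup>2 * K \<le> N" "N > 0" and \<beta>: "\<beta> \<ge> 1" and K: "K > 0"
    and supp: "(\<pi>s, D) \<in> set_pmf (omle nA H m \<theta> plan K)"
    and good: "\<And>k w. k < K \<Longrightarrow> w \<in> upper_cover nS nA nO H N \<Longrightarrow>
       weight_prod (likelihood_ratio nS \<theta> w) (take (k * (H - m + 1)) D) < exp \<beta> \<and>
       weight_prod (root_likelihood_ratio nS nA nO H \<theta> w) (take (k * (H - m + 1)) D) < exp \<beta>"
  shows "real K * optimal_value nA nO H r \<theta> - (\<Sum>\<pi>\<leftarrow>\<pi>s. policy_value H r \<theta> \<pi>)
    \<le> real H * (24 * real H * (real nS)\<^sup>2 * (real nA ^ m)\<^sup>2 * (1 + sqrt (real nS) / \<alpha>) * (1 + sqrt (real K * (60 * \<beta>))) * ln (real nS + real K))"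
proof -
  define n where "n = H - m + 1"
  have plan: "snd (plan D) \<in> policies nA nO H" if "D \<in> lists (policies nA nO H \<times> trajectories nA nO H)" for D
    using planner that unfolding optimistic_planner_def by blast
  define Dk where "Dk k = take (k * n) D" for k
  define \<theta>k where "\<theta>k k = fst (plan (Dk k))" for k
  define \<pi>k where "\<pi>k k = \<pi>s ! k" for k
  have len: "length \<pi>s = K" using set_omle[where plan = plan, OF \<theta> pos(2) plan supp] by simp
  have \<pi>k: "\<pi>k k = snd (plan (Dk k))" if "k < K" for k
    unfolding \<pi>k_def Dk_def n_def by (rule omle_policy[where plan = plan, OF \<theta> pos(2) plan supp that])
  have pre: "(take k \<pi>s, Dk k) \<in> set_pmf (omle nA H m \<theta> plan k)" if "k < K" for k
    using supp that omle_prefix[where plan = plan, OF \<theta> pos(2) plan, of k K m, symmetric] unfolding Dk_def n_def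
    by (auto simp: image_iff split: prod.splits intro!: bexI[of _ "(\<pi>s, D)"])
  have valid: "valid_data nA nO H \<theta> (Dk k)" if "k < K" for k using set_omle[where plan = plan, OF \<theta> pos(2) plan pre[OF that]] by simp
  have fstD: "map fst (Dk k) = concat (map (\<lambda>\<pi>. map (\<lambda>h. uniform_after nA h \<pi>) [0..<n]) (take k \<pi>s))" if "k < K" for k
    using set_omle[where plan = plan, OF \<theta> pos(2) plan pre[OF that]] unfolding n_def by simp
  have lists: "Dk k \<in> lists (policies nA nO H \<times> trajectories nA nO H)" if "k < K" for k
    by (rule valid_data_lists[OF valid[OF that]])
  have \<pi>pol: "\<pi>k k \<in> policies nA nO H" if "k < K" for k
    unfolding \<pi>k[OF that] by (rule plan[OF lists[OF that]])
  have true_conf: "\<theta> \<in> confidence_set nS nA nO H m \<alpha> \<beta> (Dk k)" if k: "k < K" for k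
  proof (rule true_model_in_confidence_set[OF _ valid[OF k]])
    show "\<theta> \<in> initial_confidence_set nS nA nO H m \<alpha>" using \<theta> rev by (simp add: initial_confidence_set_def)
    fix \<theta>' assume \<theta>': "\<theta>' \<in> models nS nA nO H"
    let ?w = "upper_lik nS nA nO H N \<theta>'"
    have "?w \<in> upper_cover nS nA nO H N" using \<theta>' by (simp add: upper_cover_def)
    then have "weight_prod (likelihood_ratio nS \<theta> ?w) (Dk k) \<le> exp \<beta>"
      using good[OF k, of ?w] unfolding Dk_def n_def by simp
    then have "weight_prod (\<lambda>\<pi>. pmf (traj_pmf H \<theta> \<pi>)) (Dk k) * weight_prod (likelihood_ratio nS \<theta> ?w) (Dk k)
      \<le> weight_prod (\<lambda>\<pi>. pmf (traj_pmf H \<theta> \<pi>)) (Dk k) * exp \<beta>"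
      using weight_prod_true_pos[OF valid[OF k]] by (intro mult_left_mono) auto
    then show "weight_prod (\<lambda>\<pi>. pmf (traj_pmf H \<theta>' \<pi>)) (Dk k) \<le> weight_prod (\<lambda>\<pi>. pmf (traj_pmf H \<theta> \<pi>)) (Dk k) * exp \<beta>"
      using weight_prod_model_le[OF \<theta> \<theta>' valid[OF k] upper_lik_ge[OF N(2) \<theta>' pos(1,3,4)]] by linarith
  qed
  have argmax: "is_arg_max (\<lambda>(\<theta>, \<pi>). policy_value H r \<theta> \<pi>)
      (\<lambda>(\<theta>, \<pi>). \<theta> \<in> confidence_set nS nA nO H m \<alpha> \<beta> (Dk k) \<and> \<pi> \<in> policies nA nO H) (plan (Dk k))" if k: "k < K" for k
    using planner lists[OF k] true_conf[OF k] unfolding optimistic_planner_def by blast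
  have \<theta>k_conf: "\<theta>k k \<in> confidence_set nS nA nO H m \<alpha> \<beta> (Dk k)" if k: "k < K" for k
    using argmax[OF k] unfolding is_arg_max_def \<theta>k_def by (auto simp: case_prod_unfold)
  then have \<theta>k: "\<theta>k k \<in> models nS nA nO H" "min_singular_value nS nA nO H m (\<theta>k k) \<ge> \<alpha>" if "k < K" for k
    using that by (auto simp: confidence_set_def initial_confidence_set_def)
  have optimism: "optimal_value nA nO H r \<theta> \<le> policy_value H r (\<theta>k k) (\<pi>k k)" if k: "k < K" for k
    unfolding optimal_value_def
  proof (rule cSUP_least[OF policies_nonempty[OF pos(2)]])
    fix \<pi> assume "\<pi> \<in> policies nA nO H"
    then have "\<not> policy_value H r \<theta> \<pi> > policy_value H r (\<theta>k k) (\<pi>k k)"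
      using argmax[OF k] true_conf[OF k] unfolding is_arg_max_def \<theta>k_def \<pi>k[OF k] by (auto simp: case_prod_unfold)
    then show "policy_value H r \<theta> \<pi> \<le> policy_value H r (\<theta>k k) (\<pi>k k)" by simp
  qed
  \<comment> \<open>Exponent of the excess mass of a bracket for one episode; over K H episodes it
    adds up to at most 3 / 4.\<close>
  define x where "x = 3 * real nS * real nO * real H / real N"
  have x0: "x \<ge> 0" unfolding x_def by simp
  have xK: "real K * real H * x \<le> 3 / 4"
  proof -
    have "real K * real H * (3 * real nS * real nO * real H) = 3 / 4 * real (4 * nS * nO * H\<^sup>2 * K)"
      by (simp add: power2_eq_square)
    also have "\<dots> \<le> 3 / 4 * real N" using N(1) by (intro mult_left_mono of_nat_mono) auto
    finally show ?thesis unfolding x_def using N(2) by (simp add: field_simps)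
  qed
  \<comment> \<open>For K H = 1 the bound could fail, but then k = 0 is the only iteration and there
    are no earlier data.\<close>
  have x1: "2 * x \<le> 1" if H2: "K * H \<ge> 2"
  proof -
    have "2 * x \<le> real (K * H) * x" using x0 H2 by (intro mult_right_mono) (metis of_nat_le_iff of_nat_numeral)
    then show ?thesis using xK by simp
  qed
  have dist_sq: "(traj_dist nS nA nO H \<theta> \<theta>' \<pi>)\<^sup>2 \<le> 24 * (1 - affinity nS nA nO H \<theta> (upper_lik nS nA nO H N \<theta>') \<pi>) + 28 * x"
    if \<theta>': "\<theta>' \<in> models nS nA nO H" and \<pi>: "\<pi> \<in> policies nA nO H" and KH: "K * H \<ge> 2" for \<theta>' \<pi>
  proof -
    have "exp x \<le> 1 + x + x\<^sup>2" using x0 x1[OF KH] by (intro exp_bound) auto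
    also have "x\<^sup>2 \<le> x" using x0 x1[OF KH] unfolding power2_eq_square by (intro mult_left_le) auto
    finally have "exp x \<le> 1 + 2 * x" by simp
    then have "(\<Sum>\<tau>\<in>trajectories nA nO H. policy_prob \<pi> [] \<tau> * upper_lik nS nA nO H N \<theta>' \<tau>) \<le> 1 + 2 * x"
      using upper_lik_mass[OF N(2) \<theta>' pos(1,3,4), where \<pi> = \<pi>] unfolding x_def by linarith
    from traj_dist_affinity[OF \<theta> \<theta>' \<pi> upper_lik_nonneg[OF N(2) \<theta>' pos(1,3,4)] upper_lik_ge[OF N(2) \<theta>' pos(1,3,4)] this x1[OF KH]]
    show ?thesis by simp
  qed
  have data: "(\<Sum>t<k. traj_dist nS nA nO H \<theta> (\<theta>k k) (uniform_after nA j (\<pi>k t))) \<le> sqrt (real K * (60 * \<beta>))"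
    if k: "k < K" and j: "j \<le> H - m" for k j
  proof (cases "k = 0")
    case False
    have KH: "K * H \<ge> 2" using False k pos by (metis One_nat_def Suc_leI less_one linorder_not_less mult.right_neutral mult_le_mono nat_less_le numeral_2_eq_2 order.strict_trans1)
    let ?w = "upper_lik nS nA nO H N (\<theta>k k)"
    let ?d = "\<lambda>\<pi>. (traj_dist nS nA nO H \<theta> (\<theta>k k) \<pi>)\<^sup>2"
    define q where "q = weight_prod (\<lambda>\<pi>. pmf (traj_pmf H \<theta> \<pi>)) (Dk k)"
    define R where "R = weight_prod (likelihood_ratio nS \<theta> ?w) (Dk k)"
    define s where "s = (\<Sum>\<pi>\<leftarrow>map fst (Dk k). 1 - affinity nS nA nO H \<theta> ?w \<pi>)"
    have w: "?w \<in> upper_cover nS nA nO H N" using \<theta>k k by (simp add: upper_cover_def)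
    have q: "q > 0" unfolding q_def by (rule weight_prod_true_pos[OF valid[OF k]])
    have "q * exp (- \<beta>) \<le> q * R"
      unfolding q_def R_def
      by (rule order_trans[OF confidence_set_likelihood[OF \<theta> valid[OF k] \<theta>k_conf[OF k]]
        weight_prod_model_le[OF \<theta> \<theta>k(1)[OF k] valid[OF k] upper_lik_ge[OF N(2) \<theta>k(1)[OF k] pos(1,3,4)]]])
    then have R: "exp (- \<beta>) \<le> R" using q by simp
    \<comment> \<open>The product of the root ratios is sqrt R exp s. Membership in the confidence
      set gives R \<ge> exp (- \<beta>), which leaves s < \<beta> + \<beta> / 2.\<close>
    have "sqrt R * exp s < exp \<beta>"
      using good[OF k w] unfolding R_def s_def weight_prod_mult weight_prod_sqrt weight_prod_exp Dk_def n_def by simp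
    moreover have "exp (- \<beta> / 2) \<le> sqrt R"
      by (rule real_le_rsqrt) (use R in \<open>simp add: exp_double[symmetric] flip: exp_of_nat_mult\<close>)
    ultimately have "exp (- \<beta> / 2) * exp s < exp \<beta>"
      by (meson exp_ge_zero mult_right_mono order_le_less_trans)
    then have s: "s \<le> 3 / 2 * \<beta>" by (simp flip: exp_add)
    \<comment> \<open>24 (3 / 2) \<beta> + 28 (3 / 4) = 36 \<beta> + 21 \<le> 60 \<beta>, by \<beta>
      \<ge> 1.\<close>
    have sumd: "(\<Sum>\<pi>\<leftarrow>map fst (Dk k). ?d \<pi>) \<le> 60 * \<beta>"
    proof -
      have "(\<Sum>\<pi>\<leftarrow>map fst (Dk k). ?d \<pi>) \<le> (\<Sum>\<pi>\<leftarrow>map fst (Dk k). 24 * (1 - affinity nS nA nO H \<theta> ?w \<pi>) + 28 * x)"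
        using valid[OF k] by (intro sum_list_mono dist_sq \<theta>k(1)[OF k] KH) (auto simp: valid_data_def)
      also have "\<dots> = 24 * s + 28 * (real (length (Dk k)) * x)"
        unfolding s_def sum_list_addf sum_list_const_mult by (simp add: sum_list_triv)
      also have "\<dots> \<le> 24 * (3 / 2 * \<beta>) + 28 * (3 / 4)"
      proof (intro add_mono mult_left_mono s)
        have "length (Dk k) = k * n" using set_omle[where plan = plan, OF \<theta> pos(2) plan pre[OF k]] unfolding n_def by simp
        also have "\<dots> \<le> K * H" using k m unfolding n_def by (intro mult_le_mono) auto
        finally have "real (length (Dk k)) * x \<le> real (K * H) * x" using x0 by (intro mult_right_mono of_nat_mono)
        then show "real (length (Dk k)) * x \<le> 3 / 4" using xK by simp
      qed auto
      finally show ?thesis using \<beta> by simp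
    qed
    have "(\<Sum>t<k. ?d (uniform_after nA j (\<pi>k t))) = (\<Sum>\<pi>\<leftarrow>take k \<pi>s. ?d (uniform_after nA j \<pi>))"
      using k len unfolding \<pi>k_def by (simp add: sum_list_sum_nth atLeast0LessThan)
    also have "\<dots> \<le> (\<Sum>\<pi>\<leftarrow>map fst (Dk k). ?d \<pi>)"
      unfolding fstD[OF k] using j by (intro sum_list_uniform_le) (auto simp: n_def)
    finally have sq: "(\<Sum>t<k. ?d (uniform_after nA j (\<pi>k t))) \<le> 60 * \<beta>" using sumd by linarith
    \<comment> \<open>Cauchy-Schwarz passes from squares to first powers; the resulting sqrt K is
      the origin of the rate 1 / \<epsilon>^2.\<close>
    have "(\<Sum>t<k. traj_dist nS nA nO H \<theta> (\<theta>k k) (uniform_after nA j (\<pi>k t)) * 1)\<^sup>2 \<le> (\<Sum>t<k. ?d (uniform_after nA j (\<pi>k t))) * (\<Sum>t<k. 1\<^sup>2)"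
      by (rule Cauchy_Schwarz_ineq_sum)
    also have "\<dots> \<le> (60 * \<beta>) * real K"
      using sq k \<beta> by (intro mult_mono) (auto intro: sum_nonneg)
    finally show ?thesis by (intro real_le_rsqrt) (simp add: mult_ac)
  qed (use \<beta> in simp)
  have total: "(\<Sum>k<K. traj_dist nS nA nO H \<theta> (\<theta>k k) (\<pi>k k))
    \<le> 24 * real H * (real nS)\<^sup>2 * (real nA ^ m)\<^sup>2 * (1 + sqrt (real nS) / \<alpha>) * (1 + sqrt (real K * (60 * \<beta>))) * ln (real nS + real K)"
    by (rule sum_traj_dist_le[OF \<theta> \<theta>k(1) \<theta>k(2) \<pi>pol \<alpha> m pos(1,2) _ data]) (use \<beta> in auto)
  have "real K * optimal_value nA nO H r \<theta> - (\<Sum>\<pi>\<leftarrow>\<pi>s. policy_value H r \<theta> \<pi>)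
    = (\<Sum>k<K. optimal_value nA nO H r \<theta> - policy_value H r \<theta> (\<pi>k k))"
    using len by (simp add: sum_list_sum_nth atLeast0LessThan sum_subtractf \<pi>k_def)
  also have "\<dots> \<le> (\<Sum>k<K. real H * traj_dist nS nA nO H \<theta> (\<theta>k k) (\<pi>k k))"
  proof (rule sum_mono)
    fix k assume "k \<in> {..<K}"
    then show "optimal_value nA nO H r \<theta> - policy_value H r \<theta> (\<pi>k k) \<le> real H * traj_dist nS nA nO H \<theta> (\<theta>k k) (\<pi>k k)"
      using optimism[of k] policy_value_diff[OF r \<theta> \<theta>k(1) \<pi>pol, of k k] by simp
  qed
  also have "\<dots> = real H * (\<Sum>k<K. traj_dist nS nA nO H \<theta> (\<theta>k k) (\<pi>k k))" by (simp add: sum_distrib_left)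
  also have "\<dots> \<le> real H * (24 * real H * (real nS)\<^sup>2 * (real nA ^ m)\<^sup>2 * (1 + sqrt (real nS) / \<alpha>) * (1 + sqrt (real K * (60 * \<beta>))) * ln (real nS + real K))"
    by (intro mult_left_mono total) auto
  finally show ?thesis .
qed

section \<open>Choice of the sample size\<close>

text \<open>Origin of the constant 20. With Y = SAOHK and Z = H (S^2 A + S O), the cover has at most
  M^e elements with M \<le> Y^5 and e \<le> 2 Z, so its logarithm is at most 10 Z ln Y. The factor 4
  K and the target \<delta> are paid by ln 4 \<le> Z ln Y and by ln (K H / \<delta>).\<close>

lemma union_bound_budget:
  fixes S A Ob H K :: nat and \<delta> C :: real
  assumes pos: "S > 0" "A > 0" "Ob > 0" "H > 0" and K: "K \<ge> 2" and \<delta>: "0 < \<delta>" "\<delta> \<le> 1"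
    and C: "C \<le> real ((4 * (S * A * Ob * H * K)\<^sup>2 + 1) ^ (S + (H - 1) * A * S\<^sup>2 + H * S * Ob))"
  shows "4 * real K * C * exp (- (20 * (real H * (real S ^ 2 * real A + real S * real Ob)
      * ln (real S * real A * real Ob * real H * real K) + ln (real K * real H / \<delta>)))) \<le> \<delta>"
proof -
  define Y where "Y = real S * real A * real Ob * real H * real K"
  define Z where "Z = real H * (real S ^ 2 * real A + real S * real Ob)"
  define M where "M = 4 * (S * A * Ob * H * K)\<^sup>2 + 1"
  define e where "e = S + (H - 1) * A * S\<^sup>2 + H * S * Ob"
  have nat1: "1 \<le> S * A * Ob * H" using pos by (simp add: Suc_le_eq)
  have "1 * K \<le> S * A * Ob * H * K" by (rule mult_right_mono[OF nat1]) simp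
  then have "2 \<le> S * A * Ob * H * K" using K by linarith
  then have "real 2 \<le> real (S * A * Ob * H * K)" by (rule of_nat_mono)
  then have Y: "Y \<ge> 2" unfolding Y_def by simp
  have lnY: "ln Y \<ge> ln 2" using Y by (subst ln_le_cancel_iff) auto
  then have lnY0: "ln Y \<ge> 0" using ln_2_less_1 ln2_ge_two_thirds by linarith
  have "real M = 4 * Y\<^sup>2 + 1" unfolding M_def Y_def by simp
  also have "\<dots> \<le> 5 * Y\<^sup>2"
    using Y one_le_power[of Y 2] by simp
  also have "\<dots> \<le> 2 ^ 3 * Y\<^sup>2" by simp
  also have "\<dots> \<le> Y ^ 3 * Y\<^sup>2" using Y by (intro mult_right_mono power_mono) auto
  finally have M: "real M \<le> Y ^ 5" by (simp flip: power_add)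
  have "M > 0" unfolding M_def by simp
  then have Mp: "real M > 0" by simp
  have lnM: "ln (real M) \<le> 5 * ln Y"
  proof -
    have "ln (real M) \<le> ln (Y ^ 5)" using M Mp Y by (subst ln_le_cancel_iff) auto
    then show ?thesis using Y by (simp add: ln_realpow)
  qed
  have e: "real e \<le> 2 * Z"
  proof -
    have "e \<le> H * S * Ob + H * A * S\<^sup>2 + H * S * Ob"
      unfolding e_def using pos by (intro add_mono mult_right_mono) (auto simp: Suc_le_eq)
    then have "real e \<le> real (H * S * Ob + H * A * S\<^sup>2 + H * S * Ob)" by (rule of_nat_mono)
    also have "\<dots> \<le> 2 * Z" unfolding Z_def by (simp add: algebra_simps)
    finally show ?thesis .
  qed
  have Z2: "Z \<ge> 2"
  proof -
    have "1 \<le> H" "1 \<le> S\<^sup>2 * A" "1 \<le> S * Ob" using pos by (auto simp: Suc_le_eq)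
    then have "1 * (1 + 1) \<le> H * (S\<^sup>2 * A + S * Ob)" by (intro mult_mono add_mono) auto
    then have "real (1 * (1 + 1)) \<le> real (H * (S\<^sup>2 * A + S * Ob))" by (rule of_nat_mono)
    then show ?thesis unfolding Z_def by simp
  qed
  define l where "l = ln (real K * real H / \<delta>)"
  have "real K * 1 \<le> real K * real H" using pos by (intro mult_left_mono) auto
  then have KH: "real K \<le> real K * real H" by simp
  have "1 \<le> real K * real H / \<delta>"
  proof -
    have "\<delta> \<le> real K * real H" using \<delta> KH K by linarith
    then show ?thesis using \<delta> by simp
  qed
  then have l0: "l \<ge> 0" unfolding l_def by simp
  have "4 * real K * C \<le> 4 * (real K * real H) * real (M ^ e)"
    using C KH K unfolding M_def[symmetric] e_def[symmetric]
    by (smt (verit) mult_left_mono mult_right_mono of_nat_0_le_iff)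
  also have "\<dots> = \<delta> * exp (ln 4 + l + real e * ln (real M))"
    using Mp K pos \<delta> by (simp add: exp_add l_def exp_of_nat_mult)
  also have "\<dots> \<le> \<delta> * exp (20 * (Z * ln Y + l))"
  proof (intro mult_left_mono iffD2[OF exp_le_cancel_iff])
    have "real e * ln (real M) \<le> (2 * Z) * (5 * ln Y)"
      using e lnM lnY0 Z2 Mp by (intro mult_mono) (auto simp: M_def)
    also have "\<dots> = 10 * (Z * ln Y)" by simp
    finally have i1: "real e * ln (real M) \<le> 10 * (Z * ln Y)" .
    have i2: "ln (4::real) = 2 * ln 2" using ln_realpow[of 2 2] by simp
    have i3: "2 * ln Y \<le> Z * ln Y" using Z2 lnY0 by (intro mult_right_mono) auto
    have i4: "0 \<le> Z * ln Y" using Z2 lnY0 by simp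
    have "ln 4 + l + real e * ln (real M) \<le> Z * ln Y + l + 10 * (Z * ln Y)"
      by (intro add_mono i1 order_refl) (use i2 i3 lnY in argo)
    also have "\<dots> \<le> 20 * (Z * ln Y + l)" using i4 l0 by argo
    finally show "ln 4 + l + real e * ln (real M) \<le> 20 * (Z * ln Y + l)" .
  qed (use \<delta> in auto)
  finally have main: "4 * real K * C \<le> \<delta> * exp (20 * (Z * ln Y + l))" .
  have "4 * real K * C * exp (- (20 * (Z * ln Y + l))) \<le> \<delta> * exp (20 * (Z * ln Y + l)) * exp (- (20 * (Z * ln Y + l)))"
    by (rule mult_right_mono[OF main]) simp
  also have "\<dots> = \<delta>" by (simp add: mult.assoc flip: exp_add)
  finally show ?thesis unfolding Z_def Y_def l_def .
qed

text \<open>The difficulty is that K also occurs inside the logarithms. With y = K \<epsilon>^2 and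
  u its 24th root, everything is measured in u: the assumption says Q \<le> u / 100, and all
  logarithms are at most linear in u. The total is of order u^6 sqrt K, whereas \<epsilon> K = u^12
  sqrt K.\<close>

lemma sample_size_suffices:
  fixes S A Ob H K m :: nat and \<delta> \<epsilon> \<alpha> \<beta> :: real
  defines "L \<equiv> ln (1 / \<epsilon> * (1 / \<delta>))"
    and "Z \<equiv> real H * (real S ^ 2 * real A + real S * real Ob)"
  assumes pos: "S > 0" "A > 0" "Ob > 0" "H > 0" "m > 0" and \<delta>: "0 < \<delta>" "\<delta> \<le> 1" and \<alpha>: "\<alpha> > 0"
    and \<epsilon>: "0 < \<epsilon>" "\<epsilon> < real H"
    and K: "real K \<ge> (100 * (real S * real A ^ m * real Ob * real H * (1 + 1 / \<alpha>) * (1 + L\<^sup>2))) ^ 24 * (1 / \<epsilon>\<^sup>2)"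
    and \<beta>: "\<beta> = 20 * (Z * ln (real S * real A * real Ob * real H * real K) + ln (real K * real H / \<delta>))"
  shows "K \<ge> 2" "\<beta> \<ge> 1"
    "real H * (24 * real H * (real S)\<^sup>2 * (real A ^ m)\<^sup>2 * (1 + sqrt (real S) / \<alpha>) * (1 + sqrt (real K * (60 * \<beta>))) * ln (real S + real K))
      \<le> \<epsilon> * real K"
proof -
  define W where "W = real A ^ m"
  define X where "X = real S * W * real Ob * real H * (1 + 1 / \<alpha>)"
  define Q where "Q = X * (1 + L\<^sup>2)"
  define y where "y = real K * \<epsilon>\<^sup>2"
  define u where "u = root 24 y"
  have r1: "1 \<le> real S" "1 \<le> real A" "1 \<le> real Ob" "1 \<le> real H" using pos by auto
  have W: "1 \<le> W" "real A \<le> W" unfolding W_def using r1 pos power_increasing[of 1 m "real A"] by (auto intro: one_le_power)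
  have a1: "1 \<le> 1 + 1 / \<alpha>" using \<alpha> by simp
  have prodge: "a \<le> a * b" "1 \<le> a * b" if "1 \<le> a" "1 \<le> b" for a b :: real
  proof -
    show "a \<le> a * b" using mult_left_mono[OF that(2), of a] that by simp
    then show "1 \<le> a * b" using that by linarith
  qed
  have XW: "1 \<le> real S * W" "1 \<le> real S * W * real Ob" "1 \<le> real S * W * real Ob * real H" "1 \<le> X"
    unfolding X_def using r1 W(1) a1 prodge by (meson)+
  have L1: "1 \<le> 1 + L\<^sup>2" by simp
  have Q: "X \<le> Q" "1 \<le> Q" "1 + L\<^sup>2 \<le> Q"
    unfolding Q_def using prodge[OF XW(4) L1] mult_right_mono[OF XW(4), of "1 + L\<^sup>2"] by auto
  have y: "y \<ge> (100 * Q) ^ 24"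
    using K \<epsilon> unfolding y_def Q_def X_def W_def by (simp add: field_simps)
  have ypos: "y > 0" using y Q by (smt (verit) zero_less_power)
  have u24: "u ^ 24 = y" unfolding u_def using ypos by (intro real_root_pow_pos2) auto
  have u: "u \<ge> 100 * Q"
  proof -
    have le: "root 24 ((100 * Q) ^ 24) \<le> root 24 y" using y by (intro real_root_le_mono) auto
    have eq: "root 24 ((100 * Q) ^ 24) = 100 * Q" using Q by (intro real_root_power_cancel) auto
    show ?thesis unfolding u_def by (rule le[unfolded eq])
  qed
  then have u1: "u \<ge> 100" "u \<ge> 1" "u > 0" using Q by linarith+
  have XH: "real H \<le> X"
  proof -
    have "1 * real H \<le> (real S * W * real Ob) * real H" using XW by (intro mult_right_mono) auto
    also have "\<dots> \<le> X" unfolding X_def using prodge(1)[OF XW(3) a1] .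
    finally show ?thesis by simp
  qed
  have Ky: "real K = y / \<epsilon>\<^sup>2" unfolding y_def using \<epsilon> by simp
  have Kpos: "real K > 0" unfolding Ky using ypos \<epsilon> by simp
  \<comment> \<open>\<epsilon> < H keeps \<epsilon> below u, so that K = u^24 / \<epsilon>^2 is at
    least 100.\<close>
  show K2: "K \<ge> 2"
  proof -
    have "\<epsilon> \<le> u" using \<epsilon> XH Q u by linarith
    have "100 * \<epsilon>\<^sup>2 \<le> u * u\<^sup>2" using \<open>\<epsilon> \<le> u\<close> \<epsilon> u1 by (intro mult_mono power_mono) auto
    also have "\<dots> = u ^ 3" by (simp add: power3_eq_cube power2_eq_square)
    also have "\<dots> \<le> u ^ 24" using u1 by (intro power_increasing) auto
    finally have "100 \<le> real K" unfolding Ky u24 using \<epsilon> by (simp add: pos_le_divide_eq)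
    then show ?thesis by simp
  qed
  \<comment> \<open>A common upper bound for the logarithms in \<beta>, and up to a factor 2 for ln
    (S + K).\<close>
  define \<Lambda> where "\<Lambda> = ln (X * real K / \<delta>)"
  have \<Lambda>u: "\<Lambda> \<le> 25 * u"
  proof -
    have lnK: "ln (real K) = ln y - 2 * ln \<epsilon>" unfolding Ky using ypos \<epsilon> by (simp add: ln_div ln_realpow)
    have Leq: "L = - ln \<epsilon> - ln \<delta>" unfolding L_def using \<epsilon> \<delta> by (simp add: ln_div ln_mult)
    have "\<Lambda> = ln X + ln (real K) - ln \<delta>" unfolding \<Lambda>_def using XW Kpos \<delta> by (simp add: ln_div ln_mult)
    \<comment> \<open>The term - 2 ln \<epsilon> from K and the term - ln \<delta> combine to 2 L +
      ln \<delta>. L is negative when \<epsilon> \<delta> > 1, so the polynomial contains 1 + L^2,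
      which is at least 2 L.\<close>
    also have "\<dots> = ln X + ln y + 2 * L + ln \<delta>" unfolding lnK Leq by simp
    also have "\<dots> \<le> X + ln y + (1 + L\<^sup>2) + 0"
    proof (intro add_mono)
      show "ln X \<le> X" using ln_le_minus_one[of X] XW by linarith
      show "2 * L \<le> 1 + L\<^sup>2" using sum_squares_bound[of 1 L] by simp
      show "ln \<delta> \<le> 0" using \<delta> by simp
    qed simp
    also have "ln y = 24 * ln u" unfolding u24[symmetric] using u1 by (simp add: ln_realpow)
    also have "X + 24 * ln u + (1 + L\<^sup>2) + 0 \<le> 25 * u"
      using ln_le_minus_one[of u] u1 Q u by linarith
    finally show ?thesis .
  qed
  have lnmono: "ln a \<le> \<Lambda>" if "0 < a" "a \<le> X * real K" for a
  proof -
    have "X * real K \<le> X * real K / \<delta>" using \<delta> XW Kpos by (simp add: pos_le_divide_eq mult_left_le)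
    then show ?thesis unfolding \<Lambda>_def using that by (subst ln_le_cancel_iff) (use XW Kpos \<delta> in auto)
  qed
  have \<Lambda>0: "\<Lambda> \<ge> 0"
  proof -
    have "1 \<le> X * real K" using prodge(2)[of X "real K"] XW K2 by simp
    then have "ln 1 \<le> \<Lambda>" by (intro lnmono) auto
    then show ?thesis by simp
  qed
  define Y where "Y = real S * real A * real Ob * real H * real K"
  have SAOH: "real S * real A * real Ob * real H \<le> X" "1 \<le> real S * real A * real Ob * real H"
  proof -
    have "real S * real A * real Ob * real H \<le> real S * W * real Ob * real H"
      using r1 W by (intro mult_right_mono mult_left_mono) auto
    also have "\<dots> \<le> X" unfolding X_def using prodge(1)[OF XW(3) a1] .
    finally show "real S * real A * real Ob * real H \<le> X" .
    show "1 \<le> real S * real A * real Ob * real H" using r1 prodge(2) by metis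
  qed
  have lnY: "ln Y \<le> \<Lambda>" "ln 2 \<le> ln Y"
  proof -
    have "1 * real K \<le> Y" unfolding Y_def using SAOH Kpos by (intro mult_right_mono) auto
    then have "Y \<ge> 2" using K2 by simp
    then show "ln 2 \<le> ln Y" by (subst ln_le_cancel_iff) auto
    show "ln Y \<le> \<Lambda>" using \<open>Y \<ge> 2\<close> unfolding Y_def using SAOH Kpos by (intro lnmono mult_right_mono) auto
  qed
  define l where "l = ln (real K * real H / \<delta>)"
  have l: "0 \<le> l" "l \<le> \<Lambda>"
  proof -
    have "\<delta> \<le> real K * real H" using prodge(2)[of "real K" "real H"] K2 r1 \<delta> by linarith
    then show "0 \<le> l" unfolding l_def using \<delta> by simp
    have "real K * real H / \<delta> \<le> X * real K / \<delta>" using XH \<delta> Kpos by (intro divide_right_mono) (auto simp: mult.commute)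
    then show "l \<le> \<Lambda>" unfolding l_def \<Lambda>_def using \<delta> Kpos r1 XW by (subst ln_le_cancel_iff) auto
  qed
  have Z: "1 \<le> Z" "Z \<le> 2 * X\<^sup>2"
  proof -
    have sa: "1 \<le> real S ^ 2 * real A" using r1 by (intro prodge) (auto intro: one_le_power)
    have "1 * 1 \<le> real H * (real S ^ 2 * real A + real S * real Ob)"
      using r1 sa by (intro mult_mono) (auto intro: add_increasing2)
    then show "1 \<le> Z" unfolding Z_def by simp
    have XS: "real S \<le> X"
    proof -
      have "real S \<le> real S * W" using prodge(1)[OF r1(1) W(1)] .
      also have "\<dots> \<le> real S * W * real Ob" using prodge(1)[OF XW(1) r1(3)] .
      also have "\<dots> \<le> real S * W * real Ob * real H" using prodge(1)[OF XW(2) r1(4)] .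
      also have "\<dots> \<le> X" unfolding X_def using prodge(1)[OF XW(3) a1] .
      finally show ?thesis .
    qed
    have c1: "real H * (real S * real A) \<le> X"
    proof -
      have "real H * (real S * real A) \<le> real H * (real S * real A) * real Ob"
        using r1 prodge by meson
      then show ?thesis using SAOH(1) by (simp add: mult_ac)
    qed
    have c2: "real H * (real S * real Ob) \<le> X"
    proof -
      have "real H * (real S * real Ob) \<le> real H * (real S * real Ob) * real A"
        using r1 prodge by meson
      then show ?thesis using SAOH(1) by (simp add: mult_ac)
    qed
    have "Z = (real H * (real S * real A)) * real S + real H * (real S * real Ob) * 1"
      unfolding Z_def by (simp add: power2_eq_square algebra_simps)
    also have "\<dots> \<le> X * X + X * X" using c1 c2 XS XW r1 by (intro add_mono mult_mono) auto
    finally show "Z \<le> 2 * X\<^sup>2" by (simp add: power2_eq_square)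
  qed
  have \<beta>': "\<beta> = 20 * (Z * ln Y + l)" unfolding \<beta> Y_def l_def ..
  show \<beta>1: "\<beta> \<ge> 1"
  proof -
    have "1 * ln 2 \<le> Z * ln Y" using Z lnY ln2_ge_two_thirds by (intro mult_mono) auto
    then show ?thesis unfolding \<beta>' using l ln2_ge_two_thirds by argo
  qed
  have \<beta>X: "\<beta> \<le> 60 * X\<^sup>2 * (25 * u)"
  proof -
    have X2: "1 \<le> X\<^sup>2" using XW by (intro one_le_power)
    have "0 \<le> ln Y" using lnY(2) ln2_ge_two_thirds by linarith
    then have "Z * ln Y \<le> 2 * X\<^sup>2 * \<Lambda>" using Z lnY \<Lambda>0 by (intro mult_mono) auto
    moreover have "l \<le> X\<^sup>2 * \<Lambda>" using l mult_right_mono[OF X2 \<Lambda>0] by simp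
    ultimately have "\<beta> \<le> 60 * X\<^sup>2 * \<Lambda>" unfolding \<beta>' by (simp add: algebra_simps)
    also have "\<dots> \<le> 60 * X\<^sup>2 * (25 * u)" using \<Lambda>u by (intro mult_left_mono) auto
    finally show ?thesis .
  qed
  \<comment> \<open>60 \<le> 8^2, the summand 1 raises 8 to 9, and 60 * 25 = 1500 \<le> 39^2
    together with u \<le> u^2.\<close>
  have sqrtb: "1 + sqrt (real K * (60 * \<beta>)) \<le> 9 * (sqrt (real K) * (39 * X * u))"
  proof -
    have t1: "1 \<le> real K * \<beta>" using prodge(2)[of "real K" \<beta>] K2 \<beta>1 by simp
    have "sqrt (real K * (60 * \<beta>)) \<le> sqrt (8\<^sup>2 * (real K * \<beta>))" using Kpos \<beta>1 by simp
    also have "\<dots> = 8 * sqrt (real K * \<beta>)" by (simp only: real_sqrt_mult real_sqrt_abs abs_numeral)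
    finally have "1 + sqrt (real K * (60 * \<beta>)) \<le> 9 * sqrt (real K * \<beta>)" using t1 real_sqrt_ge_one[OF t1] by linarith
    also have "sqrt (real K * \<beta>) \<le> sqrt (real K * (39 * X * u)\<^sup>2)"
    proof (intro real_sqrt_le_mono mult_left_mono)
      have "60 * X\<^sup>2 * (25 * u) \<le> 39\<^sup>2 * X\<^sup>2 * (u * u)"
      proof -
        have "1500 * X\<^sup>2 * u * 1 \<le> 1521 * X\<^sup>2 * u * u" using u1 by (intro mult_mono) auto
        then show ?thesis by (simp add: mult_ac)
      qed
      then show "\<beta> \<le> (39 * X * u)\<^sup>2" using \<beta>X by (simp add: power_mult_distrib power2_eq_square mult_ac)
    qed simp
    also have "sqrt (real K * (39 * X * u)\<^sup>2) = sqrt (real K) * (39 * X * u)"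
      using XW u1 by (simp add: real_sqrt_mult)
    finally show ?thesis by simp
  qed
  have lnSK: "ln (real S + real K) \<le> 2 * (25 * u)"
  proof -
    have K1: "1 \<le> real K" using K2 by simp
    have "real S + real K \<le> real S * real K + real S * real K"
      using prodge(1)[OF r1(1) K1] prodge(1)[OF K1 r1(1)] unfolding mult.commute[of "real K"] by (rule add_mono)
    also have "\<dots> = 2 * (real S * real K)" by simp
    also have "\<dots> \<le> (X * real K) * (X * real K)"
    proof (rule mult_mono)
      have "1 * 2 \<le> X * real K" using XW K2 by (intro mult_mono) auto
      then show "2 \<le> X * real K" by simp
      have "real S \<le> X"
        using prodge(1)[OF r1(1), of "W * real Ob * real H * (1 + 1 / \<alpha>)"] W(1) r1 a1 prodge(2) unfolding X_def
        by (simp add: mult.assoc)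
      then show "real S * real K \<le> X * real K" using Kpos by (intro mult_right_mono) auto
    qed (use XW Kpos in auto)
    finally have "ln (real S + real K) \<le> ln ((X * real K) * (X * real K))"
      using r1 Kpos XW by (subst ln_le_cancel_iff) (auto intro: mult_pos_pos)
    also have "\<dots> = 2 * ln (X * real K)" using XW Kpos by (simp add: ln_mult)
    also have "\<dots> \<le> 2 * \<Lambda>" using lnmono[of "X * real K"] XW Kpos by simp
    finally show ?thesis using \<Lambda>u by linarith
  qed
  have X3: "(real H)\<^sup>2 * (real S)\<^sup>2 * W\<^sup>2 * (1 + sqrt (real S) / \<alpha>) \<le> X ^ 3"
  proof -
    have hsw: "real H * real S * W \<le> X"
    proof -
      have "real S * W * real H \<le> real S * W * real H * real Ob"
        using XW(1) r1 prodge by meson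
      also have "\<dots> \<le> X" using prodge(1)[OF XW(3) a1] unfolding X_def by (simp add: mult_ac)
      finally show ?thesis by (simp add: mult_ac)
    qed
    have "sqrt (real S) \<le> real S" using r1 by (intro real_le_lsqrt) (auto simp: power2_eq_square)
    then have "1 + sqrt (real S) / \<alpha> \<le> real S * 1 + real S * (1 / \<alpha>)"
      using \<alpha> r1 by (intro add_mono) (auto simp: divide_right_mono)
    also have "\<dots> = real S * (1 + 1 / \<alpha>)" by (simp only: distrib_left)
    also have "\<dots> \<le> X"
    proof -
      have "1 \<le> W * (real Ob * real H)" using W(1) r1 prodge(2) by metis
      then have "(real S * (1 + 1 / \<alpha>)) * 1 \<le> (real S * (1 + 1 / \<alpha>)) * (W * (real Ob * real H))"
        using r1 a1 by (intro mult_left_mono) auto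
      then show ?thesis unfolding X_def by (simp only: mult_ac mult_1_right mult_1_left)
    qed
    finally have "(real H * real S * W)\<^sup>2 * (1 + sqrt (real S) / \<alpha>) \<le> X\<^sup>2 * X"
      using hsw r1 W \<alpha> XW by (intro mult_mono power_mono) auto
    then show ?thesis by (simp add: power_mult_distrib power3_eq_cube power2_eq_square mult_ac)
  qed
  have "real H * (24 * real H * (real S)\<^sup>2 * W\<^sup>2 * (1 + sqrt (real S) / \<alpha>) * (1 + sqrt (real K * (60 * \<beta>))) * ln (real S + real K))
    = 24 * ((real H)\<^sup>2 * (real S)\<^sup>2 * W\<^sup>2 * (1 + sqrt (real S) / \<alpha>)) * (1 + sqrt (real K * (60 * \<beta>))) * ln (real S + real K)"
    by (simp add: power2_eq_square)
  also have "\<dots> \<le> 24 * X ^ 3 * (9 * (sqrt (real K) * (39 * X * u))) * (2 * (25 * u))"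
  proof (rule mult_mono[OF mult_mono[OF _ sqrtb] lnSK])
    have "0 \<le> sqrt (real K * (60 * \<beta>))" using \<beta>1 by simp
    then show "0 \<le> 1 + sqrt (real K * (60 * \<beta>))" by simp
    show "0 \<le> ln (real S + real K)" using r1 Kpos by (intro ln_ge_zero) simp
    show "0 \<le> 24 * X ^ 3" "0 \<le> 24 * X ^ 3 * (9 * (sqrt (real K) * (39 * X * u)))"
      using XW u1 by auto
    show "24 * ((real H)\<^sup>2 * (real S)\<^sup>2 * W\<^sup>2 * (1 + sqrt (real S) / \<alpha>)) \<le> 24 * X ^ 3" using X3 by simp
  qed
  \<comment> \<open>24 * 9 * 39 * 50. Dividing by 100^4 brings it below 1, which is where the 100 in
    the sample size is spent.\<close>
  also have "\<dots> = 421200 * X ^ 4 * u\<^sup>2 * sqrt (real K)"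
    by (simp add: power2_eq_square power3_eq_cube power4_eq_xxxx mult_ac)
  also have "\<dots> \<le> 421200 * (u / 100) ^ 4 * u\<^sup>2 * sqrt (real K)"
    using Q u XW by (intro mult_right_mono mult_left_mono power_mono) auto
  also have "\<dots> \<le> 1 * u ^ 6 * sqrt (real K)"
  proof (intro mult_right_mono)
    have "421200 * (u / 100) ^ 4 * u\<^sup>2 = (421200 / 100 ^ 4) * (u ^ 4 * u\<^sup>2)" by (simp only: power_divide times_divide_eq_left times_divide_eq_right mult.assoc)
    also have "u ^ 4 * u\<^sup>2 = u ^ 6" by (simp flip: power_add)
    also have "421200 / 100 ^ 4 * u ^ 6 \<le> 1 * u ^ 6" using u1 by (intro mult_right_mono) auto
    finally show "421200 * (u / 100) ^ 4 * u\<^sup>2 \<le> 1 * u ^ 6" .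
  qed simp
  also have "\<dots> \<le> 1 * u ^ 12 * sqrt (real K)"
    using u1 Kpos by (intro mult_right_mono mult_left_mono power_increasing) auto
  also have "u ^ 12 = \<epsilon> * sqrt (real K)"
  proof -
    have "(u ^ 12)\<^sup>2 = u ^ 24" by (simp flip: power_mult)
    also have "\<dots> = (\<epsilon> * sqrt (real K))\<^sup>2"
      unfolding u24 y_def by (simp add: power_mult_distrib)
    finally have "(u ^ 12)\<^sup>2 = (\<epsilon> * sqrt (real K))\<^sup>2" .
    then show ?thesis by (rule power2_eq_imp_eq) (use u1 \<epsilon> in auto)
  qed
  also have "1 * (\<epsilon> * sqrt (real K)) * sqrt (real K) = \<epsilon> * real K" using Kpos by simp
  finally show "real H * (24 * real H * (real S)\<^sup>2 * (real A ^ m)\<^sup>2 * (1 + sqrt (real S) / \<alpha>) * (1 + sqrt (real K * (60 * \<beta>))) * ln (real S + real K))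
      \<le> \<epsilon> * real K" unfolding W_def .
qed

theorem corollary8:
  shows "\<exists>(c::real) (p :: real \<times> real \<times> real \<times> real \<times> real \<times> real \<Rightarrow> real).
    c > 0 \<and> real_polynomial_function p \<and>
    (\<forall>(\<delta>::real) (\<epsilon>::real) (\<alpha>::real) (nS::nat) (nA::nat) (nO::nat) (H::nat) (K::nat) (m::nat).
      0 < \<delta> \<and> \<delta> \<le> 1 \<and> \<epsilon> > 0 \<and> \<alpha> > 0 \<and>
      nS > 0 \<and> nA > 0 \<and> nO > 0 \<and> H > 0 \<and> K > 0 \<and> 1 \<le> m \<and> m \<le> H \<and>
      real K \<ge> p (real nS, real nA ^ m, real nO, real H, 1 / \<alpha>, ln (1 / \<epsilon> * (1 / \<delta>))) * (1 / \<epsilon>\<^sup>2)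
      \<longrightarrow>
      (let \<beta> = c * (real H * (real nS ^ 2 * real nA + real nS * real nO)
                        * ln (real nS * real nA * real nO * real H * real K)
                     + ln (real K * real H / \<delta>))
       in \<forall>\<theta> \<in> models nS nA nO H. \<forall>r :: nat \<Rightarrow> nat \<Rightarrow> real. \<forall>plan.
            (\<forall>h\<in>{1..H}. \<forall>ob<nO. 0 \<le> r h ob \<and> r h ob \<le> 1) \<and>
            min_singular_value nS nA nO H m \<theta> \<ge> \<alpha> \<and>
            optimistic_planner nS nA nO H m \<alpha> \<beta> r plan
            \<longrightarrow>
            measure_pmf.prob (omle nA H m \<theta> plan K)
              {(\<pi>s, D). 1 / real K * (\<Sum>\<pi>\<leftarrow>\<pi>s. policy_value H r \<theta> \<pi>)
                          \<ge> optimal_value nA nO H r \<theta> - \<epsilon>}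
            \<ge> 1 - \<delta>))"
proof -
  define p :: "real \<times> real \<times> real \<times> real \<times> real \<times> real \<Rightarrow> real" where
    "p = (\<lambda>x. (100 * (fst x * fst (snd x) * fst (snd (snd x)) * fst (snd (snd (snd x)))
      * (1 + fst (snd (snd (snd (snd x))))) * (1 + (snd (snd (snd (snd (snd x)))))\<^sup>2))) ^ 24)"
  have p: "real_polynomial_function p"
    unfolding p_def
    by (intro real_polynomial_function_power real_polynomial_function.intros(2-4) real_polynomial_function.intros(1)
        bounded_linear_compose[OF bounded_linear_fst] bounded_linear_compose[OF bounded_linear_snd]
        bounded_linear_fst bounded_linear_snd)
  have main: "measure_pmf.prob (omle nA H m \<theta> plan K)
      {(\<pi>s, D). 1 / real K * (\<Sum>\<pi>\<leftarrow>\<pi>s. policy_value H r \<theta> \<pi>) \<ge> optimal_value nA nO H r \<theta> - \<epsilon>} \<ge> 1 - \<delta>"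
    (is "measure_pmf.prob _ ?G \<ge> _")
    if \<delta>: "0 < \<delta>" "\<delta> \<le> 1" and \<epsilon>: "0 < \<epsilon>" and \<alpha>: "0 < \<alpha>"
      and pos: "nS > 0" "nA > 0" "nO > 0" "H > 0" "K > 0" and m: "1 \<le> m" "m \<le> H"
      and K: "real K \<ge> p (real nS, real nA ^ m, real nO, real H, 1 / \<alpha>, ln (1 / \<epsilon> * (1 / \<delta>))) * (1 / \<epsilon>\<^sup>2)"
      and \<beta>: "\<beta> = 20 * (real H * (real nS ^ 2 * real nA + real nS * real nO)
          * ln (real nS * real nA * real nO * real H * real K) + ln (real K * real H / \<delta>))"
      and \<theta>: "\<theta> \<in> models nS nA nO H" and r: "\<forall>h\<in>{1..H}. \<forall>ob<nO. 0 \<le> r h ob \<and> r h ob \<le> 1"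
      and rev: "min_singular_value nS nA nO H m \<theta> \<ge> \<alpha>"
      and planner: "optimistic_planner nS nA nO H m \<alpha> \<beta> r plan"
    for \<delta> \<epsilon> \<alpha> \<beta> :: real and nS nA nO H K m :: nat and \<theta> r plan
  proof -
    let ?M = "omle nA H m \<theta> plan K"
    have plan: "snd (plan D) \<in> policies nA nO H" if "D \<in> lists (policies nA nO H \<times> trajectories nA nO H)" for D
      using planner that unfolding optimistic_planner_def by blast
    show ?thesis
    proof (cases "real H \<le> \<epsilon>")
      \<comment> \<open>Values lie between 0 and H, so every policy is \<epsilon>-optimal. For such
        \<epsilon> the assumption on K need not even give K \<ge> 2.\<close>
      case True
      have "x \<in> ?G" if x: "x \<in> set_pmf ?M" for x
      proof -
        obtain \<pi>s D where eq: "x = (\<pi>s, D)" by force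
        have "set \<pi>s \<subseteq> policies nA nO H"
          using set_omle[where plan = plan, OF \<theta> pos(2) plan x[unfolded eq]] by simp
        then have "0 \<le> (\<Sum>\<pi>\<leftarrow>\<pi>s. policy_value H r \<theta> \<pi>)"
          using policy_value_bounds(1)[OF r \<theta>] by (intro sum_list_nonneg) auto
        moreover have "optimal_value nA nO H r \<theta> \<le> real H"
          unfolding optimal_value_def using policy_value_bounds(2)[OF r \<theta>]
          by (intro cSUP_least policies_nonempty pos) auto
        ultimately have "optimal_value nA nO H r \<theta> - \<epsilon> \<le> 0" "0 \<le> 1 / real K * (\<Sum>\<pi>\<leftarrow>\<pi>s. policy_value H r \<theta> \<pi>)"
          using True by auto
        then show ?thesis unfolding eq by simp
      qed
      then have "?G \<inter> set_pmf ?M = UNIV \<inter> set_pmf ?M" by blast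
      then have "measure_pmf.prob ?M ?G = measure_pmf.prob ?M UNIV" by (metis measure_Int_set_pmf)
      then show ?thesis using \<delta> by simp
    next
      case False
      then have \<epsilon>H: "\<epsilon> < real H" by simp
      have size: "real K \<ge> (100 * (real nS * real nA ^ m * real nO * real H * (1 + 1 / \<alpha>) * (1 + (ln (1 / \<epsilon> * (1 / \<delta>)))\<^sup>2))) ^ 24 * (1 / \<epsilon>\<^sup>2)"
        using K unfolding p_def fst_conv snd_conv .
      have "m > 0" using m by simp
      note arith = sample_size_suffices[OF pos(1-4) this \<delta> \<alpha> \<epsilon> \<epsilon>H size \<beta>]
      \<comment> \<open>Fine enough for the 3 / 4 budget of the excess mass, and polynomial in
        SAOHK, so that the logarithm of the size of the cover fits into \<beta>.\<close>
      define N where "N = 4 * (nS * nA * nO * H * K)\<^sup>2"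
      have N: "4 * nS * nO * H\<^sup>2 * K \<le> N" "N > 0"
      proof -
        have "4 * nS * nO * H\<^sup>2 * K * 1 \<le> 4 * nS * nO * H\<^sup>2 * K * (nA\<^sup>2 * nS * nO * K)"
          using pos by (intro mult_left_mono) (auto simp: Suc_le_eq)
        then show "4 * nS * nO * H\<^sup>2 * K \<le> N" unfolding N_def by (simp add: power2_eq_square mult_ac)
        show "N > 0" unfolding N_def using pos by simp
      qed
      let ?C = "upper_cover nS nA nO H N"
      define Bad where "Bad = {x :: policy list \<times> dataset. \<exists>k<K. \<exists>w\<in>?C.
         exp \<beta> \<le> weight_prod (likelihood_ratio nS \<theta> w) (take (k * (H - m + 1)) (snd x)) \<or>
         exp \<beta> \<le> weight_prod (root_likelihood_ratio nS nA nO H \<theta> w) (take (k * (H - m + 1)) (snd x))}"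
      have "measure_pmf.prob ?M Bad \<le> 4 * real K * real (card ?C) * exp (- \<beta>)"
        unfolding Bad_def by (rule omle_deviation[OF \<theta> pos(1-4) m plan N])
      also have "\<dots> \<le> \<delta>"
        unfolding \<beta>
      proof (rule union_bound_budget[OF pos(1-4) arith(1) \<delta>], rule of_nat_mono)
        show "card ?C \<le> (4 * (nS * nA * nO * H * K)\<^sup>2 + 1) ^ (nS + (H - 1) * nA * nS\<^sup>2 + H * nS * nO)"
          using upper_cover_card(2)[OF N(2), of nS nA nO H] unfolding N_def .
      qed
      finally have bad: "measure_pmf.prob ?M Bad \<le> \<delta>" .
      have "x \<in> ?G" if x: "x \<in> set_pmf ?M" "x \<notin> Bad" for x
      proof -
        obtain \<pi>s D where eq: "x = (\<pi>s, D)" by force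
        have "real K * optimal_value nA nO H r \<theta> - (\<Sum>\<pi>\<leftarrow>\<pi>s. policy_value H r \<theta> \<pi>) \<le> \<epsilon> * real K"
        proof (rule order_trans[OF omle_regret[OF \<theta> pos(1-4) m r \<alpha> rev planner N arith(2) pos(5) x(1)[unfolded eq]] arith(3)])
          show "weight_prod (likelihood_ratio nS \<theta> w) (take (k * (H - m + 1)) D) < exp \<beta> \<and>
            weight_prod (root_likelihood_ratio nS nA nO H \<theta> w) (take (k * (H - m + 1)) D) < exp \<beta>"
            if "k < K" "w \<in> ?C" for k w
            using x(2) that unfolding Bad_def eq by (auto simp: not_le)
        qed
        then show ?thesis unfolding eq using pos(5) by (simp add: field_simps)
      qed
      then have "- Bad \<inter> set_pmf ?M \<subseteq> ?G" by blast
      then have "measure_pmf.prob ?M (- Bad \<inter> set_pmf ?M) \<le> measure_pmf.prob ?M ?G"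
        by (intro measure_pmf.finite_measure_mono) auto
      moreover have "measure_pmf.prob ?M (- Bad \<inter> set_pmf ?M) = 1 - measure_pmf.prob ?M Bad"
        using measure_pmf.prob_compl[of Bad ?M] by (simp add: measure_Int_set_pmf Compl_eq_Diff_UNIV)
      ultimately show ?thesis using bad by linarith
    qed
  qed
  show ?thesis
    unfolding Let_def
    by (rule exI[of _ 20], rule exI[of _ p], intro conjI allI impI ballI, simp, rule p) (elim conjE, rule main, assumption+, rule refl, assumption+)
qed

end
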